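(* Let $N\ge 3$, $\ell\ge 2$, $p>1$, let $\Omega\subset\mathbb{R}^N$ be a nonempty open set, let $H$ be either $H_0^1(\Omega)$ or $D_0^{1,2}(\Omega)$, let $\lambda_1,\dots,\lambda_\ell\in\mathbb{R}$, and let $(\beta_{ij})$ be a real $\ell\times\ell$ matrix. Assume that: (a) for every $i$ the operator $-\Delta+\lambda_i$ is well defined and coercive in $H$; (b) $(\beta_{ij})$ satisfies the block decomposition condition with $q$ blocks, for some $1\le q\le \ell$; (c) the embedding $H\hookrightarrow L^{2p}(\Omega)$ is compact. Then the system $$-\Delta u_i+\lambda_i u_i=\sum_{j=1}^\ell\beta_{ij}|u_j|^p|u_i|^{p-2}u_i,\qquad u_i\in H,\quad i=1,\dots,\ell,$$ has a least energy block-wise nontrivial solution.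
   Context: $D_0^{1,2}(\Omega)$ is the completion of $C_c^\infty(\Omega)$ with respect to the norm $(\int_\Omega|\nabla u|^2)^{1/2}$. Solutions are understood in the weak sense, and $|t|^{p-2}t:=0$ for $t=0$. "$-\Delta+\lambda_i$ is well defined and coercive in $H$" means that $\|v\|_i:=\big(\int_\Omega(|\nabla v|^2+\lambda_i v^2)\big)^{1/2}$ is a well-defined norm in $H$, equivalent to the standard one. Block decomposition condition with $q$ blocks: $(\beta_{ij})$ is symmetric and there exist integers $0=\ell_0<\ell_1<\dots<\ell_q=\ell$ such that, with $I_h:=\{i:\ell_{h-1}<i\le\ell_h\}$ for $h=1,\dots,q$, one has $\beta_{ii}>0$ for all $i$; $\beta_{ij}\ge0$ if $i,j\in I_h$ for some $h$; and $\beta_{ij}\le 0$ if $i\in I_h$, $j\in I_k$ with $h\ne k$. Write $\mathbf{u}=(u_1,\dots,u_\ell)=(\bar u_1,\dots,\bar u_q)\in H^\ell$ with $\bar u_h=(u_i)_{i\in I_h}$, and $\|\bar u_h\|^2:=\sum_{i\in I_h}\|u_i\|_i^2$. A solution is block-wise nontrivial if $\bar u_h\neq0$ for every $h$ (at least one component of each block is nontrivial). Let $$\mathcal{J}(\mathbf{u}):=\frac12\sum_{i=1}^\ell\|u_i\|_i^2-\frac1{2p}\sum_{i,j=1}^\ell\beta_{ij}\int_\Omega|u_i|^p|u_j|^p,$$ $$\mathcal{N}:=\{\mathbf{u}\in H^\ell:\ \|\bar u_h\|\ne0\ \text{and}\ \partial_{\bar u_h}\mathcal{J}(\mathbf{u})\bar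 u_h=0\ \text{for all}\ h=1,\dots,q\},$$ where $\partial_{\bar u_h}\mathcal{J}(\mathbf{u})\bar u_h=\|\bar u_h\|^2-\sum_{i\in I_h}\sum_{j=1}^\ell\beta_{ij}\int_\Omega|u_i|^p|u_j|^p$. A least energy block-wise nontrivial solution is a block-wise nontrivial solution $\mathbf{u}$ of the system with $\mathcal{J}(\mathbf{u})=\inf_{\mathcal{N}}\mathcal{J}$. *)

theory Defs
  imports "HOL-Analysis.Analysis"
begin

section \<open>Function spaces\<close>

text \<open>Functions on \<open>\<Omega>\<close> are represented by total functions; their values outside \<open>\<Omega>\<close> never
  matter, and equality of elements of the function spaces is equality almost everywhere in \<open>\<Omega>\<close>.\<close>

primrec Ck :: "nat \<Rightarrow> ('a::euclidean_space \<Rightarrow> real) \<Rightarrow> bool" where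
  "Ck 0 f \<longleftrightarrow> continuous_on UNIV f"
| "Ck (Suc k) f \<longleftrightarrow> f differentiable_on UNIV \<and>
     (\<forall>b\<in>Basis. Ck k (\<lambda>x. frechet_derivative f (at x) b))"

definition Cc_infinity :: "'a::euclidean_space set \<Rightarrow> ('a \<Rightarrow> real) set" where
  "Cc_infinity \<Omega> = {\<phi>. (\<forall>k. Ck k \<phi>) \<and>
     compact (closure {x. \<phi> x \<noteq> 0}) \<and> closure {x. \<phi> x \<noteq> 0} \<subseteq> \<Omega>}"

definition Lp :: "real \<Rightarrow> 'a::euclidean_space set \<Rightarrow> ('a \<Rightarrow> 'b::euclidean_space) set" where
  "Lp r \<Omega> = {f \<in> borel_measurable (lebesgue_on \<Omega>).
     integrable (lebesgue_on \<Omega>) (\<lambda>x. norm (f x) powr r)}"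

definition Lp_norm :: "real \<Rightarrow> 'a::euclidean_space set \<Rightarrow> ('a \<Rightarrow> 'b::euclidean_space) \<Rightarrow> real" where
  "Lp_norm r \<Omega> f = (\<integral>x. norm (f x) powr r \<partial>lebesgue_on \<Omega>) powr (1 / r)"

definition weak_gradient ::
    "'a::euclidean_space set \<Rightarrow> ('a \<Rightarrow> real) \<Rightarrow> ('a \<Rightarrow> 'a) \<Rightarrow> bool" where
  "weak_gradient \<Omega> u g \<longleftrightarrow>
     (\<forall>K. compact K \<and> K \<subseteq> \<Omega> \<longrightarrow> u absolutely_integrable_on K \<and> g absolutely_integrable_on K) \<and>
     (\<forall>\<phi>\<in>Cc_infinity \<Omega>. \<forall>b\<in>Basis.
        (\<integral>x. u x * frechet_derivative \<phi> (at x) b \<partial>lebesgue_on \<Omega>)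
          = - (\<integral>x. (g x \<bullet> b) * \<phi> x \<partial>lebesgue_on \<Omega>))"

text \<open>The weak gradient is unique almost everywhere in \<open>\<Omega>\<close>; \<open>wgrad\<close> picks a representative.\<close>

definition wgrad :: "'a::euclidean_space set \<Rightarrow> ('a \<Rightarrow> real) \<Rightarrow> 'a \<Rightarrow> 'a" where
  "wgrad \<Omega> u = (SOME g. weak_gradient \<Omega> u g)"

definition H1 :: "'a::euclidean_space set \<Rightarrow> ('a \<Rightarrow> real) set" where
  "H1 \<Omega> = {u \<in> Lp 2 \<Omega>. \<exists>g\<in>Lp 2 \<Omega>. weak_gradient \<Omega> u g}"

definition H1_norm :: "'a::euclidean_space set \<Rightarrow> ('a \<Rightarrow> real) \<Rightarrow> real" where
  "H1_norm \<Omega> u = sqrt (\<integral>x. (norm (wgrad \<Omega> u x))\<^sup>2 + (u x)\<^sup>2 \<partial>lebesgue_on \<Omega>)"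

definition H10 :: "'a::euclidean_space set \<Rightarrow> ('a \<Rightarrow> real) set" where
  "H10 \<Omega> = {u \<in> H1 \<Omega>. \<exists>\<phi>. (\<forall>n. \<phi> n \<in> Cc_infinity \<Omega>) \<and>
     (\<lambda>n. H1_norm \<Omega> (\<lambda>x. \<phi> n x - u x)) \<longlonglongrightarrow> 0}"

definition D12_norm :: "'a::euclidean_space set \<Rightarrow> ('a \<Rightarrow> real) \<Rightarrow> real" where
  "D12_norm \<Omega> u = sqrt (\<integral>x. (norm (wgrad \<Omega> u x))\<^sup>2 \<partial>lebesgue_on \<Omega>)"

text \<open>The completion of \<open>Cc_infinity \<Omega>\<close> with respect to \<open>D12_norm \<Omega>\<close>, realised as a space of
  functions: its elements are the almost everywhere limits of Cauchy sequences of test functions.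
  In dimension at least 3 the Sobolev inequality bounds the norm of \<open>L\<^bsup>2*\<^esup>\<close>, where
  \<open>2* = 2N/(N-2)\<close>, by \<open>D12_norm\<close>. Hence every Cauchy sequence has a subsequence that converges
  almost everywhere, and the limit determines (and is determined almost everywhere by) the
  class of the Cauchy sequence in the abstract completion.\<close>

definition D012 :: "'a::euclidean_space set \<Rightarrow> ('a \<Rightarrow> real) set" where
  "D012 \<Omega> = {u. \<exists>\<phi>. (\<forall>n. \<phi> n \<in> Cc_infinity \<Omega>) \<and>
     (\<forall>e>0. \<exists>M. \<forall>m\<ge>M. \<forall>n\<ge>M. D12_norm \<Omega> (\<lambda>x. \<phi> m x - \<phi> n x) < e) \<and>
     (AE x in lebesgue_on \<Omega>. (\<lambda>n. \<phi> n x) \<longlonglongrightarrow> u x)}"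

definition is_norm_on ::
    "'a::euclidean_space set \<Rightarrow> ('a \<Rightarrow> real) set \<Rightarrow> (('a \<Rightarrow> real) \<Rightarrow> real) \<Rightarrow> bool" where
  "is_norm_on \<Omega> H nrm \<longleftrightarrow>
     (\<forall>u\<in>H. 0 \<le> nrm u \<and> (nrm u = 0 \<longleftrightarrow> (AE x in lebesgue_on \<Omega>. u x = 0))) \<and>
     (\<forall>u\<in>H. \<forall>c. nrm (\<lambda>x. c * u x) = \<bar>c\<bar> * nrm u) \<and>
     (\<forall>u\<in>H. \<forall>v\<in>H. nrm (\<lambda>x. u x + v x) \<le> nrm u + nrm v)"

definition shifted_norm :: "'a::euclidean_space set \<Rightarrow> real \<Rightarrow> ('a \<Rightarrow> real) \<Rightarrow> real" where
  "shifted_norm \<Omega> \<mu> v = sqrt (\<integral>x. (norm (wgrad \<Omega> v x))\<^sup>2 + \<mu> * (v x)\<^sup>2 \<partial>lebesgue_on \<Omega>)"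

text \<open>The operator \<open>-\<Delta> + \<mu>\<close> is well defined and coercive in \<open>H\<close>, whose standard norm is \<open>nrm\<close>.\<close>

definition well_defined_coercive ::
    "'a::euclidean_space set \<Rightarrow> ('a \<Rightarrow> real) set \<Rightarrow> (('a \<Rightarrow> real) \<Rightarrow> real) \<Rightarrow> real \<Rightarrow> bool" where
  "well_defined_coercive \<Omega> H nrm \<mu> \<longleftrightarrow>
     (\<forall>v\<in>H. integrable (lebesgue_on \<Omega>) (\<lambda>x. (norm (wgrad \<Omega> v x))\<^sup>2 + \<mu> * (v x)\<^sup>2) \<and>
        0 \<le> (\<integral>x. (norm (wgrad \<Omega> v x))\<^sup>2 + \<mu> * (v x)\<^sup>2 \<partial>lebesgue_on \<Omega>)) \<and>
     is_norm_on \<Omega> H (shifted_norm \<Omega> \<mu>) \<and>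
     (\<exists>c>0. \<exists>C>0. \<forall>v\<in>H. c * nrm v \<le> shifted_norm \<Omega> \<mu> v \<and> shifted_norm \<Omega> \<mu> v \<le> C * nrm v)"

definition compactly_embedded_Lp ::
    "'a::euclidean_space set \<Rightarrow> ('a \<Rightarrow> real) set \<Rightarrow> (('a \<Rightarrow> real) \<Rightarrow> real) \<Rightarrow> real \<Rightarrow> bool" where
  "compactly_embedded_Lp \<Omega> H nrm r \<longleftrightarrow> H \<subseteq> Lp r \<Omega> \<and>
     (\<forall>v B. (\<forall>n. v n \<in> H \<and> nrm (v n) \<le> B) \<longrightarrow>
        (\<exists>s::nat \<Rightarrow> nat. \<exists>w\<in>Lp r \<Omega>. strict_mono s \<and>
           (\<lambda>n. Lp_norm r \<Omega> (\<lambda>x. v (s n) x - w x)) \<longlonglongrightarrow> 0))"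

section \<open>The system\<close>

text \<open>Components and blocks are numbered from 1, so the component indices are \<open>{1..l}\<close>. The
  values of \<open>\<beta>\<close>, \<open>lam\<close> and \<open>u\<close> at other indices are irrelevant.\<close>

definition block :: "(nat \<Rightarrow> nat) \<Rightarrow> nat \<Rightarrow> nat set" where
  "block L h = {i. L (h - 1) < i \<and> i \<le> L h}"

definition block_decomposition ::
    "nat \<Rightarrow> nat \<Rightarrow> (nat \<Rightarrow> nat) \<Rightarrow> (nat \<Rightarrow> nat \<Rightarrow> real) \<Rightarrow> bool" where
  "block_decomposition l q L \<beta> \<longleftrightarrow>
     (\<forall>i\<in>{1..l}. \<forall>j\<in>{1..l}. \<beta> i j = \<beta> j i) \<and>
     L 0 = 0 \<and> L q = l \<and> (\<forall>h<q. L h < L (Suc h)) \<and>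
     (\<forall>i\<in>{1..l}. \<beta> i i > 0) \<and>
     (\<forall>h\<in>{1..q}. \<forall>i\<in>block L h. \<forall>j\<in>block L h. \<beta> i j \<ge> 0) \<and>
     (\<forall>h\<in>{1..q}. \<forall>k\<in>{1..q}. h \<noteq> k \<longrightarrow> (\<forall>i\<in>block L h. \<forall>j\<in>block L k. \<beta> i j \<le> 0))"

definition interaction ::
    "'a::euclidean_space set \<Rightarrow> real \<Rightarrow> ('a \<Rightarrow> real) \<Rightarrow> ('a \<Rightarrow> real) \<Rightarrow> real" where
  "interaction \<Omega> p v w = (\<integral>x. \<bar>v x\<bar> powr p * \<bar>w x\<bar> powr p \<partial>lebesgue_on \<Omega>)"

text \<open>Since \<open>0 powr a = 0\<close> for every \<open>a\<close>, the factor \<open>\<bar>t\<bar> powr (p - 2) * t\<close> vanishes at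
  \<open>t = 0\<close> also when \<open>p \<le> 2\<close>.\<close>

definition weak_solution ::
    "'a::euclidean_space set \<Rightarrow> ('a \<Rightarrow> real) set \<Rightarrow> real \<Rightarrow> nat \<Rightarrow> (nat \<Rightarrow> real) \<Rightarrow>
     (nat \<Rightarrow> nat \<Rightarrow> real) \<Rightarrow> (nat \<Rightarrow> 'a \<Rightarrow> real) \<Rightarrow> bool" where
  "weak_solution \<Omega> H p l lam \<beta> u \<longleftrightarrow>
     (\<forall>i\<in>{1..l}. u i \<in> H) \<and>
     (\<forall>i\<in>{1..l}. \<forall>v\<in>H.
        (\<integral>x. wgrad \<Omega> (u i) x \<bullet> wgrad \<Omega> v x + lam i * u i x * v x \<partial>lebesgue_on \<Omega>)
          = (\<Sum>j=1..l. \<beta> i j *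
               (\<integral>x. \<bar>u j x\<bar> powr p * (\<bar>u i x\<bar> powr (p - 2) * u i x) * v x \<partial>lebesgue_on \<Omega>)))"

definition block_norm ::
    "'a::euclidean_space set \<Rightarrow> (nat \<Rightarrow> real) \<Rightarrow> (nat \<Rightarrow> nat) \<Rightarrow> nat \<Rightarrow>
     (nat \<Rightarrow> 'a \<Rightarrow> real) \<Rightarrow> real" where
  "block_norm \<Omega> lam L h u = sqrt (\<Sum>i\<in>block L h. (shifted_norm \<Omega> (lam i) (u i))\<^sup>2)"

definition energy ::
    "'a::euclidean_space set \<Rightarrow> real \<Rightarrow> nat \<Rightarrow> (nat \<Rightarrow> real) \<Rightarrow>
     (nat \<Rightarrow> nat \<Rightarrow> real) \<Rightarrow> (nat \<Rightarrow> 'a \<Rightarrow> real) \<Rightarrow> real" where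
  "energy \<Omega> p l lam \<beta> u =
     1 / 2 * (\<Sum>i=1..l. (shifted_norm \<Omega> (lam i) (u i))\<^sup>2)
     - 1 / (2 * p) * (\<Sum>i=1..l. \<Sum>j=1..l. \<beta> i j * interaction \<Omega> p (u i) (u j))"

text \<open>The partial derivative of the energy with respect to the \<open>h\<close>-th block, applied to that
  block itself.\<close>

definition block_derivative ::
    "'a::euclidean_space set \<Rightarrow> real \<Rightarrow> nat \<Rightarrow> (nat \<Rightarrow> real) \<Rightarrow>
     (nat \<Rightarrow> nat \<Rightarrow> real) \<Rightarrow> (nat \<Rightarrow> nat) \<Rightarrow> nat \<Rightarrow> (nat \<Rightarrow> 'a \<Rightarrow> real) \<Rightarrow> real" where
  "block_derivative \<Omega> p l lam \<beta> L h u =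
     (block_norm \<Omega> lam L h u)\<^sup>2
     - (\<Sum>i\<in>block L h. \<Sum>j=1..l. \<beta> i j * interaction \<Omega> p (u i) (u j))"

definition nehari ::
    "'a::euclidean_space set \<Rightarrow> ('a \<Rightarrow> real) set \<Rightarrow> real \<Rightarrow> nat \<Rightarrow> nat \<Rightarrow> (nat \<Rightarrow> real) \<Rightarrow>
     (nat \<Rightarrow> nat \<Rightarrow> real) \<Rightarrow> (nat \<Rightarrow> nat) \<Rightarrow> (nat \<Rightarrow> 'a \<Rightarrow> real) set" where
  "nehari \<Omega> H p l q lam \<beta> L = {u. (\<forall>i\<in>{1..l}. u i \<in> H) \<and>
     (\<forall>h\<in>{1..q}. block_norm \<Omega> lam L h u \<noteq> 0 \<and> block_derivative \<Omega> p l lam \<beta> L h u = 0)}"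

definition blockwise_nontrivial ::
    "'a::euclidean_space set \<Rightarrow> nat \<Rightarrow> (nat \<Rightarrow> nat) \<Rightarrow> (nat \<Rightarrow> 'a \<Rightarrow> real) \<Rightarrow> bool" where
  "blockwise_nontrivial \<Omega> q L u \<longleftrightarrow>
     (\<forall>h\<in>{1..q}. \<exists>i\<in>block L h. \<not> (AE x in lebesgue_on \<Omega>. u i x = 0))"

text \<open>The infimum is taken in the extended reals, so that it is meaningful without knowing
  beforehand that the energy is bounded below on a nonempty set.\<close>

definition least_energy_solution ::
    "'a::euclidean_space set \<Rightarrow> ('a \<Rightarrow> real) set \<Rightarrow> real \<Rightarrow> nat \<Rightarrow> nat \<Rightarrow> (nat \<Rightarrow> real) \<Rightarrow>
     (nat \<Rightarrow> nat \<Rightarrow> real) \<Rightarrow> (nat \<Rightarrow> nat) \<Rightarrow> (nat \<Rightarrow> 'a \<Rightarrow> real) \<Rightarrow> bool" where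
  "least_energy_solution \<Omega> H p l q lam \<beta> L u \<longleftrightarrow>
     weak_solution \<Omega> H p l lam \<beta> u \<and> blockwise_nontrivial \<Omega> q L u \<and>
     ereal (energy \<Omega> p l lam \<beta> u) =
       (INF w\<in>nehari \<Omega> H p l q lam \<beta> L. ereal (energy \<Omega> p l lam \<beta> w))"

end

theory Submission
  imports Defs
begin

text \<open>
  Write \<open>a\<^sub>h\<close> for the squared norm of the block \<open>h\<close> of \<open>u\<close>, and \<open>b\<^sub>h\<^sub>k\<close> for the sum of
  \<open>\<beta>\<^sub>i\<^sub>j \<integral> |u\<^sub>i|\<^sup>p |u\<^sub>j|\<^sup>p\<close> over \<open>i\<close> in block \<open>h\<close> and \<open>j\<close> in block \<open>k\<close>. Multiplying block \<open>h\<close> by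
  \<open>s\<^sub>h > 0\<close> turns the energy into an explicit function of \<open>s\<close> (\<open>fibre\<close>) which depends on \<open>u\<close>
  through \<open>a\<close> and \<open>b\<close> only, and the multiple lies on the Nehari set exactly when \<open>s\<close> is a
  critical point. The block decomposition condition makes the entries of \<open>b\<close> off the diagonal
  nonpositive. Hence, as soon as all row sums of \<open>b\<close> are positive, \<open>b\<close> is diagonally dominant and
  a critical point exists (\<open>fibre_critical_exists\<close>); comparing the critical equations at the
  largest and at the smallest coordinate traps every \<open>s\<^sub>h\<close> to the power \<open>2p-2\<close> between the extreme
  quotients of \<open>a\<^sub>h\<close> by the row sums (\<open>fibre_critical_bounds\<close>). The whole variational argument
  consists of these two facts and the observation that on the Nehari set, where the row sums equal
  \<open>a\<^sub>h\<close>, the point \<open>s = 1\<close> maximises the fibre (\<open>fibre_le\<close>).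

  Existence of a minimiser (\<open>minimizer_exists\<close>): on the Nehari set the energy is a positive
  multiple of the sum of the \<open>a\<^sub>h\<close>, so minimising sequences are bounded. Along a subsequence they
  converge in \<open>L\<^sup>2\<^sup>p\<close> to some \<open>w\<close>; the interactions pass to the limit and the norms are lower
  semicontinuous, so \<open>a\<^sub>h(w)\<close> is at most the row sum of \<open>b(w)\<close>, which is the limit of the squared
  norms and stays away from \<open>0\<close>. Hence the critical \<open>s\<close> for \<open>w\<close> has \<open>s\<^sub>h \<le> 1\<close>, and the multiple of
  \<open>w\<close> has no more energy than the infimum.

  A minimiser \<open>u\<close> solves the system (\<open>minimizer_is_solution\<close>): perturb one component to
  \<open>u\<^sub>i + \<epsilon> v\<close> and project back by a critical \<open>s\<^sub>\<epsilon>\<close>. The projected point has at least the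
  energy of \<open>u\<close>, which in turn is at least the energy of \<open>s\<^sub>\<epsilon> u\<close>; dividing by \<open>\<epsilon>\<close> of either sign
  and using \<open>s\<^sub>\<epsilon> \<rightarrow> 1\<close> leaves the vanishing of the derivative of the energy in the direction \<open>v\<close>
  (\<open>fibre_envelope\<close>).

  On the side of the function spaces, smooth bumps give the fundamental lemma of the calculus of
  variations (\<open>fundamental_lemma\<close>), so weak gradients are unique and \<open>wgrad\<close> is linear almost
  everywhere; the shifted norms are then given by bilinear forms. By scaling, compactness of the
  embedding into \<open>L\<^sup>2\<^sup>p\<close> makes it bounded (\<open>embedding\<close>), which turns almost everywhere limits of
  Cauchy sequences of test functions into \<open>L\<^sup>2\<^sup>p\<close> limits, so that the elements of \<open>D012\<close> have weak
  gradients (\<open>approximation\<close>). Lower semicontinuity (\<open>lower_semicontinuous\<close>) comes from the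
  parallelogram law: test functions closer and closer to \<open>w\<close> in \<open>L\<^sup>2\<^sup>p\<close> whose norm is almost the
  smallest possible form a Cauchy sequence.
\<close>

section \<open>Smooth bump functions\<close>

lemma Ck_frechetI:
  assumes "\<And>x. (f has_derivative f' x) (at x)"
    and "\<And>b. b \<in> Basis \<Longrightarrow> Ck k (\<lambda>x. f' x b)"
  shows "Ck (Suc k) f"
proof -
  have "frechet_derivative f (at x) = f' x" for x
    using frechet_derivative_at[OF assms(1)] by simp
  then show ?thesis
    using assms by (auto simp: differentiable_on_def differentiable_def)
qed

lemma Ck_SucD: "Ck (Suc k) f \<Longrightarrow> (f has_derivative frechet_derivative f (at x)) (at x)"
  using frechet_derivative_works by (auto simp: differentiable_on_def)

lemma Ck_Suc_imp_Ck: "Ck (Suc k) f \<Longrightarrow> Ck k f"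
proof (induction k arbitrary: f)
  case 0
  then show ?case by (simp add: differentiable_imp_continuous_on)
qed auto

lemma Ck_const: "Ck k (\<lambda>x. c)"
  by (induction k arbitrary: c) auto

lemma Ck_cmult: "Ck k f \<Longrightarrow> Ck k (\<lambda>x. c * f x)"
proof (induction k arbitrary: f)
  case 0
  then show ?case by (simp, intro continuous_intros)
next
  case (Suc k)
  show ?case
  proof (rule Ck_frechetI)
    show "((\<lambda>x. c * f x) has_derivative (\<lambda>y. c * frechet_derivative f (at x) y)) (at x)" for x
      using Ck_SucD[OF Suc.prems] by (rule has_derivative_mult_right)
  qed (use Suc in auto)
qed

lemma Ck_add: "Ck k f \<Longrightarrow> Ck k g \<Longrightarrow> Ck k (\<lambda>x. f x + g x)"
proof (induction k arbitrary: f g)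
  case 0
  then show ?case by (simp, intro continuous_intros)
next
  case (Suc k)
  show ?case
  proof (rule Ck_frechetI)
    show "((\<lambda>x. f x + g x) has_derivative
        (\<lambda>y. frechet_derivative f (at x) y + frechet_derivative g (at x) y)) (at x)" for x
      using Suc.prems by (intro has_derivative_add Ck_SucD)
  qed (use Suc in auto)
qed

lemma Ck_mult: "Ck k f \<Longrightarrow> Ck k g \<Longrightarrow> Ck k (\<lambda>x. f x * g x)"
proof (induction k arbitrary: f g)
  case 0
  then show ?case by (simp, intro continuous_intros)
next
  case (Suc k)
  show ?case
  proof (rule Ck_frechetI)
    show "((\<lambda>x. f x * g x) has_derivative
        (\<lambda>y. f x * frechet_derivative g (at x) y + frechet_derivative f (at x) y * g x)) (at x)" for x
      using Suc.prems by (intro has_derivative_mult Ck_SucD)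
    show "Ck k (\<lambda>x. f x * frechet_derivative g (at x) b + frechet_derivative f (at x) b * g x)"
      if "b \<in> Basis" for b
      using Suc.prems that by (intro Ck_add Suc.IH) (auto intro: Ck_Suc_imp_Ck simp del: Ck.simps(1))
  qed
qed

lemma Ck_prod: "finite I \<Longrightarrow> (\<And>i. i \<in> I \<Longrightarrow> Ck k (f i)) \<Longrightarrow> Ck k (\<lambda>x. \<Prod>i\<in>I. f i x)"
  by (induction I rule: finite_induct) (auto intro: Ck_const Ck_mult)

text \<open>The function \<open>exp (-1/x) / x\<^sup>k\<close>, continued by \<open>0\<close>. The derivative
  of each member of this family is a combination of the next two, so smoothness of all of them follows by one
  induction.\<close>

definition exp_inverse :: "nat \<Rightarrow> real \<Rightarrow> real" where
  "exp_inverse k x = (if 0 < x then exp (- inverse x) * inverse x ^ k else 0)"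

text \<open>At \<open>y = 1/x\<close> this is \<open>y\<^bsup>k+2\<^esup> / (k+2)! \<le> exp y\<close>. A
  quadratic bound at the origin is what makes the derivative there vanish from both sides.\<close>

lemma exp_inverse_bound: "\<bar>exp_inverse k x\<bar> \<le> fact (k + 2) * x\<^sup>2"
proof (cases "0 < x")
  case True
  define y where "y = inverse x"
  have y: "y > 0" "x = inverse y" using True by (auto simp: y_def)
  have "y ^ (k + 2) / fact (k + 2) \<le> exp y"
    using sum_le_suminf[OF sums_summable[OF exp_converges], of "{k + 2}" y] y(1) sums_unique[OF exp_converges, of y]
    by (simp add: divide_inverse mult.commute)
  then have "y ^ (k + 2) \<le> fact (k + 2) * exp y"
    by (subst (asm) pos_divide_le_eq) (auto simp: mult.commute)
  then have "y ^ (k + 2) * exp (- y) * x\<^sup>2 \<le> fact (k + 2) * exp y * exp (- y) * x\<^sup>2"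
    by (intro mult_right_mono) auto
  moreover have "y ^ (k + 2) * x\<^sup>2 = y ^ k"
    using y(1) by (simp add: y(2) power_add power_inverse field_simps power2_eq_square)
  moreover have "exp y * exp (- y) = 1"
    by (simp add: exp_minus)
  ultimately have "exp (- y) * y ^ k \<le> fact (k + 2) * x\<^sup>2"
    by (metis (no_types, opaque_lifting) mult.assoc mult.commute mult.right_neutral)
  then show ?thesis using True y(1) by (simp add: exp_inverse_def y_def)
next
  case False
  then show ?thesis by (simp add: exp_inverse_def)
qed

lemma exp_inverse_deriv:
  "(exp_inverse k has_real_derivative (exp_inverse (k + 2) x - k * exp_inverse (k + 1) x)) (at x)"
proof -
  consider "x > 0" | "x < 0" | "x = 0" by linarith
  then show ?thesis
  proof cases
    case 1
    have "((\<lambda>x. exp (- inverse x) * inverse x ^ k) has_real_derivative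
       (exp (- inverse x) * (k * inverse x ^ (k - 1) * - (inverse x)\<^sup>2)
        + exp (- inverse x) * (inverse x)\<^sup>2 * inverse x ^ k)) (at x)"
      using 1 by (auto intro!: derivative_eq_intros simp: power2_eq_square)
    also have "exp (- inverse x) * (k * inverse x ^ (k - 1) * - (inverse x)\<^sup>2)
        + exp (- inverse x) * (inverse x)\<^sup>2 * inverse x ^ k = exp_inverse (k + 2) x - k * exp_inverse (k + 1) x"
      using 1 by (cases k) (auto simp: exp_inverse_def algebra_simps power2_eq_square simp del: power_inverse)
    finally have "((\<lambda>x. exp (- inverse x) * inverse x ^ k) has_real_derivative
       (exp_inverse (k + 2) x - k * exp_inverse (k + 1) x)) (at x)" .
    then show ?thesis
      by (rule has_field_derivative_transform_within_open[of _ _ _ "{0<..}"])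
        (use 1 in \<open>auto simp: exp_inverse_def\<close>)
  next
    case 2
    have "((\<lambda>x. 0) has_real_derivative
       (exp_inverse (k + 2) x - k * exp_inverse (k + 1) x)) (at x)"
      using 2 by (auto simp: exp_inverse_def)
    then show ?thesis
      by (rule has_field_derivative_transform_within_open[of _ _ _ "{..<0}"])
        (use 2 in \<open>auto simp: exp_inverse_def\<close>)
  next
    case 3
    have "((\<lambda>h. exp_inverse k h / h) \<longlongrightarrow> 0) (at 0)"
    proof (rule Lim_null_comparison)
      show "\<forall>\<^sub>F h in at 0. norm (exp_inverse k h / h) \<le> fact (k + 2) * \<bar>h\<bar>"
      proof (rule always_eventually, intro allI)
        fix h :: real
        have "\<bar>exp_inverse k h\<bar> \<le> (fact (k + 2) * \<bar>h\<bar>) * \<bar>h\<bar>"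
          using exp_inverse_bound[of k h] by (simp only: mult.assoc abs_mult_self_eq power2_eq_square)
        then show "norm (exp_inverse k h / h) \<le> fact (k + 2) * \<bar>h\<bar>"
          by (cases "h = 0") (simp, simp add: pos_divide_le_eq del: fact_Suc)
      qed
      show "((\<lambda>h. fact (k + 2) * \<bar>h\<bar>) \<longlongrightarrow> 0) (at (0::real))"
        by (auto intro!: tendsto_eq_intros)
    qed
    then show ?thesis using 3 by (simp add: DERIV_def exp_inverse_def)
  qed
qed

lemma Ck_exp_inverse: "Ck n (\<lambda>x. exp_inverse k (c * (x \<bullet> b) + d))"
proof (induction n arbitrary: k)
  case 0
  have "continuous_on UNIV (exp_inverse k)"
    using exp_inverse_deriv by (meson DERIV_isCont continuous_at_imp_continuous_on)
  then have "continuous_on UNIV (exp_inverse k \<circ> (\<lambda>x. c * (x \<bullet> b) + d))"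
    by (intro continuous_on_compose continuous_intros) (auto intro: continuous_on_subset)
  then show ?case by (simp add: o_def)
next
  case (Suc n)
  show ?case
  proof (rule Ck_frechetI)
    fix x :: 'a
    have "((\<lambda>x. exp_inverse k (c * (x \<bullet> b) + d)) has_derivative
        (\<lambda>y. (c * (y \<bullet> b)) * (exp_inverse (k + 2) (c * (x \<bullet> b) + d) - k * exp_inverse (k + 1) (c * (x \<bullet> b) + d)))) (at x)"
      using exp_inverse_deriv
      by (intro DERIV_compose_FDERIV) (auto intro!: derivative_eq_intros)
    then show "((\<lambda>x. exp_inverse k (c * (x \<bullet> b) + d)) has_derivative
        (\<lambda>y. (c * (y \<bullet> b)) * (exp_inverse (k + 2) (c * (x \<bullet> b) + d) + (- k) * exp_inverse (k + 1) (c * (x \<bullet> b) + d)))) (at x)"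
      by simp
  qed (intro Ck_cmult Ck_add Suc.IH)
qed

text \<open>A smooth function that is positive exactly on the open box; it increases to the indicator of the
  box as \<open>n\<close> grows.\<close>

definition bump :: "'a::euclidean_space \<Rightarrow> 'a \<Rightarrow> nat \<Rightarrow> 'a \<Rightarrow> real" where
  "bump a b n x = (\<Prod>i\<in>Basis. exp_inverse 0 (Suc n * (x \<bullet> i - a \<bullet> i)) * exp_inverse 0 (Suc n * (b \<bullet> i - x \<bullet> i)))"

lemma exp_inverse_0: "0 \<le> exp_inverse 0 x" "exp_inverse 0 x \<le> 1" "0 < exp_inverse 0 x \<longleftrightarrow> 0 < x"
  by (auto simp: exp_inverse_def)

lemma bump_bounds: "0 \<le> bump a b n x" "bump a b n x \<le> 1"
  unfolding bump_def by (auto intro!: prod_nonneg prod_le_1 mult_nonneg_nonneg mult_le_one simp: exp_inverse_0)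

lemma bump_nonzero_iff: "bump a b n x \<noteq> 0 \<longleftrightarrow> x \<in> box a b"
proof -
  have "exp_inverse 0 (Suc n * t) \<noteq> 0 \<longleftrightarrow> 0 < t" for t :: real
    by (simp add: exp_inverse_def zero_less_mult_iff del: of_nat_Suc)
  then show ?thesis unfolding bump_def by (auto simp: mem_box)
qed

lemma bump_tendsto: "(\<lambda>n. bump a b n x) \<longlonglongrightarrow> indicator (box a b) x"
proof -
  have 1: "(\<lambda>n. exp_inverse 0 (Suc n * t)) \<longlonglongrightarrow> (if 0 < t then 1 else 0)" for t :: real
  proof (cases "0 < t")
    case True
    have "(\<lambda>n. exp (- (inverse (Suc n) * inverse t))) \<longlonglongrightarrow> exp (- (0 * inverse t))"
      using LIMSEQ_inverse_real_of_nat by (intro tendsto_intros)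
    then show ?thesis using True by (simp add: exp_inverse_def zero_less_mult_iff del: of_nat_Suc)
  qed (simp add: exp_inverse_def zero_less_mult_iff del: of_nat_Suc)
  have "(\<lambda>n. bump a b n x) \<longlonglongrightarrow>
      (\<Prod>i\<in>Basis. (if 0 < x \<bullet> i - a \<bullet> i then 1 else 0) * (if 0 < b \<bullet> i - x \<bullet> i then 1 else 0))"
    unfolding bump_def by (intro tendsto_intros 1)
  moreover have "(\<Prod>i\<in>Basis. (if 0 < x \<bullet> i - a \<bullet> i then 1 else 0) * (if 0 < b \<bullet> i - x \<bullet> i then 1 else 0)) = (indicator (box a b) x :: real)"
    by (auto simp: mem_box indicator_def intro!: prod.neutral)
  ultimately show ?thesis by simp
qed

lemma Ck_bump: "Ck k (bump a b n)"
proof -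
  have *: "Suc n * (x \<bullet> i - a \<bullet> i) = Suc n * (x \<bullet> i) + - (Suc n * (a \<bullet> i))"
    "Suc n * (b \<bullet> i - x \<bullet> i) = - real (Suc n) * (x \<bullet> i) + Suc n * (b \<bullet> i)" for x i :: 'a
    by (auto simp: algebra_simps)
  show ?thesis unfolding bump_def[abs_def] *
    by (intro Ck_prod Ck_mult Ck_exp_inverse finite_Basis)
qed

lemma bump_in_Cc:
  assumes "cbox a b \<subseteq> \<Omega>"
  shows "bump a b n \<in> Cc_infinity \<Omega>"
proof -
  have "{x. bump a b n x \<noteq> 0} = box a b" by (auto simp: bump_nonzero_iff)
  moreover have "closure (box a b) \<subseteq> cbox a b" by (intro closure_minimal closed_cbox box_subset_cbox)
  moreover have "compact (closure (box a b))"
    by (simp add: bounded_box compact_closure)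
  ultimately show ?thesis using assms by (auto simp: Cc_infinity_def Ck_bump)
qed

lemma absolutely_integrable_on_iff_lebesgue_on:
  fixes f :: "'a::euclidean_space \<Rightarrow> 'b::euclidean_space"
  assumes "open \<Omega>" "K \<subseteq> \<Omega>"
  shows "f absolutely_integrable_on K \<longleftrightarrow> integrable (lebesgue_on \<Omega>) (\<lambda>x. indicator K x *\<^sub>R f x)"
proof -
  have "(\<lambda>x. indicator \<Omega> x *\<^sub>R indicator K x *\<^sub>R f x) = (\<lambda>x. indicator K x *\<^sub>R f x)"
    using assms by (auto simp: fun_eq_iff split: split_indicator)
  then show ?thesis
    using assms by (subst integrable_restrict_space) (auto simp: set_integrable_def)
qed

text \<open>Local integrability expressed through the measure on \<open>\<Omega>\<close> itself, so that all
  integrals that occur are taken over one and the same measure space.\<close>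

definition locally_integrable_in :: "'a::euclidean_space set \<Rightarrow> ('a \<Rightarrow> 'b::euclidean_space) \<Rightarrow> bool" where
  "locally_integrable_in \<Omega> f \<longleftrightarrow>
     (\<forall>K. compact K \<and> K \<subseteq> \<Omega> \<longrightarrow> integrable (lebesgue_on \<Omega>) (\<lambda>x. indicator K x *\<^sub>R f x))"

lemma weak_gradient_alt:
  assumes "open \<Omega>"
  shows "weak_gradient \<Omega> u g \<longleftrightarrow> locally_integrable_in \<Omega> u \<and> locally_integrable_in \<Omega> g \<and>
     (\<forall>\<phi>\<in>Cc_infinity \<Omega>. \<forall>b\<in>Basis.
        (\<integral>x. frechet_derivative \<phi> (at x) b * u x \<partial>lebesgue_on \<Omega>)
          = - (\<integral>x. \<phi> x * (g x \<bullet> b) \<partial>lebesgue_on \<Omega>))"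
  using assms unfolding weak_gradient_def locally_integrable_in_def
  by (auto simp: absolutely_integrable_on_iff_lebesgue_on mult.commute)

lemma locally_integrable_lincomb:
  assumes "locally_integrable_in \<Omega> f" "locally_integrable_in \<Omega> g"
  shows "locally_integrable_in \<Omega> (\<lambda>x. a *\<^sub>R f x + b *\<^sub>R g x)"
  unfolding locally_integrable_in_def
proof (intro allI impI)
  fix K assume "compact K \<and> K \<subseteq> \<Omega>"
  then have "integrable (lebesgue_on \<Omega>) (\<lambda>x. a *\<^sub>R (indicator K x *\<^sub>R f x) + b *\<^sub>R (indicator K x *\<^sub>R g x))"
    using assms unfolding locally_integrable_in_def
    by (intro Bochner_Integration.integrable_add integrable_scaleR_right) auto
  then show "integrable (lebesgue_on \<Omega>) (\<lambda>x. indicator K x *\<^sub>R (a *\<^sub>R f x + b *\<^sub>R g x))"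
    by (simp only: scaleR_add_right scaleR_left_commute)
qed

lemma locally_integrable_inner:
  assumes "locally_integrable_in \<Omega> f"
  shows "locally_integrable_in \<Omega> (\<lambda>x. f x \<bullet> b)"
  unfolding locally_integrable_in_def
proof (intro allI impI)
  fix K assume "compact K \<and> K \<subseteq> \<Omega>"
  then have "integrable (lebesgue_on \<Omega>) (\<lambda>x. (indicator K x *\<^sub>R f x) \<bullet> b)"
    using assms unfolding locally_integrable_in_def by (intro integrable_inner_left) auto
  then show "integrable (lebesgue_on \<Omega>) (\<lambda>x. indicator K x *\<^sub>R (f x \<bullet> b))" by simp
qed

lemma continuous_borel_measurable_lebesgue_on:
  fixes \<psi> :: "'a::euclidean_space \<Rightarrow> 'b::euclidean_space"
  assumes "continuous_on UNIV \<psi>"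
  shows "\<psi> \<in> borel_measurable (lebesgue_on \<Omega>)"
  using borel_measurable_continuous_onI[OF assms]
  by (intro measurable_restrict_space1 measurable_completion) simp

lemma continuous_compact_support_bounded:
  fixes \<psi> :: "'a::euclidean_space \<Rightarrow> 'b::euclidean_space"
  assumes "continuous_on UNIV \<psi>" "compact K" "\<And>x. x \<notin> K \<Longrightarrow> \<psi> x = 0"
  obtains B where "B \<ge> 0" "\<And>x. norm (\<psi> x) \<le> B * indicator K x"
proof -
  have "compact (\<psi> ` K)"
    using assms by (intro compact_continuous_image) (auto intro: continuous_on_subset)
  then obtain B where B: "\<And>x. x \<in> K \<Longrightarrow> norm (\<psi> x) \<le> B"
    unfolding bounded_iff[of "\<psi> ` K"] using compact_imp_bounded bounded_iff by (metis imageI)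
  have "norm (\<psi> x) \<le> max B 0 * indicator K x" for x
    using B[of x] assms(3)[of x] by (auto split: split_indicator split_indicator_asm)
  then show ?thesis by (intro that[of "max B 0"]) auto
qed

lemma integrable_test_mult:
  fixes f :: "'a::euclidean_space \<Rightarrow> 'b::euclidean_space"
  assumes "locally_integrable_in \<Omega> f" "continuous_on UNIV \<psi>" "compact K" "K \<subseteq> \<Omega>"
    and "\<And>x. x \<notin> K \<Longrightarrow> \<psi> x = (0::real)"
  shows "integrable (lebesgue_on \<Omega>) (\<lambda>x. \<psi> x *\<^sub>R f x)"
proof -
  obtain B where B: "B \<ge> 0" "\<And>x. norm (\<psi> x) \<le> B * indicator K x"
    using continuous_compact_support_bounded[OF assms(2,3,5)] by blast
  have int: "integrable (lebesgue_on \<Omega>) (\<lambda>x. indicator K x *\<^sub>R f x)"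
    using assms unfolding locally_integrable_in_def by auto
  have eq: "\<psi> x *\<^sub>R f x = \<psi> x *\<^sub>R (indicator K x *\<^sub>R f x)" for x
    using assms(5)[of x] by (auto split: split_indicator split_indicator_asm)
  show ?thesis
  proof (rule Bochner_Integration.integrable_bound)
    show "integrable (lebesgue_on \<Omega>) (\<lambda>x. B *\<^sub>R norm (indicator K x *\<^sub>R f x))"
      using int by (intro integrable_scaleR_right integrable_norm)
    show "(\<lambda>x. \<psi> x *\<^sub>R f x) \<in> borel_measurable (lebesgue_on \<Omega>)"
      unfolding eq
      by (rule borel_measurable_scaleR[OF continuous_borel_measurable_lebesgue_on[OF assms(2)] borel_measurable_integrable[OF int]])
    have "norm (\<psi> x *\<^sub>R f x) \<le> norm (B *\<^sub>R norm (indicator K x *\<^sub>R f x))" for x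
      using mult_right_mono[OF B(2)[of x] norm_ge_zero[of "f x"]] B(1) by (auto split: split_indicator split_indicator_asm)
    then show "AE x in lebesgue_on \<Omega>. norm (\<psi> x *\<^sub>R f x) \<le> norm (B *\<^sub>R norm (indicator K x *\<^sub>R f x))"
      by simp
  qed
qed

lemma continuous_imp_locally_integrable:
  fixes f :: "'a::euclidean_space \<Rightarrow> 'b::euclidean_space"
  assumes "open \<Omega>" "continuous_on UNIV f"
  shows "locally_integrable_in \<Omega> f"
  unfolding locally_integrable_in_def
proof (intro allI impI)
  fix K assume K: "compact K \<and> K \<subseteq> \<Omega>"
  have "integrable lborel (\<lambda>x. indicator K x *\<^sub>R f x)"
    using K assms by (intro borel_integrable_compact) (auto intro: continuous_on_subset)
  then have "integrable lebesgue (\<lambda>x. indicator K x *\<^sub>R f x)"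
    by (subst integrable_completion) (auto simp: integrable_iff_bounded)
  then show "integrable (lebesgue_on \<Omega>) (\<lambda>x. indicator K x *\<^sub>R f x)"
    using K assms absolutely_integrable_on_iff_lebesgue_on[of \<Omega> K f] by (auto simp: set_integrable_def)
qed

lemma integrable_continuous_compact_support:
  fixes f :: "'a::euclidean_space \<Rightarrow> 'b::euclidean_space"
  assumes "open \<Omega>" "continuous_on UNIV f" "compact K" "K \<subseteq> \<Omega>" "\<And>x. x \<notin> K \<Longrightarrow> f x = 0"
  shows "integrable (lebesgue_on \<Omega>) f"
proof -
  have "integrable (lebesgue_on \<Omega>) (\<lambda>x. indicator K x *\<^sub>R f x)"
    using continuous_imp_locally_integrable[OF assms(1,2)] assms(3,4)
    unfolding locally_integrable_in_def by auto
  moreover have "(\<lambda>x. indicator K x *\<^sub>R f x) = f"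
    using assms(5) by (auto simp: fun_eq_iff split: split_indicator)
  ultimately show ?thesis by simp
qed

section \<open>Test functions\<close>

definition grad :: "('a::euclidean_space \<Rightarrow> real) \<Rightarrow> 'a \<Rightarrow> 'a" where
  "grad \<phi> x = (\<Sum>b\<in>Basis. frechet_derivative \<phi> (at x) b *\<^sub>R b)"

lemma grad_inner_Basis: "b \<in> Basis \<Longrightarrow> grad \<phi> x \<bullet> b = frechet_derivative \<phi> (at x) b"
  by (simp add: grad_def inner_sum_left inner_Basis if_distrib cong: if_cong)

lemma Cc_infinityD:
  assumes "\<phi> \<in> Cc_infinity \<Omega>"
  shows "continuous_on UNIV \<phi>"
    "(\<phi> has_derivative frechet_derivative \<phi> (at x)) (at x)"
    "b \<in> Basis \<Longrightarrow> continuous_on UNIV (\<lambda>x. frechet_derivative \<phi> (at x) b)"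
    "continuous_on UNIV (grad \<phi>)"
    "compact (closure {x. \<phi> x \<noteq> 0})" "closure {x. \<phi> x \<noteq> 0} \<subseteq> \<Omega>"
    "x \<notin> closure {x. \<phi> x \<noteq> 0} \<Longrightarrow> \<phi> x = 0"
    "x \<notin> closure {x. \<phi> x \<noteq> 0} \<Longrightarrow> frechet_derivative \<phi> (at x) = (\<lambda>_. 0)"
    "x \<notin> closure {x. \<phi> x \<noteq> 0} \<Longrightarrow> grad \<phi> x = 0"
proof -
  have Ck: "Ck k \<phi>" for k using assms by (simp add: Cc_infinity_def)
  show "continuous_on UNIV \<phi>" using Ck[of 0] by simp
  show "(\<phi> has_derivative frechet_derivative \<phi> (at x)) (at x)" by (rule Ck_SucD[OF Ck[of "Suc 0"]])
  show c: "continuous_on UNIV (\<lambda>x. frechet_derivative \<phi> (at x) b)" if "b \<in> Basis" for b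
    using Ck[of "Suc 0"] that by auto
  show "continuous_on UNIV (grad \<phi>)"
    unfolding grad_def[abs_def] by (intro continuous_on_sum continuous_intros c)
  show "compact (closure {x. \<phi> x \<noteq> 0})" "closure {x. \<phi> x \<noteq> 0} \<subseteq> \<Omega>"
    using assms by (auto simp: Cc_infinity_def)
  show 0: "\<phi> x = 0" if "x \<notin> closure {x. \<phi> x \<noteq> 0}" for x
    using that closure_subset[of "{x. \<phi> x \<noteq> 0}"] by auto
  show 1: "frechet_derivative \<phi> (at x) = (\<lambda>_. 0)" if "x \<notin> closure {x. \<phi> x \<noteq> 0}" for x
  proof -
    have "((\<lambda>_. 0) has_derivative (\<lambda>_. 0)) (at x)" by simp
    then have "(\<phi> has_derivative (\<lambda>_. 0)) (at x)"
    proof (rule has_derivative_transform_within_open)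
      show "open (- closure {x. \<phi> x \<noteq> 0})" by (rule open_Compl[OF closed_closure])
      show "x \<in> - closure {x. \<phi> x \<noteq> 0}" using that by (simp only: Compl_iff not_False_eq_True)
      show "0 = \<phi> y" if "y \<in> - closure {x. \<phi> x \<noteq> 0}" for y
        using 0[OF ComplD[OF that]] by (rule sym)
    qed
    then show ?thesis by (rule frechet_derivative_at[symmetric])
  qed
  show "grad \<phi> x = 0" if "x \<notin> closure {x. \<phi> x \<noteq> 0}"
    using 1[OF that] by (simp add: grad_def)
qed

lemma Cc_infinity_supportE:
  assumes "\<phi> \<in> Cc_infinity \<Omega>"
  obtains K where "compact K" "K \<subseteq> \<Omega>" "\<And>x. x \<notin> K \<Longrightarrow> \<phi> x = 0"
    "\<And>x y. x \<notin> K \<Longrightarrow> frechet_derivative \<phi> (at x) y = 0" "\<And>x. x \<notin> K \<Longrightarrow> grad \<phi> x = 0"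
proof (rule that)
  show "compact (closure {x. \<phi> x \<noteq> 0})" "closure {x. \<phi> x \<noteq> 0} \<subseteq> \<Omega>"
    by (rule Cc_infinityD(5,6)[OF assms])+
  show "\<phi> x = 0" "grad \<phi> x = 0" if "x \<notin> closure {x. \<phi> x \<noteq> 0}" for x
    by (rule Cc_infinityD(7,9)[OF assms that])+
  show "frechet_derivative \<phi> (at x) y = 0" if "x \<notin> closure {x. \<phi> x \<noteq> 0}" for x y
    by (simp only: Cc_infinityD(8)[OF assms that])
qed

lemma integrable_test_function_mult:
  fixes f :: "'a::euclidean_space \<Rightarrow> 'b::euclidean_space"
  assumes "locally_integrable_in \<Omega> f" "\<phi> \<in> Cc_infinity \<Omega>"
  shows "integrable (lebesgue_on \<Omega>) (\<lambda>x. \<phi> x *\<^sub>R f x)"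
    and "b \<in> Basis \<Longrightarrow> integrable (lebesgue_on \<Omega>) (\<lambda>x. frechet_derivative \<phi> (at x) b *\<^sub>R f x)"
proof -
  obtain K where K: "compact K" "K \<subseteq> \<Omega>" "\<And>x. x \<notin> K \<Longrightarrow> \<phi> x = 0"
    "\<And>x y. x \<notin> K \<Longrightarrow> frechet_derivative \<phi> (at x) y = 0"
    using Cc_infinity_supportE[OF assms(2)] by metis
  show "integrable (lebesgue_on \<Omega>) (\<lambda>x. \<phi> x *\<^sub>R f x)"
    by (rule integrable_test_mult[OF assms(1) Cc_infinityD(1)[OF assms(2)] K(1,2,3)])
  show "integrable (lebesgue_on \<Omega>) (\<lambda>x. frechet_derivative \<phi> (at x) b *\<^sub>R f x)" if "b \<in> Basis"
    by (rule integrable_test_mult[OF assms(1) Cc_infinityD(3)[OF assms(2) that] K(1,2,4)])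
qed

lemma Cc_infinity_lincomb:
  assumes "\<phi> \<in> Cc_infinity \<Omega>" "\<psi> \<in> Cc_infinity \<Omega>"
  shows "(\<lambda>x. a * \<phi> x + b * \<psi> x) \<in> Cc_infinity \<Omega>"
proof -
  let ?S = "closure {x. a * \<phi> x + b * \<psi> x \<noteq> 0}"
  have "{x. a * \<phi> x + b * \<psi> x \<noteq> 0} \<subseteq> {x. \<phi> x \<noteq> 0} \<union> {x. \<psi> x \<noteq> 0}" by auto
  from closure_mono[OF this]
  have sub: "?S \<subseteq> closure {x. \<phi> x \<noteq> 0} \<union> closure {x. \<psi> x \<noteq> 0}"
    by (simp only: closure_Un)
  have "compact (closure {x. \<phi> x \<noteq> 0} \<union> closure {x. \<psi> x \<noteq> 0})"
    by (intro compact_Un Cc_infinityD(5)[OF assms(1)] Cc_infinityD(5)[OF assms(2)])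
  from compact_Int_closed[OF this closed_closure, of "{x. a * \<phi> x + b * \<psi> x \<noteq> 0}"]
  have "compact ?S" using sub by (simp only: Int_absorb1)
  moreover have "?S \<subseteq> \<Omega>"
    using sub Cc_infinityD(6)[OF assms(1)] Cc_infinityD(6)[OF assms(2)] by blast
  moreover have "Ck k (\<lambda>x. a * \<phi> x + b * \<psi> x)" for k
    using assms by (intro Ck_add Ck_cmult) (auto simp: Cc_infinity_def)
  ultimately show ?thesis unfolding Cc_infinity_def by blast
qed

text \<open>By translation invariance the difference quotients of \<open>F\<close> in the direction
  \<open>b\<close> have integral \<open>0\<close>. They converge to the derivative, dominated by a multiple of
  the indicator of a fixed ball.\<close>

lemma integral_directional_derivative_eq_0:
  fixes F :: "'a::euclidean_space \<Rightarrow> real"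
  assumes dF: "\<And>x. (F has_derivative F' x) (at x)"
    and cont: "continuous_on UNIV (\<lambda>x. F' x b)"
    and K: "compact K" "\<And>x. x \<notin> K \<Longrightarrow> F x = 0" "\<And>x. x \<notin> K \<Longrightarrow> F' x b = 0"
    and b: "norm b = 1"
  shows "(\<integral>x. F' x b \<partial>lborel) = 0"
proof -
  have contF: "continuous_on UNIV F"
    using dF by (meson continuous_at_imp_continuous_on has_derivative_continuous)
  obtain M where M: "M \<ge> 0" "\<And>x. norm (F' x b) \<le> M * indicator K x"
    using continuous_compact_support_bounded[OF cont K(1,3)] by blast
  have M': "\<bar>F' x b\<bar> \<le> M" for x
    using M(2)[of x] M(1) by (auto split: split_indicator split_indicator_asm)
  obtain R where R: "\<And>x. x \<in> K \<Longrightarrow> norm x \<le> R"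
    using compact_imp_bounded[OF K(1)] by (auto simp: bounded_iff)
  define t where "t n = inverse (real (Suc n))" for n
  have t: "0 < t n" "t n \<le> 1" for n
    by (auto simp: t_def inverse_le_1_iff simp del: of_nat_Suc)
  define D where "D n x = (F (x + t n *\<^sub>R b) - F x) / t n" for n x
  have der: "((\<lambda>s. F (x + s *\<^sub>R b)) has_real_derivative F' (x + s *\<^sub>R b) b) (at s)" for x s
  proof -
    have lin: "linear (F' y)" for y using dF has_derivative_linear by blast
    have "((\<lambda>s. F (x + s *\<^sub>R b)) has_derivative (\<lambda>h. F' (x + s *\<^sub>R b) (h *\<^sub>R b))) (at s)"
      by (rule has_derivative_compose[where f="\<lambda>s. x + s *\<^sub>R b", OF _ dF])
        (auto intro!: derivative_eq_intros)
    moreover have "(\<lambda>h. F' (x + s *\<^sub>R b) (h *\<^sub>R b)) = (*) (F' (x + s *\<^sub>R b) b)"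
      using linear_scale[OF lin] by (auto simp: mult.commute)
    ultimately show ?thesis by (simp add: has_field_derivative_def)
  qed
  have intF: "integrable lborel F"
  proof -
    have "integrable lborel (\<lambda>x. indicator K x *\<^sub>R F x)"
      using K(1) contF by (intro borel_integrable_compact) (auto intro: continuous_on_subset)
    moreover have "(\<lambda>x. indicator K x *\<^sub>R F x) = F"
      using K(2) by (auto simp: fun_eq_iff split: split_indicator)
    ultimately show ?thesis by simp
  qed
  have Fb[measurable]: "F \<in> borel_measurable borel"
    using contF by (rule borel_measurable_continuous_onI)
  have shift: "integrable lborel (\<lambda>x. F (x + c)) \<and> (\<integral>x. F (x + c) \<partial>lborel) = (\<integral>x. F x \<partial>lborel)" for c
  proof -
    have "integrable (distr lborel borel ((+) c)) F"
      using intF by (simp add: lborel_distr_plus)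
    then have "integrable lborel (\<lambda>x. F (c + x))"
      by (subst (asm) integrable_distr_eq) auto
    moreover have "(\<integral>x. F x \<partial>distr lborel borel ((+) c)) = (\<integral>x. F (c + x) \<partial>lborel)"
      by (subst integral_distr) auto
    ultimately show ?thesis by (simp add: lborel_distr_plus add.commute)
  qed
  have "(\<lambda>n. \<integral>x. D n x \<partial>lborel) \<longlonglongrightarrow> (\<integral>x. F' x b \<partial>lborel)"
  proof (rule integral_dominated_convergence)
    show "integrable lborel (\<lambda>x. M * indicator (cball 0 (R + 1)) x :: real)"
      by (intro integrable_mult_right integrable_real_indicator) (use emeasure_compact_finite[OF compact_cball, of 0 "R + 1"] in \<open>auto simp: top.not_eq_extremum\<close>)
    show "AE x in lborel. norm (D n x) \<le> M * indicator (cball 0 (R + 1)) x" for n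
    proof (rule AE_I2)
      fix x
      show "norm (D n x) \<le> M * indicator (cball 0 (R + 1)) x"
      proof (cases "norm x \<le> R + 1")
        case True
        obtain z where "F (x + t n *\<^sub>R b) - F (x + 0 *\<^sub>R b) = (t n - 0) * F' (x + z *\<^sub>R b) b"
          using MVT2[of 0 "t n" "\<lambda>s. F (x + s *\<^sub>R b)" "\<lambda>s. F' (x + s *\<^sub>R b) b"] t(1)[of n] der by blast
        then have "D n x = F' (x + z *\<^sub>R b) b"
          using t(1)[of n] by (simp add: D_def)
        then show ?thesis using M' True by simp
      next
        case False
        have "norm (x + t n *\<^sub>R b) \<ge> norm x - norm (t n *\<^sub>R b)"
          using norm_diff_ineq[of x "t n *\<^sub>R b"] by simp
        moreover have "norm (t n *\<^sub>R b) \<le> 1" using t[of n] b by simp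
        ultimately have "x \<notin> K" "x + t n *\<^sub>R b \<notin> K" using R[of x] R[of "x + t n *\<^sub>R b"] False by auto
        then show ?thesis using K(2) False by (simp add: D_def)
      qed
    qed
    show "AE x in lborel. (\<lambda>n. D n x) \<longlonglongrightarrow> F' x b"
    proof (rule AE_I2)
      fix x
      have "((\<lambda>h. (F (x + h *\<^sub>R b) - F x) / h) \<longlongrightarrow> F' x b) (at 0)"
        using der[of x 0] by (simp add: DERIV_def)
      moreover have "filterlim t (at 0) sequentially"
        unfolding filterlim_at t_def using LIMSEQ_inverse_real_of_nat by (auto simp: add_nonneg_eq_0_iff)
      ultimately show "(\<lambda>n. D n x) \<longlonglongrightarrow> F' x b"
        unfolding D_def by (rule filterlim_compose)
    qed
    show "(\<lambda>x. F' x b) \<in> borel_measurable lborel"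
      using cont borel_measurable_continuous_onI by simp
    show "D n \<in> borel_measurable lborel" for n unfolding D_def[abs_def] by measurable
  qed
  moreover have "(\<integral>x. D n x \<partial>lborel) = 0" for n
    unfolding D_def using shift[of "t n *\<^sub>R b"] intF by simp
  ultimately show ?thesis by (simp add: LIMSEQ_const_iff)
qed

text \<open>Integration by parts: the directional derivatives of the product \<open>\<phi> \<psi>\<close>
  integrate to \<open>0\<close>.\<close>

lemma weak_gradient_test_function:
  fixes \<Omega> :: "'a::euclidean_space set"
  assumes \<Omega>: "open \<Omega>" and \<phi>: "\<phi> \<in> Cc_infinity \<Omega>"
  shows "weak_gradient \<Omega> \<phi> (grad \<phi>)"
  unfolding weak_gradient_alt[OF \<Omega>]
proof (intro conjI ballI)
  show l1: "locally_integrable_in \<Omega> \<phi>" and l2: "locally_integrable_in \<Omega> (grad \<phi>)"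
    by (rule continuous_imp_locally_integrable[OF \<Omega>], rule Cc_infinityD(1,4)[OF \<phi>])+
  fix \<psi> and b :: 'a assume \<psi>: "\<psi> \<in> Cc_infinity \<Omega>" and b: "b \<in> Basis"
  let ?D = "\<lambda>x. \<phi> x * frechet_derivative \<psi> (at x) b + frechet_derivative \<phi> (at x) b * \<psi> x"
  obtain K where K: "compact K" "K \<subseteq> \<Omega>" "\<And>x. x \<notin> K \<Longrightarrow> \<psi> x = 0"
    "\<And>x y. x \<notin> K \<Longrightarrow> frechet_derivative \<psi> (at x) y = 0"
    using Cc_infinity_supportE[OF \<psi>] by metis
  have cD: "continuous_on UNIV ?D"
    using Cc_infinityD(1,3)[OF \<phi>] Cc_infinityD(1,3)[OF \<psi>] b by (intro continuous_intros) auto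
  have 0: "?D x = 0" if "x \<notin> K" for x
    using K(3,4)[OF that] by simp
  have "(\<integral>x. ?D x \<partial>lborel) = 0"
  proof (rule integral_directional_derivative_eq_0
      [where F = "\<lambda>x. \<phi> x * \<psi> x" and b = b and K = K
       and F' = "\<lambda>x y. \<phi> x * frechet_derivative \<psi> (at x) y + frechet_derivative \<phi> (at x) y * \<psi> x"])
    show "((\<lambda>x. \<phi> x * \<psi> x) has_derivative
        (\<lambda>y. \<phi> x * frechet_derivative \<psi> (at x) y + frechet_derivative \<phi> (at x) y * \<psi> x)) (at x)" for x
      using Cc_infinityD(2)[OF \<phi>] Cc_infinityD(2)[OF \<psi>] by (rule has_derivative_mult)
  qed (use cD 0 b K in auto)
  moreover have "(\<integral>x. ?D x \<partial>lebesgue_on \<Omega>) = (\<integral>x. ?D x \<partial>lborel)"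
  proof -
    have "indicator \<Omega> x *\<^sub>R ?D x = ?D x" for x
      using 0[of x] K(2) by (auto split: split_indicator split_indicator_asm)
    moreover have "(\<integral>x. ?D x \<partial>lebesgue_on \<Omega>) = (\<integral>x. indicator \<Omega> x *\<^sub>R ?D x \<partial>lebesgue)"
      using \<Omega> by (intro integral_restrict_space) auto
    ultimately have "(\<integral>x. ?D x \<partial>lebesgue_on \<Omega>) = (\<integral>x. ?D x \<partial>lebesgue)"
      by (simp only:)
    then show ?thesis
      using borel_measurable_continuous_onI[OF cD] by (subst (asm) integral_completion) auto
  qed
  moreover have "integrable (lebesgue_on \<Omega>) (\<lambda>x. \<psi> x *\<^sub>R (grad \<phi> x \<bullet> b))"
    by (rule integrable_test_function_mult(1)[OF locally_integrable_inner[OF l2] \<psi>])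
  moreover have "integrable (lebesgue_on \<Omega>) (\<lambda>x. frechet_derivative \<psi> (at x) b *\<^sub>R \<phi> x)"
    by (rule integrable_test_function_mult(2)[OF l1 \<psi> b])
  ultimately show "(\<integral>x. frechet_derivative \<psi> (at x) b * \<phi> x \<partial>lebesgue_on \<Omega>) =
    - (\<integral>x. \<psi> x * (grad \<phi> x \<bullet> b) \<partial>lebesgue_on \<Omega>)"
    using b by (simp add: grad_inner_Basis mult.commute add_eq_0_iff)
qed

section \<open>The fundamental lemma of the calculus of variations\<close>

text \<open>The bumps on the box are bounded by \<open>1\<close> and converge to its indicator.\<close>

lemma integral_box_eq_0:
  fixes f :: "'a::euclidean_space \<Rightarrow> real"
  assumes f: "locally_integrable_in \<Omega> f"
    and 0: "\<And>\<phi>. \<phi> \<in> Cc_infinity \<Omega> \<Longrightarrow> (\<integral>x. \<phi> x * f x \<partial>lebesgue_on \<Omega>) = 0"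
    and ab: "cbox a b \<subseteq> \<Omega>"
  shows "(\<integral>x. indicator (box a b) x * f x \<partial>lebesgue_on \<Omega>) = 0"
proof -
  let ?g = "\<lambda>x. indicator (cbox a b) x *\<^sub>R f x"
  have int: "integrable (lebesgue_on \<Omega>) ?g"
    using f ab unfolding locally_integrable_in_def by auto
  have eq: "bump a b n x * f x = bump a b n x * ?g x" for n x
    using bump_nonzero_iff[of a b n x] box_subset_cbox[of a b] by (auto split: split_indicator split_indicator_asm)
  have eq': "indicator (box a b) x * f x = indicator (box a b) x * ?g x" for x
    using box_subset_cbox[of a b] by (auto split: split_indicator split_indicator_asm)
  have "(\<lambda>n. \<integral>x. bump a b n x * f x \<partial>lebesgue_on \<Omega>) \<longlonglongrightarrow> (\<integral>x. indicator (box a b) x * f x \<partial>lebesgue_on \<Omega>)"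
  proof (rule integral_dominated_convergence)
    show "integrable (lebesgue_on \<Omega>) (\<lambda>x. norm (?g x))" using int by (rule integrable_norm)
    show "AE x in lebesgue_on \<Omega>. (\<lambda>n. bump a b n x * f x) \<longlonglongrightarrow> indicator (box a b) x * f x"
      by (intro AE_I2 tendsto_intros bump_tendsto)
    show "AE x in lebesgue_on \<Omega>. norm (bump a b n x * f x) \<le> norm (?g x)" for n
      unfolding eq using bump_bounds[of a b n] by (auto intro!: AE_I2 mult_left_le_one_le simp: abs_mult)
    have "bump a b n \<in> borel_measurable (lebesgue_on \<Omega>)" for n
      using Ck_bump[of 0 a b n] by (intro continuous_borel_measurable_lebesgue_on) auto
    then show "(\<lambda>x. bump a b n x * f x) \<in> borel_measurable (lebesgue_on \<Omega>)" for n
      unfolding eq using borel_measurable_integrable[OF int] by (rule borel_measurable_times)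
    have "indicator (box a b) \<in> borel_measurable (lebesgue_on \<Omega>)"
      by (intro measurable_restrict_space1 borel_measurable_indicator) auto
    then show "(\<lambda>x. indicator (box a b) x * f x) \<in> borel_measurable (lebesgue_on \<Omega>)"
      unfolding eq' using borel_measurable_integrable[OF int] by (rule borel_measurable_times)
  qed
  moreover have "(\<integral>x. bump a b n x * f x \<partial>lebesgue_on \<Omega>) = 0" for n
    by (intro 0 bump_in_Cc ab)
  ultimately show ?thesis by (simp add: LIMSEQ_const_iff)
qed

text \<open>The averages of \<open>f\<close> over all small cubes vanish, and for almost every
  \<open>x\<close> the averages over the cubes that shrink to \<open>x\<close> converge to \<open>f
  x\<close>.\<close>

lemma fundamental_lemma:
  fixes f :: "'a::euclidean_space \<Rightarrow> real"
  assumes \<Omega>: "open \<Omega>" and f: "locally_integrable_in \<Omega> f"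
    and 0: "\<And>\<phi>. \<phi> \<in> Cc_infinity \<Omega> \<Longrightarrow> (\<integral>x. \<phi> x * f x \<partial>lebesgue_on \<Omega>) = 0"
  shows "AE x in lebesgue_on \<Omega>. f x = 0"
proof -
  have box: "AE x in lebesgue. x \<in> cbox c d \<longrightarrow> f x = 0" if cd: "cbox c d \<subseteq> \<Omega>" for c d
  proof -
    define g where "g x = indicator (cbox c d) x *\<^sub>R f x" for x
    have "f absolutely_integrable_on cbox c d"
      using f cd compact_cbox[of c d]
      unfolding locally_integrable_in_def absolutely_integrable_on_iff_lebesgue_on[OF \<Omega> cd] by blast
    then have gU: "g absolutely_integrable_on UNIV"
      by (simp add: set_integrable_def g_def[abs_def])
    then have ga: "g absolutely_integrable_on S" if "S \<in> sets lebesgue" for S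
      using that set_integrable_subset by blast
    have "g integrable_on cbox a b" for a b
      using ga[of "cbox a b"] by (auto simp: absolutely_integrable_on_def)
    then obtain N where N: "negligible N" "\<And>x e. \<lbrakk>x \<notin> N; 0 < e\<rbrakk> \<Longrightarrow>
        \<exists>\<delta>>0. \<forall>h. 0 < h \<and> h < \<delta> \<longrightarrow> norm (integral (cbox x (x + h *\<^sub>R One)) g /\<^sub>R h ^ DIM('a) - g x) < e"
      using integrable_ccontinuous_explicit[of g] by blast
    have "f x = 0" if x: "x \<in> box c d" "x \<notin> N" for x
    proof (rule ccontr)
      assume nz: "f x \<noteq> 0"
      have gx: "g x = f x" using x box_subset_cbox[of c d] by (auto simp: g_def)
      then obtain \<delta> where \<delta>: "\<delta> > 0" "\<And>h. 0 < h \<Longrightarrow> h < \<delta> \<Longrightarrow>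
          norm (integral (cbox x (x + h *\<^sub>R One)) g /\<^sub>R h ^ DIM('a) - f x) < \<bar>f x\<bar>"
        using N(2)[OF x(2), of "\<bar>f x\<bar>"] nz by auto
      obtain e where e: "e > 0" "ball x e \<subseteq> box c d"
        using x(1) open_box openE by blast
      \<comment> \<open>so small that the cube with corner \<open>x\<close> and side \<open>h\<close> stays inside the ball\<close>
      define h where "h = min (\<delta> / 2) (e / (2 * DIM('a)))"
      have h: "0 < h" "h < \<delta>" "DIM('a) * h < e"
        using \<delta>(1) e(1) by (auto simp: h_def min_def field_simps)
      have sub: "cbox x (x + h *\<^sub>R One) \<subseteq> box c d"
      proof
        fix y assume y: "y \<in> cbox x (x + h *\<^sub>R One)"
        have "norm (y - x) \<le> (\<Sum>i\<in>Basis. \<bar>(y - x) \<bullet> i\<bar>)" by (rule norm_le_l1)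
        also have "\<dots> \<le> (\<Sum>i\<in>(Basis::'a set). h)"
          using y by (intro sum_mono) (auto simp: mem_box inner_simps abs_le_iff)
        also have "\<dots> < e" using h by simp
        finally show "y \<in> box c d" using e(2) by (auto simp: dist_norm norm_minus_commute)
      qed
      let ?B = "box x (x + h *\<^sub>R One)"
      have B: "?B \<subseteq> cbox c d" "?B \<subseteq> \<Omega>" "cbox x (x + h *\<^sub>R One) \<subseteq> \<Omega>"
        using sub box_subset_cbox[of c d] box_subset_cbox[of x "x + h *\<^sub>R One"] cd by blast+
      have "integral (cbox x (x + h *\<^sub>R One)) g = integral ?B g"
        by (rule integral_open_interval[symmetric])
      also have "\<dots> = (\<integral>y\<in>?B. g y \<partial>lebesgue)"
        using ga[of ?B] by (intro set_lebesgue_integral_eq_integral(2)[symmetric]) auto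
      also have "\<dots> = (\<integral>y. indicator \<Omega> y *\<^sub>R (indicator ?B y * f y) \<partial>lebesgue)"
        unfolding set_lebesgue_integral_def g_def using B
        by (intro Bochner_Integration.integral_cong) (auto split: split_indicator split_indicator_asm)
      also have "\<dots> = (\<integral>y. indicator ?B y * f y \<partial>lebesgue_on \<Omega>)"
        using \<Omega> by (subst integral_restrict_space) auto
      also have "\<dots> = 0" by (rule integral_box_eq_0[OF f 0 B(3)])
      finally show False using \<delta>(2)[OF h(1,2)] by simp
    qed
    then have "{x. \<not> (x \<in> cbox c d \<longrightarrow> f x = 0)} \<subseteq> N \<union> (cbox c d - box c d)" by auto
    moreover have "negligible (N \<union> (cbox c d - box c d))"
      using N(1) by (simp add: negligible_frontier_interval)
    ultimately show ?thesis
      by (intro AE_I'[of "N \<union> (cbox c d - box c d)"]) (auto simp: negligible_iff_null_sets)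
  qed
  obtain D where D: "countable D" "D \<subseteq> Pow \<Omega>" "\<And>X. X \<in> D \<Longrightarrow> \<exists>a b. X = cbox a b" "\<Union>D = \<Omega>"
    using open_countable_Union_open_cbox[OF \<Omega>] by metis
  have "AE x in lebesgue. \<forall>X\<in>D. x \<in> X \<longrightarrow> f x = 0"
  proof (subst AE_ball_countable[OF D(1)], intro ballI)
    fix X assume "X \<in> D"
    then show "AE x in lebesgue. x \<in> X \<longrightarrow> f x = 0" using D(2,3) box by blast
  qed
  then have "AE x in lebesgue. x \<in> \<Omega> \<longrightarrow> f x = 0"
    by eventually_elim (use D(4) in blast)
  then show ?thesis using \<Omega> by (subst AE_restrict_space_iff) auto
qed

section \<open>Weak gradients\<close>

lemma weak_gradient_unique:
  fixes \<Omega> :: "'a::euclidean_space set"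
  assumes \<Omega>: "open \<Omega>" and g: "weak_gradient \<Omega> u g" and h: "weak_gradient \<Omega> u h"
  shows "AE x in lebesgue_on \<Omega>. g x = h x"
proof -
  have lg: "locally_integrable_in \<Omega> g" "locally_integrable_in \<Omega> h"
    using g h by (auto simp: weak_gradient_alt[OF \<Omega>])
  have "AE x in lebesgue_on \<Omega>. \<forall>b\<in>Basis. (g x - h x) \<bullet> b = 0"
  proof (rule AE_finite_allI[OF finite_Basis])
    fix b :: 'a assume b: "b \<in> Basis"
    have lgh: "locally_integrable_in \<Omega> (\<lambda>x. (g x - h x) \<bullet> b)"
      using locally_integrable_inner[OF locally_integrable_lincomb[OF lg, of 1 "-1"]] by simp
    show "AE x in lebesgue_on \<Omega>. (g x - h x) \<bullet> b = 0"
    proof (rule fundamental_lemma[OF \<Omega> lgh])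
      fix \<phi> assume \<phi>: "\<phi> \<in> Cc_infinity \<Omega>"
      have "integrable (lebesgue_on \<Omega>) (\<lambda>x. \<phi> x *\<^sub>R (g x \<bullet> b))"
         "integrable (lebesgue_on \<Omega>) (\<lambda>x. \<phi> x *\<^sub>R (h x \<bullet> b))"
        using integrable_test_function_mult(1)[OF locally_integrable_inner[OF lg(1)] \<phi>]
          integrable_test_function_mult(1)[OF locally_integrable_inner[OF lg(2)] \<phi>] by auto
      moreover have "(\<integral>x. \<phi> x * (g x \<bullet> b) \<partial>lebesgue_on \<Omega>) = (\<integral>x. \<phi> x * (h x \<bullet> b) \<partial>lebesgue_on \<Omega>)"
        using g h \<phi> b by (auto simp: weak_gradient_alt[OF \<Omega>])
      ultimately show "(\<integral>x. \<phi> x * ((g x - h x) \<bullet> b) \<partial>lebesgue_on \<Omega>) = 0"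
        by (simp add: inner_diff_left right_diff_distrib)
    qed
  qed
  then show ?thesis
    by eventually_elim (simp add: euclidean_eq_iff[where 'a='a] inner_diff_left)
qed

lemma weak_gradient_lincomb:
  fixes \<Omega> :: "'a::euclidean_space set"
  assumes \<Omega>: "open \<Omega>" and g: "weak_gradient \<Omega> u g" and h: "weak_gradient \<Omega> v h"
  shows "weak_gradient \<Omega> (\<lambda>x. a * u x + b * v x) (\<lambda>x. a *\<^sub>R g x + b *\<^sub>R h x)"
  unfolding weak_gradient_alt[OF \<Omega>]
proof (intro conjI ballI)
  have l: "locally_integrable_in \<Omega> u" "locally_integrable_in \<Omega> v"
     "locally_integrable_in \<Omega> g" "locally_integrable_in \<Omega> h"
    using g h by (auto simp: weak_gradient_alt[OF \<Omega>])
  show "locally_integrable_in \<Omega> (\<lambda>x. a * u x + b * v x)"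
    using locally_integrable_lincomb[OF l(1,2)] by simp
  show "locally_integrable_in \<Omega> (\<lambda>x. a *\<^sub>R g x + b *\<^sub>R h x)"
    by (rule locally_integrable_lincomb[OF l(3,4)])
  fix \<phi> and e :: 'a assume \<phi>: "\<phi> \<in> Cc_infinity \<Omega>" and e: "e \<in> Basis"
  have "integrable (lebesgue_on \<Omega>) (\<lambda>x. \<phi> x * (g x \<bullet> e))"
    "integrable (lebesgue_on \<Omega>) (\<lambda>x. \<phi> x * (h x \<bullet> e))"
    "integrable (lebesgue_on \<Omega>) (\<lambda>x. frechet_derivative \<phi> (at x) e * u x)"
    "integrable (lebesgue_on \<Omega>) (\<lambda>x. frechet_derivative \<phi> (at x) e * v x)"
    using integrable_test_function_mult(1)[OF locally_integrable_inner[OF l(3)] \<phi>]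
      integrable_test_function_mult(1)[OF locally_integrable_inner[OF l(4)] \<phi>]
      integrable_test_function_mult(2)[OF l(1) \<phi> e]
      integrable_test_function_mult(2)[OF l(2) \<phi> e] by auto
  then show "(\<integral>x. frechet_derivative \<phi> (at x) e * (a * u x + b * v x) \<partial>lebesgue_on \<Omega>) =
      - (\<integral>x. \<phi> x * ((a *\<^sub>R g x + b *\<^sub>R h x) \<bullet> e) \<partial>lebesgue_on \<Omega>)"
    using g h \<phi> e
    by (simp add: inner_add_left algebra_simps weak_gradient_alt[OF \<Omega>] mult.left_commute[of _ a] mult.left_commute[of _ b])
qed

lemma weak_gradient_wgrad: "weak_gradient \<Omega> u g \<Longrightarrow> weak_gradient \<Omega> u (wgrad \<Omega> u)"
  unfolding wgrad_def by (rule someI[of "weak_gradient \<Omega> u"])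

lemma wgrad_AE_eq:
  assumes "open \<Omega>" "weak_gradient \<Omega> u g"
  shows "AE x in lebesgue_on \<Omega>. wgrad \<Omega> u x = g x"
  using weak_gradient_unique[OF assms(1) weak_gradient_wgrad[OF assms(2)] assms(2)] .

section \<open>Dominated subsequences and Fatou\<close>

lemma AE_summable_of_summable_integral:
  fixes f :: "nat \<Rightarrow> 'a \<Rightarrow> real"
  assumes int: "\<And>n. integrable M (f n)" and pos: "\<And>n x. 0 \<le> f n x"
    and sum: "summable (\<lambda>n. \<integral>x. f n x \<partial>M)"
  shows "AE x in M. summable (\<lambda>n. f n x)"
proof -
  have "(\<integral>\<^sup>+x. (\<Sum>n. ennreal (f n x)) \<partial>M) = (\<Sum>n. \<integral>\<^sup>+x. ennreal (f n x) \<partial>M)"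
    using int by (intro nn_integral_suminf) auto
  also have "\<dots> = (\<Sum>n. ennreal (\<integral>x. f n x \<partial>M))"
    using int pos by (simp add: nn_integral_eq_integral)
  also have "\<dots> \<noteq> top"
    by (rule ennreal_suminf_neq_top[OF sum]) (rule Bochner_Integration.integral_nonneg, rule pos)
  finally have "AE x in M. (\<Sum>n. ennreal (f n x)) \<noteq> top"
    using int unfolding infinity_ennreal_def[symmetric] by (intro nn_integral_PInf_AE) auto
  then show ?thesis
  proof eventually_elim
    case (elim x)
    show ?case by (rule summable_suminf_not_top[OF pos elim])
  qed
qed

text \<open>Select terms whose integrals are below \<open>2\<^sup>-\<^sup>n\<close>. The sum of the selected
  functions is integrable, hence finite almost everywhere, and dominates each of them.\<close>

lemma L1_null_subsequence_dominated:
  fixes h :: "nat \<Rightarrow> 'a \<Rightarrow> real"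
  assumes int: "\<And>n. integrable M (h n)" and pos: "\<And>n x. 0 \<le> h n x"
    and lim: "(\<lambda>n. \<integral>x. h n x \<partial>M) \<longlonglongrightarrow> 0"
  obtains s G where "strict_mono s" "integrable M G" "AE x in M. \<forall>n. h (s n) x \<le> G x"
    "AE x in M. (\<lambda>n. h (s n) x) \<longlonglongrightarrow> 0"
proof -
  have "\<exists>s. strict_mono s \<and> (\<forall>n. (\<integral>x. h (s n) x \<partial>M) < (1/2) ^ n)"
  proof -
    have ev: "\<exists>k>m. (\<integral>x. h k x \<partial>M) < (1/2) ^ n" for m n
    proof -
      have "\<forall>\<^sub>F k in sequentially. (\<integral>x. h k x \<partial>M) < (1/2) ^ n"
        using order_tendstoD(2)[OF lim] by simp
      then have "\<forall>\<^sub>F k in sequentially. (\<integral>x. h k x \<partial>M) < (1/2) ^ n \<and> k > m"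
        using eventually_gt_at_top by (rule eventually_conj)
      then show ?thesis
        using eventually_happens'[OF sequentially_bot] by fast
    qed
    have "\<exists>s. \<forall>n. (\<integral>x. h (s n) x \<partial>M) < (1/2) ^ n \<and> s n < s (Suc n)"
    proof (rule dependent_nat_choice)
      show "\<exists>k. (\<integral>x. h k x \<partial>M) < (1/2) ^ 0" using ev[of 0 0] by blast
      show "\<exists>y. (\<integral>x. h y x \<partial>M) < (1/2) ^ Suc n \<and> k < y" for k n using ev[of k "Suc n"] by blast
    qed
    then show ?thesis by (auto simp: strict_mono_Suc_iff)
  qed
  then obtain s where s: "strict_mono s" "\<And>n. (\<integral>x. h (s n) x \<partial>M) < (1/2) ^ n" by blast
  have sum: "summable (\<lambda>n. \<integral>x. h (s n) x \<partial>M)"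
  proof (rule summable_comparison_test')
    show "summable (\<lambda>n. (1/2::real) ^ n)" by (rule summable_geometric) simp
    show "norm (\<integral>x. h (s n) x \<partial>M) \<le> (1/2) ^ n" if "n \<ge> 0" for n
      using s(2)[of n] pos by (simp add: Bochner_Integration.integral_nonneg)
  qed
  have AE: "AE x in M. summable (\<lambda>n. h (s n) x)"
    by (rule AE_summable_of_summable_integral[OF int pos sum])
  show ?thesis
  proof (rule that[OF s(1)])
    show "integrable M (\<lambda>x. \<Sum>n. h (s n) x)"
      using AE sum by (intro integrable_suminf int) (simp_all add: pos)
    show "AE x in M. \<forall>n. h (s n) x \<le> (\<Sum>n. h (s n) x)"
      using AE
    proof eventually_elim
      case (elim x)
      show ?case using sum_le_suminf[OF elim, of "{n}" for n] pos by simp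
    qed
    show "AE x in M. (\<lambda>n. h (s n) x) \<longlonglongrightarrow> 0"
      using AE by eventually_elim (rule summable_LIMSEQ_zero)
  qed
qed

lemma Fatou_real:
  fixes g :: "nat \<Rightarrow> 'a \<Rightarrow> real"
  assumes int: "\<And>n. integrable M (g n)" and pos: "\<And>n x. 0 \<le> g n x"
    and le: "\<And>n. n \<ge> m \<Longrightarrow> (\<integral>x. g n x \<partial>M) \<le> c"
    and lim: "AE x in M. (\<lambda>n. g n x) \<longlonglongrightarrow> G x"
    and G[measurable]: "G \<in> borel_measurable M" and G0: "\<And>x. 0 \<le> G x"
  shows "integrable M G" "(\<integral>x. G x \<partial>M) \<le> c"
proof -
  have "0 \<le> (\<integral>x. g m x \<partial>M)" by (rule Bochner_Integration.integral_nonneg) (rule pos)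
  then have c: "0 \<le> c" using le[of m] by simp
  have gm[measurable]: "g n \<in> borel_measurable M" for n using int by auto
  have "(\<integral>\<^sup>+x. ennreal (G x) \<partial>M) = (\<integral>\<^sup>+x. liminf (\<lambda>n. ennreal (g n x)) \<partial>M)"
  proof (rule nn_integral_cong_AE)
    show "AE x in M. ennreal (G x) = liminf (\<lambda>n. ennreal (g n x))"
      using lim by eventually_elim (auto intro!: lim_imp_Liminf[symmetric] tendsto_ennrealI)
  qed
  also have "\<dots> \<le> liminf (\<lambda>n. \<integral>\<^sup>+x. ennreal (g n x) \<partial>M)"
    by (rule nn_integral_liminf) simp
  also have "\<dots> \<le> limsup (\<lambda>n. \<integral>\<^sup>+x. ennreal (g n x) \<partial>M)"
    by (rule Liminf_le_Limsup) simp
  also have "\<dots> \<le> ennreal c"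
  proof (rule Limsup_bounded)
    show "\<forall>\<^sub>F n in sequentially. (\<integral>\<^sup>+x. ennreal (g n x) \<partial>M) \<le> ennreal c"
      using eventually_ge_at_top[of m]
      by eventually_elim (use int pos le in \<open>auto simp: nn_integral_eq_integral intro!: ennreal_leI\<close>)
  qed
  finally have *: "(\<integral>\<^sup>+x. ennreal (G x) \<partial>M) \<le> ennreal c" .
  show i: "integrable M G"
    using * G0 by (intro integrableI_nonneg) (auto simp: order.strict_trans1[OF _ ennreal_less_top])
  show "(\<integral>x. G x \<partial>M) \<le> c"
    using * G0 i c by (simp add: nn_integral_eq_integral)
qed

section \<open>Powers of Lebesgue norms\<close>

text \<open>The \<open>r\<close>-th power of the norm of \<open>L\<^sup>r\<close>. Its convexity and the crude
  bound \<open>Lp_lincomb(2)\<close> take over the role of the triangle inequality.\<close>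

definition Lpow :: "real \<Rightarrow> 'a::euclidean_space set \<Rightarrow> ('a \<Rightarrow> 'b::euclidean_space) \<Rightarrow> real" where
  "Lpow r \<Omega> f = (\<integral>x. norm (f x) powr r \<partial>lebesgue_on \<Omega>)"

lemma Lpow_nonneg: "0 \<le> Lpow r \<Omega> f"
  unfolding Lpow_def by (intro Bochner_Integration.integral_nonneg) simp

lemma Lp_norm_tendsto_0_iff:
  assumes "r > 0"
  shows "(\<lambda>n. Lp_norm r \<Omega> (f n)) \<longlonglongrightarrow> 0 \<longleftrightarrow> (\<lambda>n. Lpow r \<Omega> (f n)) \<longlonglongrightarrow> 0"
proof
  assume "(\<lambda>n. Lp_norm r \<Omega> (f n)) \<longlonglongrightarrow> 0"
  then have "(\<lambda>n. Lp_norm r \<Omega> (f n) powr r) \<longlonglongrightarrow> 0 powr r"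
    using assms by (intro tendsto_powr') (auto simp: Lp_norm_def)
  moreover have "Lp_norm r \<Omega> (f n) powr r = Lpow r \<Omega> (f n)" for n
    using assms Lpow_nonneg[of r \<Omega> "f n"] by (simp add: Lp_norm_def Lpow_def powr_powr)
  ultimately show "(\<lambda>n. Lpow r \<Omega> (f n)) \<longlonglongrightarrow> 0" by simp
next
  assume "(\<lambda>n. Lpow r \<Omega> (f n)) \<longlonglongrightarrow> 0"
  then have "(\<lambda>n. Lpow r \<Omega> (f n) powr (1 / r)) \<longlonglongrightarrow> 0 powr (1 / r)"
    using assms by (intro tendsto_powr') (auto simp: Lpow_nonneg)
  then show "(\<lambda>n. Lp_norm r \<Omega> (f n)) \<longlonglongrightarrow> 0"
    by (simp add: Lp_norm_def Lpow_def)
qed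

lemma LpD: 
  assumes "f \<in> Lp r \<Omega>"
  shows "f \<in> borel_measurable (lebesgue_on \<Omega>)" "integrable (lebesgue_on \<Omega>) (\<lambda>x. norm (f x) powr r)"
  using assms by (auto simp: Lp_def)

lemma powr_add_le:
  fixes x y :: real
  assumes "0 \<le> x" "0 \<le> y" "0 < r"
  shows "(x + y) powr r \<le> 2 powr r * (x powr r + y powr r)"
proof -
  have "(x + y) powr r \<le> (2 * max x y) powr r"
    using assms by (intro powr_mono2) auto
  also have "\<dots> = 2 powr r * max x y powr r" using assms by (simp add: powr_mult)
  also have "max x y powr r \<le> x powr r + y powr r" by (auto simp: max_def)
  finally show ?thesis by simp
qed

lemma norm_lincomb_powr_le:
  fixes x y :: "'a::real_normed_vector"
  assumes "0 < r"
  shows "norm (a *\<^sub>R x + b *\<^sub>R y) powr r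
    \<le> 2 powr r * (\<bar>a\<bar> powr r * norm x powr r + \<bar>b\<bar> powr r * norm y powr r)"
proof -
  have "norm (a *\<^sub>R x + b *\<^sub>R y) powr r \<le> (\<bar>a\<bar> * norm x + \<bar>b\<bar> * norm y) powr r"
    using assms norm_triangle_ineq[of "a *\<^sub>R x" "b *\<^sub>R y"] by (intro powr_mono2) auto
  also have "\<dots> \<le> 2 powr r * ((\<bar>a\<bar> * norm x) powr r + (\<bar>b\<bar> * norm y) powr r)"
    using assms by (intro powr_add_le) auto
  finally show ?thesis by (simp add: powr_mult)
qed

lemma Lp_lincomb:
  fixes f g :: "'a::euclidean_space \<Rightarrow> 'b::euclidean_space"
  assumes "0 < r" "f \<in> Lp r \<Omega>" "g \<in> Lp r \<Omega>"
  shows "(\<lambda>x. a *\<^sub>R f x + b *\<^sub>R g x) \<in> Lp r \<Omega>"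
    and "Lpow r \<Omega> (\<lambda>x. a *\<^sub>R f x + b *\<^sub>R g x)
      \<le> 2 powr r * (\<bar>a\<bar> powr r * Lpow r \<Omega> f + \<bar>b\<bar> powr r * Lpow r \<Omega> g)"
proof -
  note [measurable] = LpD(1)[OF assms(2)] LpD(1)[OF assms(3)]
  note [simp] = LpD(2)[OF assms(2)] LpD(2)[OF assms(3)]
  let ?R = "\<lambda>x. 2 powr r * (\<bar>a\<bar> powr r * norm (f x) powr r + \<bar>b\<bar> powr r * norm (g x) powr r)"
  have R: "integrable (lebesgue_on \<Omega>) ?R" by simp
  have int: "integrable (lebesgue_on \<Omega>) (\<lambda>x. norm (a *\<^sub>R f x + b *\<^sub>R g x) powr r)"
  proof (rule Bochner_Integration.integrable_bound[OF R])
    show "AE x in lebesgue_on \<Omega>. norm (norm (a *\<^sub>R f x + b *\<^sub>R g x) powr r) \<le> norm (?R x)"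
      using norm_lincomb_powr_le[OF assms(1)] by (auto intro!: AE_I2 order.trans[OF _ abs_ge_self])
  qed measurable
  then show "(\<lambda>x. a *\<^sub>R f x + b *\<^sub>R g x) \<in> Lp r \<Omega>"
    by (simp add: Lp_def)
  have "Lpow r \<Omega> (\<lambda>x. a *\<^sub>R f x + b *\<^sub>R g x) \<le> integral\<^sup>L (lebesgue_on \<Omega>) ?R"
    unfolding Lpow_def using norm_lincomb_powr_le[OF assms(1)] by (intro integral_mono int R)
  then show "Lpow r \<Omega> (\<lambda>x. a *\<^sub>R f x + b *\<^sub>R g x)
      \<le> 2 powr r * (\<bar>a\<bar> powr r * Lpow r \<Omega> f + \<bar>b\<bar> powr r * Lpow r \<Omega> g)"
    by (simp add: Lpow_def)
qed

lemma Lp_diff: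
  fixes f g :: "'a::euclidean_space \<Rightarrow> 'b::euclidean_space"
  assumes "0 < r" "f \<in> Lp r \<Omega>" "g \<in> Lp r \<Omega>"
  shows "(\<lambda>x. f x - g x) \<in> Lp r \<Omega>"
  using Lp_lincomb(1)[OF assms, of 1 "-1"] by simp

lemma Lpow_triangle:
  fixes f g h :: "'a::euclidean_space \<Rightarrow> 'b::euclidean_space"
  assumes "0 < r" "f \<in> Lp r \<Omega>" "g \<in> Lp r \<Omega>" "h \<in> Lp r \<Omega>"
  shows "Lpow r \<Omega> (\<lambda>x. f x - h x)
      \<le> 2 powr r * (Lpow r \<Omega> (\<lambda>x. f x - g x) + Lpow r \<Omega> (\<lambda>x. g x - h x))"
  using Lp_lincomb(2)[OF assms(1) Lp_diff[OF assms(1-3)] Lp_diff[OF assms(1,3,4)], of 1 1] by simp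

lemma Lpow_scale:
  fixes f :: "'a::euclidean_space \<Rightarrow> 'b::euclidean_space"
  shows "Lpow r \<Omega> (\<lambda>x. a *\<^sub>R f x) = \<bar>a\<bar> powr r * Lpow r \<Omega> f"
  by (simp add: Lpow_def powr_mult)

lemma midpoint_powr_le:
  fixes x y :: real
  assumes "0 \<le> x" "0 \<le> y" "1 \<le> r"
  shows "((x + y) / 2) powr r \<le> (x powr r + y powr r) / 2"
proof (cases "x = 0 \<or> y = 0")
  case True
  have *: "(t / 2) powr r \<le> t powr r / 2" if "0 \<le> t" for t :: real
  proof -
    have "2 powr 1 \<le> (2 powr r :: real)" using assms(3) by (intro powr_mono) auto
    then have "t powr r / 2 powr r \<le> t powr r / 2" by (intro divide_left_mono) auto
    then show ?thesis using that by (simp add: powr_divide)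
  qed
  show ?thesis using True *[of x] *[of y] assms by auto
next
  case False
  have "((1 - 1/2) *\<^sub>R x + (1/2) *\<^sub>R y) powr r \<le> (1 - 1/2) * x powr r + 1/2 * y powr r"
    using False assms by (intro convex_onD[OF powr_convex[OF assms(3)]]) auto
  then show ?thesis by (simp add: field_simps)
qed

text \<open>Convexity: balls around \<open>0\<close> with respect to \<open>Lpow\<close> are closed under
  midpoints, which is what the parallelogram argument for lower semicontinuity uses.\<close>

lemma Lpow_midpoint:
  fixes f g :: "'a::euclidean_space \<Rightarrow> 'b::euclidean_space"
  assumes "1 \<le> r" "f \<in> Lp r \<Omega>" "g \<in> Lp r \<Omega>"
  shows "Lpow r \<Omega> (\<lambda>x. (1/2) *\<^sub>R f x + (1/2) *\<^sub>R g x) \<le> (Lpow r \<Omega> f + Lpow r \<Omega> g) / 2"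
proof -
  have r: "0 < r" using assms by simp
  have le: "norm ((1/2) *\<^sub>R f x + (1/2) *\<^sub>R g x) powr r \<le> (norm (f x) powr r + norm (g x) powr r) / 2" for x
  proof -
    have "norm ((1/2) *\<^sub>R f x + (1/2) *\<^sub>R g x) powr r \<le> ((norm (f x) + norm (g x)) / 2) powr r"
      using norm_triangle_ineq[of "(1/2) *\<^sub>R f x" "(1/2) *\<^sub>R g x"] r by (intro powr_mono2) auto
    then show ?thesis using midpoint_powr_le[of "norm (f x)" "norm (g x)" r] assms by auto
  qed
  have "Lpow r \<Omega> (\<lambda>x. (1/2) *\<^sub>R f x + (1/2) *\<^sub>R g x)
     \<le> (\<integral>x. (norm (f x) powr r + norm (g x) powr r) / 2 \<partial>lebesgue_on \<Omega>)"
    unfolding Lpow_def using LpD(2)[OF Lp_lincomb(1)[OF r assms(2,3)]] LpD(2)[OF assms(2)] LpD(2)[OF assms(3)] le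
    by (intro integral_mono) auto
  then show ?thesis using LpD(2)[OF assms(2)] LpD(2)[OF assms(3)] by (simp add: Lpow_def)
qed

text \<open>Gives the limits of the interaction integrals by dominated convergence, since those integrands are
  controlled by \<open>2p\<close>-th powers.\<close>

lemma Lpow_subsequence_dominated:
  fixes f :: "nat \<Rightarrow> 'a::euclidean_space \<Rightarrow> 'b::euclidean_space"
  assumes "0 < r" "\<And>n. f n \<in> Lp r \<Omega>" "g \<in> Lp r \<Omega>"
    and lim: "(\<lambda>n. Lpow r \<Omega> (\<lambda>x. f n x - g x)) \<longlonglongrightarrow> 0"
  obtains s G where "strict_mono s" "integrable (lebesgue_on \<Omega>) G"
    "AE x in lebesgue_on \<Omega>. \<forall>n. norm (f (s n) x) powr r \<le> G x"
    "AE x in lebesgue_on \<Omega>. (\<lambda>n. f (s n) x) \<longlonglongrightarrow> g x"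
proof -
  obtain s G where s: "strict_mono s" "integrable (lebesgue_on \<Omega>) G"
    "AE x in lebesgue_on \<Omega>. \<forall>n. norm (f (s n) x - g x) powr r \<le> G x"
    "AE x in lebesgue_on \<Omega>. (\<lambda>n. norm (f (s n) x - g x) powr r) \<longlonglongrightarrow> 0"
  proof (rule L1_null_subsequence_dominated[of "lebesgue_on \<Omega>" "\<lambda>n x. norm (f n x - g x) powr r"])
    show "integrable (lebesgue_on \<Omega>) (\<lambda>x. norm (f n x - g x) powr r)" for n
      by (rule LpD(2)[OF Lp_diff[OF assms(1,2,3)]])
  qed (use lim in \<open>auto simp: Lpow_def\<close>)
  show ?thesis
  proof (rule that[OF s(1)])
    let ?G = "\<lambda>x. 2 powr r * (G x + norm (g x) powr r)"
    show "integrable (lebesgue_on \<Omega>) ?G"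
      using s(2) LpD(2)[OF assms(3)] by simp
    show "AE x in lebesgue_on \<Omega>. \<forall>n. norm (f (s n) x) powr r \<le> ?G x"
      using s(3)
    proof eventually_elim
      case (elim x)
      show ?case
      proof
        fix n
        have "norm (1 *\<^sub>R (f (s n) x - g x) + 1 *\<^sub>R g x) powr r
          \<le> 2 powr r * (\<bar>1\<bar> powr r * norm (f (s n) x - g x) powr r + \<bar>1\<bar> powr r * norm (g x) powr r)"
          by (rule norm_lincomb_powr_le[OF assms(1)])
        also have "\<dots> \<le> ?G x" using elim by simp
        finally show "norm (f (s n) x) powr r \<le> ?G x" by simp
      qed
    qed
    show "AE x in lebesgue_on \<Omega>. (\<lambda>n. f (s n) x) \<longlonglongrightarrow> g x"
      using s(4)
    proof eventually_elim
      case (elim x)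
      have "(\<lambda>n. (norm (f (s n) x - g x) powr r) powr (1 / r)) \<longlonglongrightarrow> 0 powr (1 / r)"
        using elim assms(1) by (intro tendsto_powr') auto
      then have "(\<lambda>n. norm (f (s n) x - g x)) \<longlonglongrightarrow> 0"
        using assms(1) by (simp add: powr_powr)
      then show ?case by (simp add: tendsto_norm_zero_iff LIM_zero_iff)
    qed
  qed
qed

text \<open>Fatou's lemma for the differences \<open>f m - f (s n)\<close> with \<open>m\<close> fixed: an
  almost everywhere limit of a subsequence of a Cauchy sequence is its limit in
  \<open>L\<^sup>r\<close>.\<close>

lemma Lpow_Cauchy_AE_limit:
  fixes f :: "nat \<Rightarrow> 'a::euclidean_space \<Rightarrow> 'b::euclidean_space"
  assumes r: "0 < r" and f: "\<And>n. f n \<in> Lp r \<Omega>"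
    and C: "\<And>e. e > 0 \<Longrightarrow> \<exists>M. \<forall>m\<ge>M. \<forall>n\<ge>M. Lpow r \<Omega> (\<lambda>x. f m x - f n x) < e"
    and s: "strict_mono s" and lim: "AE x in lebesgue_on \<Omega>. (\<lambda>n. f (s n) x) \<longlonglongrightarrow> g x"
    and g[measurable]: "g \<in> borel_measurable (lebesgue_on \<Omega>)"
  shows "g \<in> Lp r \<Omega>" "(\<lambda>n. Lpow r \<Omega> (\<lambda>x. f n x - g x)) \<longlonglongrightarrow> 0"
proof -
  have fm[measurable]: "f n \<in> borel_measurable (lebesgue_on \<Omega>)" for n using LpD(1)[OF f] .
  have key: "integrable (lebesgue_on \<Omega>) (\<lambda>x. norm (f m x - g x) powr r) \<and> Lpow r \<Omega> (\<lambda>x. f m x - g x) \<le> e"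
    if M: "\<And>m n. m \<ge> M \<Longrightarrow> n \<ge> M \<Longrightarrow> Lpow r \<Omega> (\<lambda>x. f m x - f n x) < e" and m: "m \<ge> M" for M m e
  proof -
    have a: "AE x in lebesgue_on \<Omega>. (\<lambda>n. norm (f m x - f (s n) x) powr r) \<longlonglongrightarrow> norm (f m x - g x) powr r"
      using lim
    proof eventually_elim
      case (elim x)
      show ?case using r by (intro tendsto_powr' tendsto_norm tendsto_diff tendsto_const elim) auto
    qed
    have b: "(\<integral>x. norm (f m x - f (s n) x) powr r \<partial>lebesgue_on \<Omega>) \<le> e" if "n \<ge> M" for n
    proof -
      have "s n \<ge> M" using seq_suble[OF s, of n] that by simp
      then show ?thesis using M[OF m, of "s n"] by (simp add: Lpow_def)
    qed
    have i: "integrable (lebesgue_on \<Omega>) (\<lambda>x. norm (f m x - f (s n) x) powr r)" for n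
      by (rule LpD(2)[OF Lp_diff[OF r f f]])
    have p: "0 \<le> norm (f m x - f (s n) x) powr r" "0 \<le> norm (f m x - g x) powr r" for n x by auto
    have mm: "(\<lambda>x. norm (f m x - g x) powr r) \<in> borel_measurable (lebesgue_on \<Omega>)" by measurable
    show ?thesis
      using Fatou_real[OF i p(1) b a mm p(2)] by (simp add: Lpow_def)
  qed
  obtain M where "\<forall>m\<ge>M. \<forall>n\<ge>M. Lpow r \<Omega> (\<lambda>x. f m x - f n x) < 1" using C[of 1] by auto
  then have "(\<lambda>x. f M x - g x) \<in> Lp r \<Omega>" using key[of M 1 M] by (auto simp: Lp_def)
  from Lp_diff[OF r f[of M] this] show gL: "g \<in> Lp r \<Omega>" by simp
  show "(\<lambda>n. Lpow r \<Omega> (\<lambda>x. f n x - g x)) \<longlonglongrightarrow> 0"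
  proof (rule LIMSEQ_I)
    fix e :: real assume "0 < e"
    then obtain M where M: "\<forall>m\<ge>M. \<forall>n\<ge>M. Lpow r \<Omega> (\<lambda>x. f m x - f n x) < e / 2" using C[of "e / 2"] by auto
    have "norm (Lpow r \<Omega> (\<lambda>x. f n x - g x) - 0) < e" if "n \<ge> M" for n
      using key[of M "e / 2" n] M that \<open>0 < e\<close> Lpow_nonneg[of r \<Omega> "\<lambda>x. f n x - g x"] by auto
    then show "\<exists>N. \<forall>n\<ge>N. norm (Lpow r \<Omega> (\<lambda>x. f n x - g x) - 0) < e" by blast
  qed
qed

text \<open>For a subsequence whose increments \<open>d\<^sub>n\<close> have \<open>\<integral>
  |d\<^sub>n|\<^sup>r\<close> below \<open>4\<^sup>-\<^sup>r\<^sup>n\<close>, the functions \<open>(2\<^sup>n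
  |d\<^sub>n|)\<^sup>r\<close> have summable integrals. So almost everywhere \<open>|d\<^sub>n| \<le>
  2\<^sup>-\<^sup>n\<close> eventually, and the subsequence converges pointwise.\<close>

lemma Lp_complete:
  fixes f :: "nat \<Rightarrow> 'a::euclidean_space \<Rightarrow> 'b::euclidean_space"
  assumes r: "0 < r" and f: "\<And>n. f n \<in> Lp r \<Omega>"
    and C: "\<And>e. e > 0 \<Longrightarrow> \<exists>M. \<forall>m\<ge>M. \<forall>n\<ge>M. Lpow r \<Omega> (\<lambda>x. f m x - f n x) < e"
  obtains g where "g \<in> Lp r \<Omega>" "(\<lambda>n. Lpow r \<Omega> (\<lambda>x. f n x - g x)) \<longlonglongrightarrow> 0"
proof -
  have fm[measurable]: "f n \<in> borel_measurable (lebesgue_on \<Omega>)" for n using LpD(1)[OF f] .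
  \<comment> \<open>decays fast enough to absorb the factor \<open>2\<^sup>r\<^sup>n\<close> in \<open>h\<close>\<close>
  define c :: "nat \<Rightarrow> real" where "c n = (1/4) powr (r * n)" for n
  have c: "c n > 0" for n by (simp add: c_def)
  have "\<exists>s. \<forall>n. (\<forall>i\<ge>s n. \<forall>j\<ge>s n. Lpow r \<Omega> (\<lambda>x. f i x - f j x) < c n) \<and> s n < s (Suc n)"
  proof (rule dependent_nat_choice)
    show "\<exists>k. \<forall>i\<ge>k. \<forall>j\<ge>k. Lpow r \<Omega> (\<lambda>x. f i x - f j x) < c 0" using C[OF c] .
    fix k n
    obtain M where "\<forall>i\<ge>M. \<forall>j\<ge>M. Lpow r \<Omega> (\<lambda>x. f i x - f j x) < c (Suc n)" using C[OF c] by blast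
    then show "\<exists>y. (\<forall>i\<ge>y. \<forall>j\<ge>y. Lpow r \<Omega> (\<lambda>x. f i x - f j x) < c (Suc n)) \<and> k < y"
      by (intro exI[of _ "max M (Suc k)"]) auto
  qed
  then obtain s where s: "\<And>n i j. i \<ge> s n \<Longrightarrow> j \<ge> s n \<Longrightarrow> Lpow r \<Omega> (\<lambda>x. f i x - f j x) < c n"
    "\<And>n. s n < s (Suc n)" by blast
  have sm: "strict_mono s" using s(2) by (simp add: strict_mono_Suc_iff)
  define h where "h n x = (2 ^ n * norm (f (s (Suc n)) x - f (s n) x)) powr r" for n x
  have h_eq: "h n x = 2 powr (r * n) * norm (f (s (Suc n)) x - f (s n) x) powr r" for n x
    by (simp add: h_def powr_mult powr_realpow[symmetric] powr_powr mult.commute)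
  have hi: "integrable (lebesgue_on \<Omega>) (h n)" for n
    unfolding h_eq[abs_def] by (intro integrable_mult_right LpD(2)[OF Lp_diff[OF r f f]])
  have hI: "(\<integral>x. h n x \<partial>lebesgue_on \<Omega>) \<le> ((1/2) powr r) ^ n" for n
  proof -
    have "(\<integral>x. h n x \<partial>lebesgue_on \<Omega>) = 2 powr (r * n) * Lpow r \<Omega> (\<lambda>x. f (s (Suc n)) x - f (s n) x)"
      unfolding h_eq Lpow_def by simp
    also have "\<dots> \<le> 2 powr (r * n) * c n"
      using s(1)[of n "s (Suc n)" "s n"] s(2)[of n] by (intro mult_left_mono) auto
    also have "\<dots> = (1/2) powr (r * n)"
      by (simp add: c_def flip: powr_mult)
    also have "\<dots> = ((1/2) powr r) ^ n"
      by (simp add: powr_powr flip: powr_realpow)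
    finally show ?thesis .
  qed
  have sumI: "summable (\<lambda>n. \<integral>x. h n x \<partial>lebesgue_on \<Omega>)"
  proof (rule summable_comparison_test')
    have "(1/2) powr r < (1::real)" using r powr_less_mono2[of r "1/2" 1] by simp
    then show "summable (\<lambda>n. ((1/2::real) powr r) ^ n)" by (intro summable_geometric) simp
    show "norm (\<integral>x. h n x \<partial>lebesgue_on \<Omega>) \<le> ((1/2) powr r) ^ n" if "n \<ge> 0" for n
    proof -
      have "0 \<le> (\<integral>x. h n x \<partial>lebesgue_on \<Omega>)"
        by (intro Bochner_Integration.integral_nonneg) (simp add: h_def)
      then show ?thesis using hI[of n] by simp
    qed
  qed
  have "AE x in lebesgue_on \<Omega>. summable (\<lambda>n. h n x)"
    by (rule AE_summable_of_summable_integral[OF hi _ sumI]) (simp add: h_def)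
  then have conv: "AE x in lebesgue_on \<Omega>. convergent (\<lambda>n. f (s n) x)"
  proof eventually_elim
    case (elim x)
    from summable_LIMSEQ_zero[OF elim] have "\<forall>\<^sub>F n in sequentially. h n x < 1"
      by (rule order_tendstoD) simp
    then have "\<forall>\<^sub>F n in sequentially. norm (f (s (Suc n)) x - f (s n) x) \<le> (1/2) ^ n"
    proof eventually_elim
      case (elim n)
      have "2 ^ n * norm (f (s (Suc n)) x - f (s n) x) \<le> 1"
      proof (rule ccontr)
        assume "\<not> ?thesis"
        then have "1 powr r \<le> h n x" unfolding h_def using r by (intro powr_mono2) auto
        then show False using elim by simp
      qed
      then show ?case by (simp add: field_simps power_one_over)
    qed
    then have "summable (\<lambda>n. f (s (Suc n)) x - f (s n) x)"
      by (rule summable_comparison_test_ev) (rule summable_geometric, simp)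
    then have "convergent (\<lambda>n. \<Sum>i<n. f (s (Suc i)) x - f (s i) x)"
      by (simp add: summable_iff_convergent)
    then have "convergent (\<lambda>n. (f (s n) x - f (s 0) x) + f (s 0) x)"
      by (subst (asm) sum_lessThan_telescope) (intro convergent_add convergent_const)
    then show ?case by simp
  qed
  define g where "g x = lim (\<lambda>n. f (s n) x)" for x
  have gm: "g \<in> borel_measurable (lebesgue_on \<Omega>)"
    unfolding g_def[abs_def] by (intro borel_measurable_lim_metric fm)
  have "AE x in lebesgue_on \<Omega>. (\<lambda>n. f (s n) x) \<longlonglongrightarrow> g x"
    using conv by eventually_elim (simp add: g_def convergent_LIMSEQ_iff)
  from Lpow_Cauchy_AE_limit[OF r f C sm this gm] show ?thesis by (rule that)
qed

text \<open>On a set of finite measure this bounds an \<open>L\<^sup>1\<close> norm by an arbitrarily small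
  constant and a multiple of the \<open>r\<close>-th power, so that convergence in \<open>L\<^sup>r\<close>
  yields convergence of integrals against test functions.\<close>

lemma Young_split:
  fixes t \<delta> :: real
  assumes "0 \<le> t" "0 < \<delta>" "1 \<le> r"
  shows "t \<le> \<delta> + \<delta> powr (1 - r) * t powr r"
proof (cases "t \<le> \<delta>")
  case True
  then show ?thesis by (simp add: add_increasing2)
next
  case False
  then have "t = t powr (1 - r) * t powr r" using assms by (simp flip: powr_add)
  also have "\<dots> \<le> \<delta> powr (1 - r) * t powr r"
    using False assms by (intro mult_right_mono powr_mono2') auto
  finally show ?thesis using assms by linarith
qed

lemma Lp_locally_integrable:
  fixes f :: "'a::euclidean_space \<Rightarrow> 'b::euclidean_space"
  assumes "open \<Omega>" "1 \<le> r" "f \<in> Lp r \<Omega>"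
  shows "locally_integrable_in \<Omega> f"
  unfolding locally_integrable_in_def
proof (intro allI impI)
  fix K assume K: "compact K \<and> K \<subseteq> \<Omega>"
  have 1: "integrable (lebesgue_on \<Omega>) (\<lambda>x. indicator K x *\<^sub>R (1::real))"
    using continuous_imp_locally_integrable[OF assms(1), of "\<lambda>_. 1::real"] K
    unfolding locally_integrable_in_def by auto
  note [measurable] = LpD(1)[OF assms(3)]
  have Km: "(indicator K :: 'a \<Rightarrow> real) \<in> borel_measurable (lebesgue_on \<Omega>)"
    using borel_measurable_integrable[OF 1] by simp
  show "integrable (lebesgue_on \<Omega>) (\<lambda>x. indicator K x *\<^sub>R f x)"
  proof (rule Bochner_Integration.integrable_bound)
    show "integrable (lebesgue_on \<Omega>) (\<lambda>x. indicator K x *\<^sub>R 1 + norm (f x) powr r)"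
      by (intro Bochner_Integration.integrable_add 1 LpD(2)[OF assms(3)])
    show "(\<lambda>x. indicator K x *\<^sub>R f x) \<in> borel_measurable (lebesgue_on \<Omega>)"
      using Km by measurable
    have "norm (f x) \<le> 1 + norm (f x) powr r" for x
      using Young_split[of "norm (f x)" 1 r] assms(2) by simp
    then show "AE x in lebesgue_on \<Omega>. norm (indicator K x *\<^sub>R f x) \<le> norm (indicator K x *\<^sub>R 1 + norm (f x) powr r)"
      by (auto split: split_indicator)
  qed
qed

lemma tendsto_integral_compact_support_mult:
  fixes f :: "nat \<Rightarrow> 'a::euclidean_space \<Rightarrow> 'b::euclidean_space"
  assumes \<Omega>: "open \<Omega>" and r: "1 \<le> r" and f: "\<And>n. f n \<in> Lp r \<Omega>" and g: "g \<in> Lp r \<Omega>"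
    and lim: "(\<lambda>n. Lpow r \<Omega> (\<lambda>x. f n x - g x)) \<longlonglongrightarrow> 0"
    and \<psi>: "continuous_on UNIV \<psi>" "compact K" "K \<subseteq> \<Omega>" "\<And>x. x \<notin> K \<Longrightarrow> \<psi> x = (0::real)"
  shows "(\<lambda>n. \<integral>x. \<psi> x *\<^sub>R f n x \<partial>lebesgue_on \<Omega>) \<longlonglongrightarrow> (\<integral>x. \<psi> x *\<^sub>R g x \<partial>lebesgue_on \<Omega>)"
proof (rule LIMSEQ_I)
  fix e :: real assume e: "e > 0"
  have r0: "0 < r" using r by simp
  obtain B where B: "B \<ge> 0" "\<And>x. norm (\<psi> x) \<le> B * indicator K x"
    using continuous_compact_support_bounded[OF \<psi>(1,2,4)] by blast
  have 1: "integrable (lebesgue_on \<Omega>) (\<lambda>x. indicator K x :: real)"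
    using continuous_imp_locally_integrable[OF \<Omega>, of "\<lambda>_. 1::real"] \<psi>(2,3)
    unfolding locally_integrable_in_def by auto
  define m :: real where "m = (\<integral>x. indicator K x \<partial>lebesgue_on \<Omega>)"
  have m: "m \<ge> 0" unfolding m_def by (intro Bochner_Integration.integral_nonneg) auto
  define \<delta> where "\<delta> = e / (2 * (B * m + 1))"
  have Bm: "B * m \<ge> 0" using B(1) m by simp
  have \<delta>: "\<delta> > 0" "B * m * \<delta> < e / 2" using e Bm by (auto simp: \<delta>_def field_simps)
  have d: "(\<lambda>x. f n x - g x) \<in> Lp r \<Omega>" for n by (rule Lp_diff[OF r0 f g])
  have int: "integrable (lebesgue_on \<Omega>) (\<lambda>x. \<psi> x *\<^sub>R h x)" if "h \<in> Lp r \<Omega>" for h :: "'a \<Rightarrow> 'b"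
    by (rule integrable_test_mult[OF Lp_locally_integrable[OF \<Omega> r that] \<psi>])
  have bound: "norm ((\<integral>x. \<psi> x *\<^sub>R f n x \<partial>lebesgue_on \<Omega>) - (\<integral>x. \<psi> x *\<^sub>R g x \<partial>lebesgue_on \<Omega>))
     \<le> B * m * \<delta> + B * \<delta> powr (1 - r) * Lpow r \<Omega> (\<lambda>x. f n x - g x)" for n
  proof -
    have "(\<integral>x. \<psi> x *\<^sub>R f n x \<partial>lebesgue_on \<Omega>) - (\<integral>x. \<psi> x *\<^sub>R g x \<partial>lebesgue_on \<Omega>) =
      (\<integral>x. \<psi> x *\<^sub>R (f n x - g x) \<partial>lebesgue_on \<Omega>)"
      using int[OF f] int[OF g] by (simp add: scaleR_diff_right)
    also have "norm \<dots> \<le> (\<integral>x. norm (\<psi> x *\<^sub>R (f n x - g x)) \<partial>lebesgue_on \<Omega>)"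
      by (rule integral_norm_bound)
    also have "\<dots> \<le> (\<integral>x. B * \<delta> * indicator K x + B * \<delta> powr (1 - r) * norm (f n x - g x) powr r \<partial>lebesgue_on \<Omega>)"
    proof (rule integral_mono)
      show "integrable (lebesgue_on \<Omega>) (\<lambda>x. norm (\<psi> x *\<^sub>R (f n x - g x)))"
        by (intro integrable_norm int d)
      show "integrable (lebesgue_on \<Omega>) (\<lambda>x. B * \<delta> * indicator K x + B * \<delta> powr (1 - r) * norm (f n x - g x) powr r)"
        using 1 LpD(2)[OF d] by simp
      fix x
      have "norm (\<psi> x *\<^sub>R (f n x - g x)) \<le> B * indicator K x * norm (f n x - g x)"
        using B(2)[of x] by (auto intro: mult_right_mono)
      also have "\<dots> \<le> B * indicator K x * (\<delta> + \<delta> powr (1 - r) * norm (f n x - g x) powr r)"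
        using Young_split[of "norm (f n x - g x)" \<delta> r] \<delta>(1) r B(1) by (intro mult_left_mono) auto
      also have "\<dots> \<le> B * \<delta> * indicator K x + B * \<delta> powr (1 - r) * norm (f n x - g x) powr r"
        using B(1) by (auto simp: algebra_simps split: split_indicator)
      finally show "norm (\<psi> x *\<^sub>R (f n x - g x)) \<le> B * \<delta> * indicator K x + B * \<delta> powr (1 - r) * norm (f n x - g x) powr r" .
    qed
    also have "\<dots> = B * m * \<delta> + B * \<delta> powr (1 - r) * Lpow r \<Omega> (\<lambda>x. f n x - g x)"
      using 1 LpD(2)[OF d] by (simp add: m_def Lpow_def)
    finally show ?thesis .
  qed
  have "(\<lambda>n. B * \<delta> powr (1 - r) * Lpow r \<Omega> (\<lambda>x. f n x - g x)) \<longlonglongrightarrow> B * \<delta> powr (1 - r) * 0"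
    by (intro tendsto_intros lim)
  then have "\<forall>\<^sub>F n in sequentially. B * \<delta> powr (1 - r) * Lpow r \<Omega> (\<lambda>x. f n x - g x) < e / 2"
    using e by (intro order_tendstoD(2)) auto
  then obtain N where N: "\<And>n. n \<ge> N \<Longrightarrow> B * \<delta> powr (1 - r) * Lpow r \<Omega> (\<lambda>x. f n x - g x) < e / 2"
    by (auto simp: eventually_sequentially)
  have "norm ((\<integral>x. \<psi> x *\<^sub>R f n x \<partial>lebesgue_on \<Omega>) - (\<integral>x. \<psi> x *\<^sub>R g x \<partial>lebesgue_on \<Omega>)) < e" if "n \<ge> N" for n
    using bound[of n] N[OF that] \<delta>(2) by linarith
  then show "\<exists>N. \<forall>n\<ge>N. norm ((\<integral>x. \<psi> x *\<^sub>R f n x \<partial>lebesgue_on \<Omega>) - (\<integral>x. \<psi> x *\<^sub>R g x \<partial>lebesgue_on \<Omega>)) < e"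
    by blast
qed

lemma weak_gradient_limit:
  fixes f :: "nat \<Rightarrow> 'a::euclidean_space \<Rightarrow> real"
  assumes \<Omega>: "open \<Omega>" and r: "1 \<le> r" and r': "1 \<le> r'"
    and f: "\<And>n. f n \<in> Lp r \<Omega>" "u \<in> Lp r \<Omega>" "(\<lambda>n. Lpow r \<Omega> (\<lambda>x. f n x - u x)) \<longlonglongrightarrow> 0"
    and g: "\<And>n. g n \<in> Lp r' \<Omega>" "G \<in> Lp r' \<Omega>" "(\<lambda>n. Lpow r' \<Omega> (\<lambda>x. g n x - G x)) \<longlonglongrightarrow> 0"
    and wg: "\<And>n. weak_gradient \<Omega> (f n) (g n)"
  shows "weak_gradient \<Omega> u G"
  unfolding weak_gradient_alt[OF \<Omega>]
proof (intro conjI ballI)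
  show "locally_integrable_in \<Omega> u" by (rule Lp_locally_integrable[OF \<Omega> r f(2)])
  show "locally_integrable_in \<Omega> G" by (rule Lp_locally_integrable[OF \<Omega> r' g(2)])
  fix \<phi> and b :: 'a assume \<phi>: "\<phi> \<in> Cc_infinity \<Omega>" and b: "b \<in> Basis"
  obtain K where K: "compact K" "K \<subseteq> \<Omega>" "\<And>x. x \<notin> K \<Longrightarrow> \<phi> x = 0"
    "\<And>x y. x \<notin> K \<Longrightarrow> frechet_derivative \<phi> (at x) y = 0"
    using Cc_infinity_supportE[OF \<phi>] by metis
  have 1: "(\<lambda>n. \<integral>x. frechet_derivative \<phi> (at x) b * f n x \<partial>lebesgue_on \<Omega>)
      \<longlonglongrightarrow> (\<integral>x. frechet_derivative \<phi> (at x) b * u x \<partial>lebesgue_on \<Omega>)"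
    using tendsto_integral_compact_support_mult[OF \<Omega> r f Cc_infinityD(3)[OF \<phi> b] K(1,2,4)] by simp
  have "(\<lambda>n. \<integral>x. \<phi> x *\<^sub>R g n x \<partial>lebesgue_on \<Omega>) \<longlonglongrightarrow> (\<integral>x. \<phi> x *\<^sub>R G x \<partial>lebesgue_on \<Omega>)"
    by (rule tendsto_integral_compact_support_mult[OF \<Omega> r' g Cc_infinityD(1)[OF \<phi>] K(1,2,3)])
  then have "(\<lambda>n. - ((\<integral>x. \<phi> x *\<^sub>R g n x \<partial>lebesgue_on \<Omega>) \<bullet> b)) \<longlonglongrightarrow> - ((\<integral>x. \<phi> x *\<^sub>R G x \<partial>lebesgue_on \<Omega>) \<bullet> b)"
    by (intro tendsto_intros)
  moreover have "(\<integral>x. \<phi> x *\<^sub>R h x \<partial>lebesgue_on \<Omega>) \<bullet> b = (\<integral>x. \<phi> x * (h x \<bullet> b) \<partial>lebesgue_on \<Omega>)"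
    if "h \<in> Lp r' \<Omega>" for h :: "'a \<Rightarrow> 'a"
    using integral_inner_left[OF integrable_test_function_mult(1)[OF Lp_locally_integrable[OF \<Omega> r' that] \<phi>], of b]
    by simp
  ultimately have "(\<lambda>n. - (\<integral>x. \<phi> x * (g n x \<bullet> b) \<partial>lebesgue_on \<Omega>)) \<longlonglongrightarrow> - (\<integral>x. \<phi> x * (G x \<bullet> b) \<partial>lebesgue_on \<Omega>)"
    using g(1,2) by simp
  moreover have "- (\<integral>x. \<phi> x * (g n x \<bullet> b) \<partial>lebesgue_on \<Omega>) = (\<integral>x. frechet_derivative \<phi> (at x) b * f n x \<partial>lebesgue_on \<Omega>)" for n
    using wg[of n] \<phi> b by (simp add: weak_gradient_alt[OF \<Omega>])
  ultimately show "(\<integral>x. frechet_derivative \<phi> (at x) b * u x \<partial>lebesgue_on \<Omega>) = - (\<integral>x. \<phi> x * (G x \<bullet> b) \<partial>lebesgue_on \<Omega>)"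
    using 1 LIMSEQ_unique by simp
qed

lemma measurable_lebesgue_on_AE_cong:
  fixes f g :: "'a::euclidean_space \<Rightarrow> 'b::euclidean_space"
  assumes "open \<Omega>" "f \<in> borel_measurable (lebesgue_on \<Omega>)" "AE x in lebesgue_on \<Omega>. g x = f x"
  shows "g \<in> borel_measurable (lebesgue_on \<Omega>)"
proof -
  have S: "\<Omega> \<inter> space lebesgue \<in> sets lebesgue" using assms(1) by auto
  have "(\<lambda>x. indicator \<Omega> x *\<^sub>R f x) \<in> borel_measurable lebesgue"
    using assms(2) by (simp add: borel_measurable_restrict_space_iff[OF S])
  moreover have "AE x in lebesgue. indicator \<Omega> x *\<^sub>R f x = indicator \<Omega> x *\<^sub>R g x"
    using assms(3) unfolding AE_restrict_space_iff[OF S]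
    by eventually_elim (auto split: split_indicator)
  ultimately have "(\<lambda>x. indicator \<Omega> x *\<^sub>R g x) \<in> borel_measurable lebesgue"
    by (rule borel_measurable_AE)
  then show ?thesis by (simp add: borel_measurable_restrict_space_iff[OF S])
qed

lemma integrable_lebesgue_on_AE_cong:
  fixes f g :: "'a::euclidean_space \<Rightarrow> 'b::euclidean_space"
  assumes "open \<Omega>" "integrable (lebesgue_on \<Omega>) f" "AE x in lebesgue_on \<Omega>. g x = f x"
  shows "integrable (lebesgue_on \<Omega>) g" "integral\<^sup>L (lebesgue_on \<Omega>) g = integral\<^sup>L (lebesgue_on \<Omega>) f"
proof -
  have m: "g \<in> borel_measurable (lebesgue_on \<Omega>)"
    by (rule measurable_lebesgue_on_AE_cong[OF assms(1) borel_measurable_integrable[OF assms(2)] assms(3)])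
  show "integrable (lebesgue_on \<Omega>) g"
    using assms(2) m integrable_cong_AE[OF m borel_measurable_integrable[OF assms(2)] assms(3)] by simp
  show "integral\<^sup>L (lebesgue_on \<Omega>) g = integral\<^sup>L (lebesgue_on \<Omega>) f"
    by (rule integral_cong_AE[OF m borel_measurable_integrable[OF assms(2)] assms(3)])
qed

section \<open>Functions with a square integrable gradient\<close>

text \<open>Membership in the surrounding Sobolev space with norm \<open>shifted_norm \<Omega>
  \<kappa>\<close>: for \<open>\<kappa> = 0\<close> only the gradient is square integrable, for
  \<open>\<kappa> \<noteq> 0\<close> the function is so as well.\<close>

definition L2_gradient :: "'a::euclidean_space set \<Rightarrow> real \<Rightarrow> ('a \<Rightarrow> real) \<Rightarrow> ('a \<Rightarrow> 'a) \<Rightarrow> bool" where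
  "L2_gradient \<Omega> \<kappa> u g \<longleftrightarrow> weak_gradient \<Omega> u g \<and> g \<in> Lp 2 \<Omega> \<and> (\<kappa> \<noteq> 0 \<longrightarrow> u \<in> Lp 2 \<Omega>)"

lemma shifted_norm_eq:
  assumes \<Omega>: "open \<Omega>" and g: "L2_gradient \<Omega> \<kappa> u g" and \<kappa>: "0 \<le> \<kappa>"
  shows "(shifted_norm \<Omega> \<kappa> u)\<^sup>2 = Lpow 2 \<Omega> g + \<kappa> * Lpow 2 \<Omega> u"
proof -
  have 1: "integrable (lebesgue_on \<Omega>) (\<lambda>x. (norm (g x))\<^sup>2)"
    using g LpD(2)[of g 2 \<Omega>] by (simp add: L2_gradient_def)
  have 2: "integrable (lebesgue_on \<Omega>) (\<lambda>x. \<kappa> * (u x)\<^sup>2)"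
    using g LpD(2)[of u 2 \<Omega>] by (cases "\<kappa> = 0") (auto simp: L2_gradient_def)
  have "(\<integral>x. (norm (wgrad \<Omega> u x))\<^sup>2 + \<kappa> * (u x)\<^sup>2 \<partial>lebesgue_on \<Omega>) =
      (\<integral>x. (norm (g x))\<^sup>2 + \<kappa> * (u x)\<^sup>2 \<partial>lebesgue_on \<Omega>)"
  proof (rule integrable_lebesgue_on_AE_cong(2)[OF \<Omega>])
    show "AE x in lebesgue_on \<Omega>. (norm (wgrad \<Omega> u x))\<^sup>2 + \<kappa> * (u x)\<^sup>2 = (norm (g x))\<^sup>2 + \<kappa> * (u x)\<^sup>2"
      using wgrad_AE_eq[OF \<Omega>, of u g] g by (auto simp: L2_gradient_def elim: eventually_mono)
  qed (use 1 2 in simp)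
  also have "\<dots> = Lpow 2 \<Omega> g + \<kappa> * Lpow 2 \<Omega> u"
    using 1 2 by (simp add: Lpow_def)
  finally show ?thesis
    using \<kappa> Lpow_nonneg[of 2 \<Omega> g] Lpow_nonneg[of 2 \<Omega> u] by (simp add: shifted_norm_def)
qed

lemma L2_gradient_lincomb:
  assumes "open \<Omega>" "L2_gradient \<Omega> \<kappa> u g" "L2_gradient \<Omega> \<kappa> v h"
  shows "L2_gradient \<Omega> \<kappa> (\<lambda>x. a * u x + b * v x) (\<lambda>x. a *\<^sub>R g x + b *\<^sub>R h x)"
  using assms weak_gradient_lincomb[OF assms(1)] Lp_lincomb(1)[of 2 g \<Omega> h a b] Lp_lincomb(1)[of 2 u \<Omega> v a b]
  by (auto simp: L2_gradient_def)

lemma L2_gradient_diff: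
  assumes "open \<Omega>" "L2_gradient \<Omega> \<kappa> u g" "L2_gradient \<Omega> \<kappa> v h"
  shows "L2_gradient \<Omega> \<kappa> (\<lambda>x. u x - v x) (\<lambda>x. g x - h x)"
  using L2_gradient_lincomb[OF assms, of 1 "-1"] by simp

lemma continuous_compact_support_Lp:
  fixes f :: "'a::euclidean_space \<Rightarrow> 'b::euclidean_space"
  assumes \<Omega>: "open \<Omega>" and f: "continuous_on UNIV f" "compact K" "K \<subseteq> \<Omega>" "\<And>x. x \<notin> K \<Longrightarrow> f x = 0" and r: "0 < r"
  shows "f \<in> Lp r \<Omega>"
proof -
  have "integrable (lebesgue_on \<Omega>) (\<lambda>x. norm (f x) powr r)"
  proof (rule integrable_continuous_compact_support[OF \<Omega> _ f(2,3)])
    show "continuous_on UNIV (\<lambda>x. norm (f x) powr r)"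
      using f(1) r by (intro continuous_on_powr' continuous_intros) auto
  qed (use f(4) r in auto)
  then show ?thesis using continuous_borel_measurable_lebesgue_on[OF f(1)] by (simp add: Lp_def)
qed

lemma Cc_infinity_Lp:
  assumes "open \<Omega>" "\<phi> \<in> Cc_infinity \<Omega>" "0 < r"
  shows "\<phi> \<in> Lp r \<Omega>" "grad \<phi> \<in> Lp r \<Omega>"
proof -
  obtain K where K: "compact K" "K \<subseteq> \<Omega>" "\<And>x. x \<notin> K \<Longrightarrow> \<phi> x = 0" "\<And>x. x \<notin> K \<Longrightarrow> grad \<phi> x = 0"
    using Cc_infinity_supportE[OF assms(2)] by metis
  show "\<phi> \<in> Lp r \<Omega>"
    by (rule continuous_compact_support_Lp[OF assms(1) Cc_infinityD(1)[OF assms(2)] K(1-3) assms(3)])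
  show "grad \<phi> \<in> Lp r \<Omega>"
    by (rule continuous_compact_support_Lp[OF assms(1) Cc_infinityD(4)[OF assms(2)] K(1,2,4) assms(3)])
qed

lemma L2_gradient_test_function:
  assumes "open \<Omega>" "\<phi> \<in> Cc_infinity \<Omega>"
  shows "L2_gradient \<Omega> \<kappa> \<phi> (grad \<phi>)"
  using assms weak_gradient_test_function Cc_infinity_Lp[of \<Omega> \<phi> 2] by (auto simp: L2_gradient_def)

lemma shifted_norm_nonneg_of_L2_gradient:
  assumes "open \<Omega>" "L2_gradient \<Omega> \<kappa> u g" "0 \<le> \<kappa>"
  shows "0 \<le> shifted_norm \<Omega> \<kappa> u"
proof -
  have "0 \<le> (\<integral>x. (norm (wgrad \<Omega> u x))\<^sup>2 + \<kappa> * (u x)\<^sup>2 \<partial>lebesgue_on \<Omega>)"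
    using assms(3) by (intro Bochner_Integration.integral_nonneg) auto
  then show ?thesis by (simp add: shifted_norm_def)
qed

text \<open>The factor \<open>2\<close> is the price for using \<open>|x + y|\<^sup>2 \<le> 4 (|x|\<^sup>2 +
  |y|\<^sup>2)\<close>; it is harmless in limits.\<close>

lemma shifted_norm_lincomb_le:
  assumes \<Omega>: "open \<Omega>" and \<kappa>: "0 \<le> \<kappa>" and u: "L2_gradient \<Omega> \<kappa> u g" and v: "L2_gradient \<Omega> \<kappa> v h"
  shows "shifted_norm \<Omega> \<kappa> (\<lambda>x. a * u x + b * v x) \<le> 2 * (\<bar>a\<bar> * shifted_norm \<Omega> \<kappa> u + \<bar>b\<bar> * shifted_norm \<Omega> \<kappa> v)"
proof -
  let ?N = "shifted_norm \<Omega> \<kappa>"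
  have nn: "0 \<le> ?N u" "0 \<le> ?N v"
    using shifted_norm_nonneg_of_L2_gradient[OF \<Omega> _ \<kappa>] u v by blast+
  have 1: "Lpow 2 \<Omega> (\<lambda>x. a *\<^sub>R g x + b *\<^sub>R h x) \<le> 4 * (a\<^sup>2 * Lpow 2 \<Omega> g + b\<^sup>2 * Lpow 2 \<Omega> h)"
    using Lp_lincomb(2)[of 2 g \<Omega> h a b] u v by (auto simp: L2_gradient_def)
  have 2: "\<kappa> * Lpow 2 \<Omega> (\<lambda>x. a * u x + b * v x) \<le> \<kappa> * (4 * (a\<^sup>2 * Lpow 2 \<Omega> u + b\<^sup>2 * Lpow 2 \<Omega> v))"
  proof (cases "\<kappa> = 0")
    case False
    then have "Lpow 2 \<Omega> (\<lambda>x. a * u x + b * v x) \<le> 4 * (a\<^sup>2 * Lpow 2 \<Omega> u + b\<^sup>2 * Lpow 2 \<Omega> v)"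
      using Lp_lincomb(2)[of 2 u \<Omega> v a b] u v by (auto simp: L2_gradient_def)
    then show ?thesis using \<kappa> by (rule mult_left_mono)
  qed simp
  have "(?N (\<lambda>x. a * u x + b * v x))\<^sup>2 \<le> 4 * (a\<^sup>2 * (?N u)\<^sup>2 + b\<^sup>2 * (?N v)\<^sup>2)"
    using 1 2 unfolding shifted_norm_eq[OF \<Omega> L2_gradient_lincomb[OF \<Omega> u v] \<kappa>]
      shifted_norm_eq[OF \<Omega> u \<kappa>] shifted_norm_eq[OF \<Omega> v \<kappa>]
    by (simp add: algebra_simps)
  also have "\<dots> \<le> (2 * (\<bar>a\<bar> * ?N u + \<bar>b\<bar> * ?N v))\<^sup>2"
    using nn by (simp add: power_mult_distrib power2_sum distrib_left)
  finally show ?thesis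
    using nn by (intro power2_le_imp_le[of "?N (\<lambda>x. a * u x + b * v x)"]) auto
qed

text \<open>The gradients converge in \<open>L\<^sup>2\<close> by completeness, and the limit is the weak
  gradient of \<open>w\<close> because \<open>f n\<close> tends to \<open>w\<close> in
  \<open>L\<^sup>r\<close>. When \<open>\<kappa> \<noteq> 0\<close> the sequence is also Cauchy in
  \<open>L\<^sup>2\<close>, and its limit there agrees with \<open>w\<close>, as both are almost everywhere
  limits of subsequences.\<close>

lemma L2_gradient_limit:
  fixes f :: "nat \<Rightarrow> 'a::euclidean_space \<Rightarrow> real"
  assumes \<Omega>: "open \<Omega>" and \<kappa>: "0 \<le> \<kappa>" and r: "1 \<le> r"
    and fg: "\<And>n. L2_gradient \<Omega> \<kappa> (f n) (g n)"
    and f: "\<And>n. f n \<in> Lp r \<Omega>" "w \<in> Lp r \<Omega>" "(\<lambda>n. Lpow r \<Omega> (\<lambda>x. f n x - w x)) \<longlonglongrightarrow> 0"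
    and C: "\<And>e. e > 0 \<Longrightarrow> \<exists>M. \<forall>m\<ge>M. \<forall>n\<ge>M. shifted_norm \<Omega> \<kappa> (\<lambda>x. f m x - f n x) < e"
  obtains G where "L2_gradient \<Omega> \<kappa> w G" "(\<lambda>n. shifted_norm \<Omega> \<kappa> (\<lambda>x. f n x - w x)) \<longlonglongrightarrow> 0"
proof -
  have eq: "(shifted_norm \<Omega> \<kappa> (\<lambda>x. f m x - f n x))\<^sup>2
      = Lpow 2 \<Omega> (\<lambda>x. g m x - g n x) + \<kappa> * Lpow 2 \<Omega> (\<lambda>x. f m x - f n x)" for m n
    by (rule shifted_norm_eq[OF \<Omega> L2_gradient_diff[OF \<Omega> fg fg] \<kappa>])
  have nn: "0 \<le> shifted_norm \<Omega> \<kappa> (\<lambda>x. f m x - f n x)" for m n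
    by (rule shifted_norm_nonneg_of_L2_gradient[OF \<Omega> L2_gradient_diff[OF \<Omega> fg fg] \<kappa>])
  have sq: "\<exists>M. \<forall>m\<ge>M. \<forall>n\<ge>M. (shifted_norm \<Omega> \<kappa> (\<lambda>x. f m x - f n x))\<^sup>2 < e" if e: "e > 0" for e
  proof -
    obtain M where M: "\<forall>m\<ge>M. \<forall>n\<ge>M. shifted_norm \<Omega> \<kappa> (\<lambda>x. f m x - f n x) < sqrt e"
      using C[of "sqrt e"] e by auto
    have "(shifted_norm \<Omega> \<kappa> (\<lambda>x. f m x - f n x))\<^sup>2 < (sqrt e)\<^sup>2" if "m \<ge> M" "n \<ge> M" for m n
      using M that nn by (intro power_strict_mono) auto
    then show ?thesis using e by auto
  qed
  have gL: "g n \<in> Lp 2 \<Omega>" for n using fg by (auto simp: L2_gradient_def)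
  have Cg: "\<exists>M. \<forall>m\<ge>M. \<forall>n\<ge>M. Lpow 2 \<Omega> (\<lambda>x. g m x - g n x) < e" if e: "e > 0" for e
  proof -
    have "Lpow 2 \<Omega> (\<lambda>x. g m x - g n x) \<le> (shifted_norm \<Omega> \<kappa> (\<lambda>x. f m x - f n x))\<^sup>2" for m n
      unfolding eq using mult_nonneg_nonneg[OF \<kappa> Lpow_nonneg[of 2 \<Omega> "\<lambda>x. f m x - f n x"]] by simp
    then show ?thesis using sq[OF e] by (meson le_less_trans)
  qed
  obtain G where G: "G \<in> Lp 2 \<Omega>" "(\<lambda>n. Lpow 2 \<Omega> (\<lambda>x. g n x - G x)) \<longlonglongrightarrow> 0"
    by (rule Lp_complete[OF zero_less_numeral gL Cg])
  have wG: "weak_gradient \<Omega> w G"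
    using fg by (intro weak_gradient_limit[OF \<Omega> r _ f gL G]) (auto simp: L2_gradient_def)
  have k: "w \<in> Lp 2 \<Omega> \<and> (\<lambda>n. Lpow 2 \<Omega> (\<lambda>x. f n x - w x)) \<longlonglongrightarrow> 0" if k0: "\<kappa> \<noteq> 0"
  proof -
    have f2: "f n \<in> Lp 2 \<Omega>" for n using fg[of n] k0 by (auto simp: L2_gradient_def)
    have C2: "\<exists>M. \<forall>m\<ge>M. \<forall>n\<ge>M. Lpow 2 \<Omega> (\<lambda>x. f m x - f n x) < e" if e: "e > 0" for e
    proof -
      have "\<kappa> * Lpow 2 \<Omega> (\<lambda>x. f m x - f n x) \<le> (shifted_norm \<Omega> \<kappa> (\<lambda>x. f m x - f n x))\<^sup>2" for m n
        unfolding eq using Lpow_nonneg[of 2 \<Omega> "\<lambda>x. g m x - g n x"] by auto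
      moreover obtain M where "\<forall>m\<ge>M. \<forall>n\<ge>M. (shifted_norm \<Omega> \<kappa> (\<lambda>x. f m x - f n x))\<^sup>2 < \<kappa> * e"
        using sq[of "\<kappa> * e"] e k0 \<kappa> by auto
      ultimately have "\<forall>m\<ge>M. \<forall>n\<ge>M. \<kappa> * Lpow 2 \<Omega> (\<lambda>x. f m x - f n x) < \<kappa> * e"
        by (meson le_less_trans)
      then show ?thesis using k0 \<kappa> by auto
    qed
    obtain s G where "strict_mono s" "AE x in lebesgue_on \<Omega>. (\<lambda>n. f (s n) x) \<longlonglongrightarrow> w x"
      using Lpow_subsequence_dominated[OF _ f] r by (metis less_le_trans zero_less_one)
    with Lpow_Cauchy_AE_limit[OF _ f2 C2] LpD(1)[OF f(2)] show ?thesis by auto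
  qed
  have wL: "L2_gradient \<Omega> \<kappa> w G" using wG G(1) k by (auto simp: L2_gradient_def)
  have "(\<lambda>n. Lpow 2 \<Omega> (\<lambda>x. g n x - G x) + \<kappa> * Lpow 2 \<Omega> (\<lambda>x. f n x - w x)) \<longlonglongrightarrow> 0 + \<kappa> * 0"
    using G(2) k by (cases "\<kappa> = 0") (auto intro!: tendsto_eq_intros)
  then have "(\<lambda>n. (shifted_norm \<Omega> \<kappa> (\<lambda>x. f n x - w x))\<^sup>2) \<longlonglongrightarrow> 0"
    unfolding shifted_norm_eq[OF \<Omega> L2_gradient_diff[OF \<Omega> fg wL] \<kappa>] by simp
  then have "(\<lambda>n. sqrt ((shifted_norm \<Omega> \<kappa> (\<lambda>x. f n x - w x))\<^sup>2)) \<longlonglongrightarrow> sqrt 0"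
    by (rule tendsto_real_sqrt)
  moreover have "0 \<le> shifted_norm \<Omega> \<kappa> (\<lambda>x. f n x - w x)" for n
    by (rule shifted_norm_nonneg_of_L2_gradient[OF \<Omega> L2_gradient_diff[OF \<Omega> fg wL] \<kappa>])
  ultimately have "(\<lambda>n. shifted_norm \<Omega> \<kappa> (\<lambda>x. f n x - w x)) \<longlonglongrightarrow> 0" by simp
  with wL show ?thesis by (rule that)
qed

lemma H1_norm_eq: "H1_norm \<Omega> = shifted_norm \<Omega> 1"
  by (rule ext) (simp add: H1_norm_def shifted_norm_def)

lemma D12_norm_eq: "D12_norm \<Omega> = shifted_norm \<Omega> 0"
  by (rule ext) (simp add: D12_norm_def shifted_norm_def)

lemma H10_L2_gradient: "u \<in> H10 \<Omega> \<Longrightarrow> \<exists>g. L2_gradient \<Omega> 1 u g"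
  by (auto simp: H10_def H1_def L2_gradient_def)

lemma shifted_norm_diff_self:
  assumes "open \<Omega>" "\<phi> \<in> Cc_infinity \<Omega>" "0 \<le> \<kappa>"
  shows "shifted_norm \<Omega> \<kappa> (\<lambda>x. \<phi> x - \<phi> x) = 0"
  using shifted_norm_eq[OF assms(1) L2_gradient_diff[OF assms(1) L2_gradient_test_function[OF assms(1,2)] L2_gradient_test_function[OF assms(1,2)]] assms(3)]
  by (simp add: Lpow_def)

lemma Cc_subset_H10: 
  assumes "open \<Omega>" shows "Cc_infinity \<Omega> \<subseteq> H10 \<Omega>"
proof
  fix \<phi> assume \<phi>: "\<phi> \<in> Cc_infinity \<Omega>"
  have "\<phi> \<in> H1 \<Omega>" using L2_gradient_test_function[OF assms \<phi>, of 1] by (auto simp: H1_def L2_gradient_def)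
  then show "\<phi> \<in> H10 \<Omega>"
    using \<phi> shifted_norm_diff_self[OF assms \<phi>, of 1] by (auto simp: H10_def H1_norm_eq intro!: exI[of _ "\<lambda>_. \<phi>"])
qed

lemma Cc_subset_D012: 
  assumes "open \<Omega>" shows "Cc_infinity \<Omega> \<subseteq> D012 \<Omega>"
proof
  fix \<phi> assume \<phi>: "\<phi> \<in> Cc_infinity \<Omega>"
  show "\<phi> \<in> D012 \<Omega>"
    using \<phi> shifted_norm_diff_self[OF assms \<phi>, of 0] by (auto simp: D012_def D12_norm_eq intro!: exI[of _ "\<lambda>_. \<phi>"])
qed

lemma H10_lincomb:
  assumes \<Omega>: "open \<Omega>" and u: "u \<in> H10 \<Omega>" and v: "v \<in> H10 \<Omega>"
  shows "(\<lambda>x. a * u x + b * v x) \<in> H10 \<Omega>"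
proof -
  obtain g h where g: "L2_gradient \<Omega> 1 u g" and h: "L2_gradient \<Omega> 1 v h"
    using H10_L2_gradient u v by blast
  obtain \<phi> \<psi> where \<phi>: "\<And>n. \<phi> n \<in> Cc_infinity \<Omega>" "(\<lambda>n. shifted_norm \<Omega> 1 (\<lambda>x. \<phi> n x - u x)) \<longlonglongrightarrow> 0"
    and \<psi>: "\<And>n. \<psi> n \<in> Cc_infinity \<Omega>" "(\<lambda>n. shifted_norm \<Omega> 1 (\<lambda>x. \<psi> n x - v x)) \<longlonglongrightarrow> 0"
    using u v by (auto simp: H10_def H1_norm_eq)
  have 1: "(\<lambda>x. a * u x + b * v x) \<in> H1 \<Omega>"
    using L2_gradient_lincomb[OF \<Omega> g h, of a b] by (auto simp: H1_def L2_gradient_def)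
  have d: "L2_gradient \<Omega> 1 (\<lambda>x. \<phi> n x - u x) (\<lambda>x. grad (\<phi> n) x - g x)"
    "L2_gradient \<Omega> 1 (\<lambda>x. \<psi> n x - v x) (\<lambda>x. grad (\<psi> n) x - h x)" for n
    using L2_gradient_diff[OF \<Omega> L2_gradient_test_function[OF \<Omega> \<phi>(1)] g]
      L2_gradient_diff[OF \<Omega> L2_gradient_test_function[OF \<Omega> \<psi>(1)] h] by blast+
  have "(\<lambda>n. shifted_norm \<Omega> 1 (\<lambda>x. (a * \<phi> n x + b * \<psi> n x) - (a * u x + b * v x))) \<longlonglongrightarrow> 0"
  proof (rule tendsto_sandwich[OF always_eventually always_eventually])
    have eq: "(\<lambda>x. (a * \<phi> n x + b * \<psi> n x) - (a * u x + b * v x)) = (\<lambda>x. a * (\<phi> n x - u x) + b * (\<psi> n x - v x))" for n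
      by (auto simp: algebra_simps)
    show "\<forall>n. shifted_norm \<Omega> 1 (\<lambda>x. (a * \<phi> n x + b * \<psi> n x) - (a * u x + b * v x))
       \<le> 2 * (\<bar>a\<bar> * shifted_norm \<Omega> 1 (\<lambda>x. \<phi> n x - u x) + \<bar>b\<bar> * shifted_norm \<Omega> 1 (\<lambda>x. \<psi> n x - v x))"
      unfolding eq using shifted_norm_lincomb_le[OF \<Omega> _ d] by simp
    show "\<forall>n. 0 \<le> shifted_norm \<Omega> 1 (\<lambda>x. (a * \<phi> n x + b * \<psi> n x) - (a * u x + b * v x))"
      unfolding eq using shifted_norm_nonneg_of_L2_gradient[OF \<Omega> L2_gradient_lincomb[OF \<Omega> d]] by simp
    have "(\<lambda>n. 2 * (\<bar>a\<bar> * shifted_norm \<Omega> 1 (\<lambda>x. \<phi> n x - u x) + \<bar>b\<bar> * shifted_norm \<Omega> 1 (\<lambda>x. \<psi> n x - v x)))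
        \<longlonglongrightarrow> 2 * (\<bar>a\<bar> * 0 + \<bar>b\<bar> * 0)"
      by (intro tendsto_intros \<phi>(2) \<psi>(2))
    then show "(\<lambda>n. 2 * (\<bar>a\<bar> * shifted_norm \<Omega> 1 (\<lambda>x. \<phi> n x - u x) + \<bar>b\<bar> * shifted_norm \<Omega> 1 (\<lambda>x. \<psi> n x - v x)))
        \<longlonglongrightarrow> 0" by simp
  qed simp
  then show ?thesis
    using 1 Cc_infinity_lincomb[OF \<phi>(1) \<psi>(1)]
    by (auto simp: H10_def H1_norm_eq intro!: exI[of _ "\<lambda>n x. a * \<phi> n x + b * \<psi> n x"])
qed

lemma D012_lincomb:
  assumes \<Omega>: "open \<Omega>" and u: "u \<in> D012 \<Omega>" and v: "v \<in> D012 \<Omega>"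
  shows "(\<lambda>x. a * u x + b * v x) \<in> D012 \<Omega>"
proof -
  let ?N = "shifted_norm \<Omega> 0"
  obtain \<phi> where \<phi>: "\<And>n. \<phi> n \<in> Cc_infinity \<Omega>"
      "\<And>e. e > 0 \<Longrightarrow> \<exists>M. \<forall>m\<ge>M. \<forall>n\<ge>M. ?N (\<lambda>x. \<phi> m x - \<phi> n x) < e"
      "AE x in lebesgue_on \<Omega>. (\<lambda>n. \<phi> n x) \<longlonglongrightarrow> u x"
    using u by (auto simp: D012_def D12_norm_eq)
  obtain \<psi> where \<psi>: "\<And>n. \<psi> n \<in> Cc_infinity \<Omega>"
      "\<And>e. e > 0 \<Longrightarrow> \<exists>M. \<forall>m\<ge>M. \<forall>n\<ge>M. ?N (\<lambda>x. \<psi> m x - \<psi> n x) < e"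
      "AE x in lebesgue_on \<Omega>. (\<lambda>n. \<psi> n x) \<longlonglongrightarrow> v x"
    using v by (auto simp: D012_def D12_norm_eq)
  have d: "L2_gradient \<Omega> 0 (\<lambda>x. \<phi> m x - \<phi> n x) (\<lambda>x. grad (\<phi> m) x - grad (\<phi> n) x)"
    "L2_gradient \<Omega> 0 (\<lambda>x. \<psi> m x - \<psi> n x) (\<lambda>x. grad (\<psi> m) x - grad (\<psi> n) x)" for m n
    using L2_gradient_diff[OF \<Omega> L2_gradient_test_function[OF \<Omega> \<phi>(1)] L2_gradient_test_function[OF \<Omega> \<phi>(1)]]
      L2_gradient_diff[OF \<Omega> L2_gradient_test_function[OF \<Omega> \<psi>(1)] L2_gradient_test_function[OF \<Omega> \<psi>(1)]] by blast+
  have "\<exists>M. \<forall>m\<ge>M. \<forall>n\<ge>M. ?N (\<lambda>x. (a * \<phi> m x + b * \<psi> m x) - (a * \<phi> n x + b * \<psi> n x)) < e" if e: "e > 0" for e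
  proof -
    define \<delta> where "\<delta> = e / (2 * (1 + \<bar>a\<bar> + \<bar>b\<bar>))"
    have \<delta>: "\<delta> > 0" "2 * (\<bar>a\<bar> * \<delta> + \<bar>b\<bar> * \<delta>) < e"
    proof -
      show "\<delta> > 0" using e by (simp add: \<delta>_def add_pos_nonneg)
      have "2 * (1 + \<bar>a\<bar> + \<bar>b\<bar>) * \<delta> = e" by (simp add: \<delta>_def)
      then show "2 * (\<bar>a\<bar> * \<delta> + \<bar>b\<bar> * \<delta>) < e" using \<open>\<delta> > 0\<close> by (simp add: algebra_simps)
    qed
    obtain M1 where M1: "\<forall>m\<ge>M1. \<forall>n\<ge>M1. ?N (\<lambda>x. \<phi> m x - \<phi> n x) < \<delta>" using \<phi>(2)[OF \<delta>(1)] by blast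
    obtain M2 where M2: "\<forall>m\<ge>M2. \<forall>n\<ge>M2. ?N (\<lambda>x. \<psi> m x - \<psi> n x) < \<delta>" using \<psi>(2)[OF \<delta>(1)] by blast
    have "?N (\<lambda>x. (a * \<phi> m x + b * \<psi> m x) - (a * \<phi> n x + b * \<psi> n x)) < e"
      if "m \<ge> max M1 M2" "n \<ge> max M1 M2" for m n
    proof -
      have eq: "(\<lambda>x. (a * \<phi> m x + b * \<psi> m x) - (a * \<phi> n x + b * \<psi> n x)) = (\<lambda>x. a * (\<phi> m x - \<phi> n x) + b * (\<psi> m x - \<psi> n x))"
        by (auto simp: algebra_simps)
      have "?N (\<lambda>x. a * (\<phi> m x - \<phi> n x) + b * (\<psi> m x - \<psi> n x))
         \<le> 2 * (\<bar>a\<bar> * ?N (\<lambda>x. \<phi> m x - \<phi> n x) + \<bar>b\<bar> * ?N (\<lambda>x. \<psi> m x - \<psi> n x))"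
        by (rule shifted_norm_lincomb_le[OF \<Omega> _ d]) simp
      also have "\<dots> \<le> 2 * (\<bar>a\<bar> * \<delta> + \<bar>b\<bar> * \<delta>)"
        using M1 M2 that by (intro mult_left_mono add_mono) (auto intro: less_imp_le)
      finally show ?thesis unfolding eq using \<delta>(2) by simp
    qed
    then show ?thesis by blast
  qed
  moreover have "AE x in lebesgue_on \<Omega>. (\<lambda>n. a * \<phi> n x + b * \<psi> n x) \<longlonglongrightarrow> a * u x + b * v x"
    using \<phi>(3) \<psi>(3) by eventually_elim (intro tendsto_intros)
  ultimately show ?thesis
    using Cc_infinity_lincomb[OF \<phi>(1) \<psi>(1)]
    unfolding D012_def D12_norm_eq by (intro CollectI exI[of _ "\<lambda>n x. a * \<phi> n x + b * \<psi> n x"]) blast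
qed

section \<open>The spaces under the coercivity and compactness assumptions\<close>

lemma integral_lincomb3:
  fixes f g h :: "'a \<Rightarrow> real"
  assumes "integrable M f" "integrable M g" "integrable M h"
  shows "integrable M (\<lambda>x. a * f x + b * g x + c * h x)"
    and "(\<integral>x. a * f x + b * g x + c * h x \<partial>M) = a * (\<integral>x. f x \<partial>M) + b * (\<integral>x. g x \<partial>M) + c * (\<integral>x. h x \<partial>M)"
  using assms by simp_all

text \<open>The parameter \<open>\<kappa>\<close> selects the standard norm of \<open>H\<close>, and
  \<open>\<mu>\<close> stands for one of the coefficients \<open>\<lambda>\<^sub>i\<close>; the exponent
  \<open>r\<close> will be \<open>2p\<close>.\<close>

locale coercive_space =
  fixes \<Omega> :: "'a::euclidean_space set" and H :: "('a \<Rightarrow> real) set" and \<kappa> r \<mu> :: real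
  assumes \<Omega>: "open \<Omega>"
    and space: "H = H10 \<Omega> \<and> \<kappa> = 1 \<or> H = D012 \<Omega> \<and> \<kappa> = 0"
    and r: "1 < r"
    and coercive: "well_defined_coercive \<Omega> H (shifted_norm \<Omega> \<kappa>) \<mu>"
    and compact: "compactly_embedded_Lp \<Omega> H (shifted_norm \<Omega> \<kappa>) r"
begin

abbreviation "N \<equiv> shifted_norm \<Omega> \<kappa>"
abbreviation "T \<equiv> shifted_norm \<Omega> \<mu>"

lemma \<kappa>: "0 \<le> \<kappa>" using space by auto

lemma r0: "0 < r" using r by simp

lemma Cc_H: "\<phi> \<in> Cc_infinity \<Omega> \<Longrightarrow> \<phi> \<in> H"
  using space Cc_subset_H10[OF \<Omega>] Cc_subset_D012[OF \<Omega>] by auto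

lemma lincomb: "u \<in> H \<Longrightarrow> v \<in> H \<Longrightarrow> (\<lambda>x. a * u x + b * v x) \<in> H"
  using space H10_lincomb[OF \<Omega>] D012_lincomb[OF \<Omega>] by auto

lemma diff: "u \<in> H \<Longrightarrow> v \<in> H \<Longrightarrow> (\<lambda>x. u x - v x) \<in> H"
  using lincomb[of u v 1 "-1"] by simp

lemma scale: "u \<in> H \<Longrightarrow> (\<lambda>x. a * u x) \<in> H"
  using lincomb[of u u a 0] by simp

lemma H_Lp: "u \<in> H \<Longrightarrow> u \<in> Lp r \<Omega>"
  using compact by (auto simp: compactly_embedded_Lp_def)

lemma T_nonneg: "u \<in> H \<Longrightarrow> 0 \<le> T u"
  and T_eq_0_iff: "u \<in> H \<Longrightarrow> T u = 0 \<longleftrightarrow> (AE x in lebesgue_on \<Omega>. u x = 0)"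
  and T_scale: "u \<in> H \<Longrightarrow> T (\<lambda>x. a * u x) = \<bar>a\<bar> * T u"
  and T_triangle: "u \<in> H \<Longrightarrow> v \<in> H \<Longrightarrow> T (\<lambda>x. u x + v x) \<le> T u + T v"
  using coercive by (auto simp: well_defined_coercive_def is_norm_on_def)

lemma T_sq:
  assumes "u \<in> H"
  shows "integrable (lebesgue_on \<Omega>) (\<lambda>x. (norm (wgrad \<Omega> u x))\<^sup>2 + \<mu> * (u x)\<^sup>2)"
    "(T u)\<^sup>2 = (\<integral>x. (norm (wgrad \<Omega> u x))\<^sup>2 + \<mu> * (u x)\<^sup>2 \<partial>lebesgue_on \<Omega>)"
  using coercive assms by (auto simp: well_defined_coercive_def shifted_norm_def)

lemma equivalence:
  obtains c C where "c > 0" "C > 0" "\<And>v. v \<in> H \<Longrightarrow> c * N v \<le> T v" "\<And>v. v \<in> H \<Longrightarrow> T v \<le> C * N v"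
  using coercive unfolding well_defined_coercive_def by blast

lemma bounded_subsequence:
  fixes v :: "nat \<Rightarrow> 'a \<Rightarrow> real"
  assumes v: "\<And>n. v n \<in> H" and B: "\<And>n. T (v n) \<le> B"
  obtains s w where "strict_mono (s :: nat \<Rightarrow> nat)" "w \<in> Lp r \<Omega>" "(\<lambda>n. Lpow r \<Omega> (\<lambda>x. v (s n) x - w x)) \<longlonglongrightarrow> 0"
proof -
  obtain c C where c: "c > 0" "\<And>v. v \<in> H \<Longrightarrow> c * N v \<le> T v" using equivalence by metis
  have N_le: "N (v n) \<le> B / c" for n
    using c(2)[OF v, of n] B[of n] c(1) by (simp add: field_simps)
  have "\<forall>v B. (\<forall>n. v n \<in> H \<and> N (v n) \<le> B) \<longrightarrow>
        (\<exists>s::nat \<Rightarrow> nat. \<exists>w\<in>Lp r \<Omega>. strict_mono s \<and> (\<lambda>n. Lp_norm r \<Omega> (\<lambda>x. v (s n) x - w x)) \<longlonglongrightarrow> 0)"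
    using compact unfolding compactly_embedded_Lp_def by blast
  then obtain s w where "strict_mono (s :: nat \<Rightarrow> nat)" "w \<in> Lp r \<Omega>"
      "(\<lambda>n. Lp_norm r \<Omega> (\<lambda>x. v (s n) x - w x)) \<longlonglongrightarrow> 0"
    using v N_le by blast
  then show ?thesis using that Lp_norm_tendsto_0_iff[OF r0, of \<Omega> "\<lambda>n x. v (s n) x - w x"] by blast
qed

text \<open>Otherwise there are elements of norm \<open>1\<close> whose \<open>L\<^sup>r\<close> norms are
  unbounded along every subsequence, which contradicts compactness.\<close>

lemma embedding: obtains C where "C \<ge> 0" "\<And>v. v \<in> H \<Longrightarrow> Lpow r \<Omega> v \<le> C * T v powr r"
proof -
  have "\<exists>C. \<forall>v\<in>H. Lpow r \<Omega> v \<le> C * T v powr r"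
  proof (rule ccontr)
    assume no: "\<nexists>C. \<forall>v\<in>H. Lpow r \<Omega> v \<le> C * T v powr r"
    have "\<exists>v\<in>H. Lpow r \<Omega> v > real n * T v powr r" for n
      using no by (meson not_le)
    then obtain v where v: "\<And>n. v n \<in> H" "\<And>n. Lpow r \<Omega> (v n) > real n * T (v n) powr r" by metis
    have T0: "T (v n) > 0" for n
    proof (rule ccontr)
      assume "\<not> 0 < T (v n)"
      then have T0: "T (v n) = 0" using T_nonneg[OF v(1)[of n]] by simp
      then have "AE x in lebesgue_on \<Omega>. norm (v n x) powr r = 0"
        using T_eq_0_iff[OF v(1)] by (auto elim: eventually_mono)
      then have "Lpow r \<Omega> (v n) = 0" unfolding Lpow_def by (rule integral_eq_zero_AE)
      then show False using v(2)[of n] T0 r by simp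
    qed
    define z where "z n x = (1 / T (v n)) * v n x" for n x
    have z: "z n \<in> H" for n unfolding z_def by (rule scale[OF v(1)])
    have "T (z n) \<le> 1" for n
      using T_scale[OF v(1), of "1 / T (v n)" n] T0[of n] by (simp add: z_def[abs_def])
    then obtain s w where s: "strict_mono s" "w \<in> Lp r \<Omega>" "(\<lambda>n. Lpow r \<Omega> (\<lambda>x. z (s n) x - w x)) \<longlonglongrightarrow> 0"
      using bounded_subsequence[of z 1] z by metis
    have big: "real n < Lpow r \<Omega> (z n)" for n
    proof -
      have "Lpow r \<Omega> (z n) = (1 / T (v n)) powr r * Lpow r \<Omega> (v n)"
        using Lpow_scale[of r \<Omega> "1 / T (v n)" "v n"] T0[of n] by (simp add: z_def[abs_def])
      also have "\<dots> = Lpow r \<Omega> (v n) / T (v n) powr r"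
        using T0[of n] by (simp add: powr_divide)
      also have "\<dots> > real n" using v(2)[of n] T0[of n] by (simp add: pos_less_divide_eq)
      finally show ?thesis .
    qed
    have "\<forall>\<^sub>F n in sequentially. Lpow r \<Omega> (\<lambda>x. z (s n) x - w x) < 1"
      using order_tendstoD(2)[OF s(3)] by simp
    moreover have "\<forall>\<^sub>F n in sequentially. real n > 2 powr r * (1 + Lpow r \<Omega> w)"
      using eventually_gt_at_top filterlim_at_top_dense filterlim_real_sequentially by blast
    ultimately have "\<forall>\<^sub>F n in sequentially. False"
    proof eventually_elim
      case (elim n)
      have "Lpow r \<Omega> (\<lambda>x. 1 *\<^sub>R (z (s n) x - w x) + 1 *\<^sub>R w x)
         \<le> 2 powr r * (\<bar>1\<bar> powr r * Lpow r \<Omega> (\<lambda>x. z (s n) x - w x) + \<bar>1\<bar> powr r * Lpow r \<Omega> w)"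
        by (rule Lp_lincomb(2)[OF r0 Lp_diff[OF r0 H_Lp[OF z] s(2)] s(2)])
      also have "\<dots> \<le> 2 powr r * (1 + Lpow r \<Omega> w)"
        using elim(1) by simp
      finally have "Lpow r \<Omega> (z (s n)) < real n" using elim(2) by simp
      moreover have "real n \<le> real (s n)" using seq_suble[OF s(1), of n] by simp
      ultimately show False using big[of "s n"] by simp
    qed
    then show False by simp
  qed
  then obtain C where "\<And>v. v \<in> H \<Longrightarrow> Lpow r \<Omega> v \<le> C * T v powr r" by blast
  then have "Lpow r \<Omega> v \<le> max C 0 * T v powr r" if "v \<in> H" for v
    using that by (meson max.cobounded1 mult_right_mono order_trans powr_ge_zero)
  then show ?thesis by (intro that[of "max C 0"]) auto
qed

lemma embedding_N: obtains C where "C \<ge> 0" "\<And>v. v \<in> H \<Longrightarrow> Lpow r \<Omega> v \<le> C * \<bar>N v\<bar> powr r"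
proof -
  obtain C where C: "C \<ge> 0" "\<And>v. v \<in> H \<Longrightarrow> Lpow r \<Omega> v \<le> C * T v powr r" using embedding by metis
  obtain c C' where C': "C' > 0" "\<And>v. v \<in> H \<Longrightarrow> T v \<le> C' * N v" using equivalence by metis
  have "Lpow r \<Omega> v \<le> (C * C' powr r) * \<bar>N v\<bar> powr r" if v: "v \<in> H" for v
  proof -
    have "T v powr r \<le> (C' * \<bar>N v\<bar>) powr r"
      using C'(2)[OF v] C'(1) T_nonneg[OF v] r by (intro powr_mono2) (auto intro: order_trans mult_left_mono)
    also have "\<dots> = C' powr r * \<bar>N v\<bar> powr r" using C'(1) by (simp add: powr_mult)
    finally have "C * T v powr r \<le> C * (C' powr r * \<bar>N v\<bar> powr r)" using C(1) by (rule mult_left_mono)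
    then show ?thesis using C(2)[OF v] by (simp add: mult.assoc)
  qed
  then show ?thesis using C(1) by (intro that[of "C * C' powr r"]) auto
qed

lemma Lpow_tendsto_0:
  assumes "\<And>n. v n \<in> H" "(\<lambda>n. N (v n)) \<longlonglongrightarrow> 0"
  shows "(\<lambda>n. Lpow r \<Omega> (v n)) \<longlonglongrightarrow> 0"
proof -
  obtain C where C: "C \<ge> 0" "\<And>v. v \<in> H \<Longrightarrow> Lpow r \<Omega> v \<le> C * \<bar>N v\<bar> powr r" using embedding_N by metis
  have "(\<lambda>n. C * \<bar>N (v n)\<bar> powr r) \<longlonglongrightarrow> C * \<bar>0\<bar> powr r"
    using r by (intro tendsto_mult tendsto_powr' tendsto_rabs assms tendsto_const) auto
  then have lim: "(\<lambda>n. C * \<bar>N (v n)\<bar> powr r) \<longlonglongrightarrow> 0" by simp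
  show ?thesis
    by (rule tendsto_sandwich[OF _ _ tendsto_const lim]) (use C assms(1) in \<open>auto simp: Lpow_nonneg\<close>)
qed

text \<open>For \<open>H10\<close> the approximating sequence is part of the definition, and the bounded
  embedding gives its convergence in \<open>L\<^sup>r\<close>. An element of \<open>D012\<close> is only an
  almost everywhere limit of a Cauchy sequence; by the bounded embedding this sequence is Cauchy in
  \<open>L\<^sup>r\<close>, so it converges there, and a weak gradient exists.\<close>

lemma approximation:
  assumes u: "u \<in> H"
  obtains \<phi> g where "\<And>n. \<phi> n \<in> Cc_infinity \<Omega>" "L2_gradient \<Omega> \<kappa> u g"
    "(\<lambda>n. N (\<lambda>x. \<phi> n x - u x)) \<longlonglongrightarrow> 0" "(\<lambda>n. Lpow r \<Omega> (\<lambda>x. \<phi> n x - u x)) \<longlonglongrightarrow> 0"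
  using space
proof
  assume s: "H = H10 \<Omega> \<and> \<kappa> = 1"
  then obtain g where g: "L2_gradient \<Omega> \<kappa> u g" using H10_L2_gradient u by blast
  obtain \<phi> where \<phi>: "\<And>n. \<phi> n \<in> Cc_infinity \<Omega>" "(\<lambda>n. N (\<lambda>x. \<phi> n x - u x)) \<longlonglongrightarrow> 0"
    using u s by (auto simp: H10_def H1_norm_eq)
  have "(\<lambda>n. Lpow r \<Omega> (\<lambda>x. \<phi> n x - u x)) \<longlonglongrightarrow> 0"
    by (rule Lpow_tendsto_0[OF diff[OF Cc_H[OF \<phi>(1)] u] \<phi>(2)])
  with \<phi> g show thesis using that by blast
next
  assume s: "H = D012 \<Omega> \<and> \<kappa> = 0"
  obtain \<phi> where \<phi>: "\<And>n. \<phi> n \<in> Cc_infinity \<Omega>"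
      "\<And>e. e > 0 \<Longrightarrow> \<exists>M. \<forall>m\<ge>M. \<forall>n\<ge>M. N (\<lambda>x. \<phi> m x - \<phi> n x) < e"
      "AE x in lebesgue_on \<Omega>. (\<lambda>n. \<phi> n x) \<longlonglongrightarrow> u x"
    using u s by (auto simp: D012_def D12_norm_eq)
  obtain C where C: "C \<ge> 0" "\<And>v. v \<in> H \<Longrightarrow> Lpow r \<Omega> v \<le> C * \<bar>N v\<bar> powr r" using embedding_N by metis
  have nn: "0 \<le> N (\<lambda>x. \<phi> m x - \<phi> n x)" for m n
    using shifted_norm_nonneg_of_L2_gradient[OF \<Omega> L2_gradient_diff[OF \<Omega> L2_gradient_test_function[OF \<Omega> \<phi>(1)] L2_gradient_test_function[OF \<Omega> \<phi>(1)]] \<kappa>] .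
  have CL: "\<exists>M. \<forall>m\<ge>M. \<forall>n\<ge>M. Lpow r \<Omega> (\<lambda>x. \<phi> m x - \<phi> n x) < e" if e: "e > 0" for e
  proof -
    define \<delta> where "\<delta> = (e / (C + 1)) powr (1 / r)"
    have \<delta>: "\<delta> > 0" "\<delta> powr r = e / (C + 1)"
      using e C(1) r by (auto simp: \<delta>_def powr_powr)
    obtain M where M: "\<forall>m\<ge>M. \<forall>n\<ge>M. N (\<lambda>x. \<phi> m x - \<phi> n x) < \<delta>" using \<phi>(2)[OF \<delta>(1)] by blast
    have "Lpow r \<Omega> (\<lambda>x. \<phi> m x - \<phi> n x) < e" if "m \<ge> M" "n \<ge> M" for m n
    proof -
      have "Lpow r \<Omega> (\<lambda>x. \<phi> m x - \<phi> n x) \<le> C * \<bar>N (\<lambda>x. \<phi> m x - \<phi> n x)\<bar> powr r"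
        by (rule C(2)[OF diff[OF Cc_H[OF \<phi>(1)] Cc_H[OF \<phi>(1)]]])
      also have "\<dots> \<le> C * \<delta> powr r"
        using M that nn[of m n] C(1) r by (intro mult_left_mono powr_mono2) (auto intro: less_imp_le)
      also have "\<dots> < e" using e C(1) by (simp add: \<delta>(2) field_simps)
      finally show ?thesis .
    qed
    then show ?thesis by blast
  qed
  have L: "(\<lambda>n. Lpow r \<Omega> (\<lambda>x. \<phi> n x - u x)) \<longlonglongrightarrow> 0"
    by (rule Lpow_Cauchy_AE_limit(2)[OF r0 H_Lp[OF Cc_H[OF \<phi>(1)]] CL strict_mono_id[unfolded id_def] _ LpD(1)[OF H_Lp[OF u]]])
      (use \<phi>(3) in simp_all)
  obtain G where "L2_gradient \<Omega> \<kappa> u G" "(\<lambda>n. N (\<lambda>x. \<phi> n x - u x)) \<longlonglongrightarrow> 0"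
    using L2_gradient_limit[OF \<Omega> \<kappa> less_imp_le[OF r] L2_gradient_test_function[OF \<Omega> \<phi>(1)] H_Lp[OF Cc_H[OF \<phi>(1)]] H_Lp[OF u] L \<phi>(2)] by blast
  with \<phi>(1) L show thesis using that by blast
qed

lemma weak: "u \<in> H \<Longrightarrow> weak_gradient \<Omega> u (wgrad \<Omega> u)"
  using approximation[of u] weak_gradient_wgrad unfolding L2_gradient_def by metis

lemma wgrad_lincomb:
  assumes "u \<in> H" "v \<in> H"
  shows "AE x in lebesgue_on \<Omega>. wgrad \<Omega> (\<lambda>x. a * u x + b * v x) x = a *\<^sub>R wgrad \<Omega> u x + b *\<^sub>R wgrad \<Omega> v x"
  by (rule wgrad_AE_eq[OF \<Omega> weak_gradient_lincomb[OF \<Omega> weak[OF assms(1)] weak[OF assms(2)]]])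

definition form :: "('a \<Rightarrow> real) \<Rightarrow> ('a \<Rightarrow> real) \<Rightarrow> real" where
  "form u v = (\<integral>x. wgrad \<Omega> u x \<bullet> wgrad \<Omega> v x + \<mu> * u x * v x \<partial>lebesgue_on \<Omega>)"

text \<open>Polarisation: the integrand is a combination of the quadratic integrands of \<open>u + v\<close>
  and \<open>u - v\<close>.\<close>

lemma form_integrable:
  assumes u: "u \<in> H" and v: "v \<in> H"
  shows "integrable (lebesgue_on \<Omega>) (\<lambda>x. wgrad \<Omega> u x \<bullet> wgrad \<Omega> v x + \<mu> * u x * v x)"
proof (rule integrable_lebesgue_on_AE_cong(1)[OF \<Omega>])
  let ?q = "\<lambda>w x. (norm (wgrad \<Omega> w x))\<^sup>2 + \<mu> * (w x)\<^sup>2"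
  show "integrable (lebesgue_on \<Omega>) (\<lambda>x. (1/4) * (?q (\<lambda>x. 1 * u x + 1 * v x) x - ?q (\<lambda>x. 1 * u x + (- 1) * v x) x))"
    by (intro integrable_mult_right Bochner_Integration.integrable_diff T_sq(1) lincomb u v)
  show "AE x in lebesgue_on \<Omega>. wgrad \<Omega> u x \<bullet> wgrad \<Omega> v x + \<mu> * u x * v x =
      (1/4) * (?q (\<lambda>x. 1 * u x + 1 * v x) x - ?q (\<lambda>x. 1 * u x + (- 1) * v x) x)"
    using wgrad_lincomb[OF u v, of 1 1] wgrad_lincomb[OF u v, of 1 "-1"]
  proof eventually_elim
    case (elim x)
    show ?case unfolding elim
      by (simp add: power2_norm_eq_inner inner_simps inner_commute) (simp add: power2_eq_square algebra_simps)
  qed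
qed

lemma T_lincomb_sq:
  assumes u: "u \<in> H" and v: "v \<in> H"
  shows "(T (\<lambda>x. a * u x + b * v x))\<^sup>2 = a\<^sup>2 * (T u)\<^sup>2 + 2 * a * b * form u v + b\<^sup>2 * (T v)\<^sup>2"
proof -
  let ?q = "\<lambda>w x. (norm (wgrad \<Omega> w x))\<^sup>2 + \<mu> * (w x)\<^sup>2"
  let ?f = "\<lambda>x. wgrad \<Omega> u x \<bullet> wgrad \<Omega> v x + \<mu> * u x * v x"
  note i = integral_lincomb3[OF T_sq(1)[OF u] form_integrable[OF u v] T_sq(1)[OF v], of "a\<^sup>2" "2 * a * b" "b\<^sup>2"]
  have "(\<integral>x. ?q (\<lambda>x. a * u x + b * v x) x \<partial>lebesgue_on \<Omega>) =
     (\<integral>x. a\<^sup>2 * ?q u x + (2 * a * b) * ?f x + b\<^sup>2 * ?q v x \<partial>lebesgue_on \<Omega>)"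
  proof (rule integrable_lebesgue_on_AE_cong(2)[OF \<Omega> i(1)])
    show "AE x in lebesgue_on \<Omega>. ?q (\<lambda>x. a * u x + b * v x) x = a\<^sup>2 * ?q u x + (2 * a * b) * ?f x + b\<^sup>2 * ?q v x"
      using wgrad_lincomb[OF u v, of a b]
    proof eventually_elim
      case (elim x)
      show ?case unfolding elim
        by (simp add: power2_norm_eq_inner inner_simps inner_commute) (simp add: power2_eq_square algebra_simps)
    qed
  qed
  also have "\<dots> = a\<^sup>2 * (\<integral>x. ?q u x \<partial>lebesgue_on \<Omega>) + (2 * a * b) * (\<integral>x. ?f x \<partial>lebesgue_on \<Omega>)
      + b\<^sup>2 * (\<integral>x. ?q v x \<partial>lebesgue_on \<Omega>)"
    by (rule i(2))
  finally show ?thesis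
    unfolding T_sq(2)[OF lincomb[OF u v]] T_sq(2)[OF u] T_sq(2)[OF v] form_def .
qed

lemma closed:
  assumes \<phi>: "\<And>n. \<phi> n \<in> Cc_infinity \<Omega>"
    and C: "\<And>e. e > 0 \<Longrightarrow> \<exists>M. \<forall>m\<ge>M. \<forall>n\<ge>M. N (\<lambda>x. \<phi> m x - \<phi> n x) < e"
    and w: "w \<in> Lp r \<Omega>" "(\<lambda>n. Lpow r \<Omega> (\<lambda>x. \<phi> n x - w x)) \<longlonglongrightarrow> 0"
  shows "w \<in> H \<and> (\<lambda>n. N (\<lambda>x. \<phi> n x - w x)) \<longlonglongrightarrow> 0"
proof -
  obtain G where G: "L2_gradient \<Omega> \<kappa> w G" "(\<lambda>n. N (\<lambda>x. \<phi> n x - w x)) \<longlonglongrightarrow> 0"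
    using L2_gradient_limit[OF \<Omega> \<kappa> less_imp_le[OF r] L2_gradient_test_function[OF \<Omega> \<phi>] H_Lp[OF Cc_H[OF \<phi>]] w C] by blast
  have "w \<in> H"
    using space
  proof
    assume "H = H10 \<Omega> \<and> \<kappa> = 1"
    then show ?thesis using G \<phi> by (auto simp: H10_def H1_def L2_gradient_def H1_norm_eq)
  next
    assume s: "H = D012 \<Omega> \<and> \<kappa> = 0"
    obtain s where s': "strict_mono (s :: nat \<Rightarrow> nat)" "AE x in lebesgue_on \<Omega>. (\<lambda>n. \<phi> (s n) x) \<longlonglongrightarrow> w x"
      using Lpow_subsequence_dominated[OF r0 H_Lp[OF Cc_H[OF \<phi>]] w] by metis
    have "\<exists>M. \<forall>m\<ge>M. \<forall>n\<ge>M. N (\<lambda>x. \<phi> (s m) x - \<phi> (s n) x) < e" if e: "e > 0" for e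
    proof -
      obtain M where M: "\<forall>m\<ge>M. \<forall>n\<ge>M. N (\<lambda>x. \<phi> m x - \<phi> n x) < e" using C[OF e] by blast
      have "s n \<ge> M" if "n \<ge> M" for n using seq_suble[OF s'(1), of n] that by simp
      then show ?thesis using M by blast
    qed
    then show ?thesis
      using s s'(2) \<phi> unfolding D012_def D12_norm_eq by (auto intro!: exI[of _ "\<lambda>n. \<phi> (s n)"])
  qed
  then show ?thesis using G(2) by blast
qed

text \<open>Let \<open>A n\<close> consist of the test functions whose difference to \<open>w\<close> has \<open>Lpow\<close> at most \<open>1/(n+1)\<close>,
  and let \<open>z n\<close> almost minimise \<open>T\<close> on \<open>A n\<close>. Since \<open>A n\<close> is closed under midpoints, the
  parallelogram law makes \<open>z\<close> a Cauchy sequence for \<open>T\<close>, and its limit can only be \<open>w\<close>.\<close>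

lemma lower_semicontinuous:
  assumes w: "w \<in> Lp r \<Omega>"
    and ap: "\<And>\<delta>. \<delta> > 0 \<Longrightarrow> \<exists>v\<in>H. Lpow r \<Omega> (\<lambda>x. v x - w x) \<le> \<delta> \<and> T v \<le> B"
  shows "w \<in> H \<and> T w \<le> B"
proof -
  obtain c C where c: "c > 0" "\<And>v. v \<in> H \<Longrightarrow> c * N v \<le> T v"
    and C: "C > 0" "\<And>v. v \<in> H \<Longrightarrow> T v \<le> C * N v" using equivalence by metis
  have B: "0 \<le> B" using ap[of 1] T_nonneg by force
  have ap': "\<exists>\<phi>\<in>Cc_infinity \<Omega>. Lpow r \<Omega> (\<lambda>x. \<phi> x - w x) \<le> \<delta> \<and> T \<phi> \<le> B + \<delta>" if \<delta>: "\<delta> > 0" for \<delta>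
  proof -
    \<comment> \<open>the factor \<open>2 powr r\<close> compensates the constant of \<open>Lpow_triangle\<close>\<close>
    define \<eta> where "\<eta> = \<delta> / (2 * 2 powr r)"
    have \<eta>: "\<eta> > 0" "2 powr r * (\<eta> + \<eta>) = \<delta>" using \<delta> by (auto simp: \<eta>_def)
    obtain v where v: "v \<in> H" "Lpow r \<Omega> (\<lambda>x. v x - w x) \<le> \<eta>" "T v \<le> B" using ap[OF \<eta>(1)] by blast
    obtain \<phi> where \<phi>: "\<And>n. \<phi> n \<in> Cc_infinity \<Omega>"
      "(\<lambda>n. N (\<lambda>x. \<phi> n x - v x)) \<longlonglongrightarrow> 0" "(\<lambda>n. Lpow r \<Omega> (\<lambda>x. \<phi> n x - v x)) \<longlonglongrightarrow> 0"
      using approximation[OF v(1)] by blast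
    have "\<forall>\<^sub>F n in sequentially. N (\<lambda>x. \<phi> n x - v x) < \<delta> / C"
      using order_tendstoD(2)[OF \<phi>(2)] \<delta> C(1) by simp
    moreover have "\<forall>\<^sub>F n in sequentially. Lpow r \<Omega> (\<lambda>x. \<phi> n x - v x) < \<eta>"
      using order_tendstoD(2)[OF \<phi>(3)] \<eta>(1) by simp
    ultimately have "\<forall>\<^sub>F n in sequentially. N (\<lambda>x. \<phi> n x - v x) < \<delta> / C \<and> Lpow r \<Omega> (\<lambda>x. \<phi> n x - v x) < \<eta>"
      by (rule eventually_conj)
    then obtain n where n: "N (\<lambda>x. \<phi> n x - v x) < \<delta> / C" "Lpow r \<Omega> (\<lambda>x. \<phi> n x - v x) < \<eta>"
      using eventually_happens'[OF sequentially_bot] by fast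
    have pH: "\<phi> n \<in> H" and dH: "(\<lambda>x. \<phi> n x - v x) \<in> H" using Cc_H[OF \<phi>(1)] diff v(1) by auto
    have "Lpow r \<Omega> (\<lambda>x. \<phi> n x - w x) \<le> 2 powr r * (Lpow r \<Omega> (\<lambda>x. \<phi> n x - v x) + Lpow r \<Omega> (\<lambda>x. v x - w x))"
      by (rule Lpow_triangle[OF r0 H_Lp[OF pH] H_Lp[OF v(1)] w])
    also have "\<dots> \<le> 2 powr r * (\<eta> + \<eta>)" using n(2) v(2) by (intro mult_left_mono) auto
    finally have 1: "Lpow r \<Omega> (\<lambda>x. \<phi> n x - w x) \<le> \<delta>" unfolding \<eta>(2) .
    have "T (\<phi> n) \<le> T (\<lambda>x. \<phi> n x - v x) + T v"
      using T_triangle[OF dH v(1)] by simp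
    also have "T (\<lambda>x. \<phi> n x - v x) \<le> C * N (\<lambda>x. \<phi> n x - v x)" by (rule C(2)[OF dH])
    also have "\<dots> \<le> \<delta>" using n(1) C(1) by (simp add: field_simps)
    finally have "T (\<phi> n) \<le> B + \<delta>" using v(3) by simp
    with 1 \<phi>(1)[of n] show ?thesis by blast
  qed
  define A where "A n = {\<phi> \<in> Cc_infinity \<Omega>. Lpow r \<Omega> (\<lambda>x. \<phi> x - w x) \<le> inverse (real (Suc n))}" for n
  define d where "d n = (INF \<phi>\<in>A n. (T \<phi>)\<^sup>2)" for n
  have ne: "A n \<noteq> {}" for n
    using ap'[of "inverse (real (Suc n))"] by (auto simp: A_def)
  have bb: "bdd_below ((\<lambda>\<phi>. (T \<phi>)\<^sup>2) ` A n)" for n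
    by (rule bdd_belowI[of _ 0]) auto
  have d_le: "d n \<le> (T \<phi>)\<^sup>2" if "\<phi> \<in> A n" for \<phi> n
    unfolding d_def by (rule cINF_lower[OF bb that])
  have A_mono: "A n \<subseteq> A m" if "m \<le> n" for m n
    using that by (auto simp: A_def intro: order_trans[OF _ le_imp_inverse_le])
  have inc: "incseq d"
    unfolding incseq_def d_def by (intro allI impI cINF_superset_mono ne bb A_mono) auto
  \<comment> \<open>the approximations \<open>ap'\<close> lie in \<open>A n\<close> and have norms as close to \<open>B\<close> as desired\<close>
  have dB: "d n \<le> B\<^sup>2" for n
  proof (rule ccontr)
    assume "\<not> d n \<le> B\<^sup>2"
    then have lt: "B < sqrt (d n)" using B by (simp add: real_less_rsqrt)
    define \<delta> where "\<delta> = min (inverse (real (Suc n))) ((sqrt (d n) - B) / 2)"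
    have \<delta>: "\<delta> > 0" "\<delta> \<le> inverse (real (Suc n))" "B + \<delta> < sqrt (d n)"
      using lt by (auto simp: \<delta>_def min_def field_simps)
    obtain \<phi> where \<phi>: "\<phi> \<in> Cc_infinity \<Omega>" "Lpow r \<Omega> (\<lambda>x. \<phi> x - w x) \<le> \<delta>" "T \<phi> \<le> B + \<delta>"
      using ap'[OF \<delta>(1)] by blast
    have "\<phi> \<in> A n" using \<phi> \<delta>(2) by (auto simp: A_def)
    then have "sqrt (d n) \<le> sqrt ((T \<phi>)\<^sup>2)" using d_le by (intro real_sqrt_le_mono)
    also have "\<dots> = T \<phi>" using T_nonneg[OF Cc_H[OF \<phi>(1)]] by simp
    finally show False using \<phi>(3) \<delta>(3) by simp
  qed
  obtain D where D: "d \<longlonglongrightarrow> D" "\<And>n. d n \<le> D"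
    using incseq_convergent[OF inc, of "B\<^sup>2"] dB by blast
  have "\<exists>\<phi>\<in>A n. (T \<phi>)\<^sup>2 < d n + inverse (real (Suc n))" for n
  proof -
    have "\<exists>y\<in>(\<lambda>\<phi>. (T \<phi>)\<^sup>2) ` A n. y < d n + inverse (real (Suc n))"
      unfolding d_def using ne[of n] by (intro cInf_lessD) auto
    then show ?thesis by blast
  qed
  then obtain z where z: "\<And>n. z n \<in> A n" "\<And>n. (T (z n))\<^sup>2 < d n + inverse (real (Suc n))" by metis
  have zC: "z n \<in> Cc_infinity \<Omega>" and zw: "Lpow r \<Omega> (\<lambda>x. z n x - w x) \<le> inverse (real (Suc n))" for n
    using z(1)[of n] by (auto simp: A_def)
  have zH: "z n \<in> H" for n by (rule Cc_H[OF zC])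
  have par: "(T (\<lambda>x. z m x - z n x))\<^sup>2 \<le> 2 * (D - d m) + 4 * inverse (real (Suc m))" if mn: "m \<le> n" for m n
  proof -
    have inv: "inverse (real (Suc n)) \<le> inverse (real (Suc m))"
      using mn by (intro le_imp_inverse_le) auto
    have arith: "2 * x + 2 * y - 4 * e \<le> 2 * (D - e) + 4 * t" if "x < e + t" "y < e' + t'" "e' \<le> D" "t' \<le> t"
      for x y e e' t t' :: real using that by argo
    have zA: "z n \<in> A m" using A_mono[OF mn] z(1) by blast
    have "Lpow r \<Omega> (\<lambda>x. (1/2) *\<^sub>R (z m x - w x) + (1/2) *\<^sub>R (z n x - w x))
        \<le> (Lpow r \<Omega> (\<lambda>x. z m x - w x) + Lpow r \<Omega> (\<lambda>x. z n x - w x)) / 2"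
      by (rule Lpow_midpoint[OF less_imp_le[OF r] Lp_diff[OF r0 H_Lp[OF zH] w] Lp_diff[OF r0 H_Lp[OF zH] w]])
    also have "\<dots> \<le> inverse (real (Suc m))"
      using add_mono[OF zw[of m] order_trans[OF zw[of n] inv]] by simp
    also have "(\<lambda>x. (1/2) *\<^sub>R (z m x - w x) + (1/2) *\<^sub>R (z n x - w x)) = (\<lambda>x. ((1/2) * z m x + (1/2) * z n x) - w x)"
      by (auto simp: field_simps)
    finally have "(\<lambda>x. (1/2) * z m x + (1/2) * z n x) \<in> A m"
      unfolding A_def using Cc_infinity_lincomb[OF zC zC] by blast
    \<comment> \<open>the midpoint of \<open>z m\<close> and \<open>z n\<close> competes in \<open>A m\<close>\<close>
    from d_le[OF this] have mid: "d m \<le> (1/4) * (T (z m))\<^sup>2 + (1/2) * form (z m) (z n) + (1/4) * (T (z n))\<^sup>2"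
      unfolding T_lincomb_sq[OF zH zH] by (simp add: power2_eq_square)
    have "(T (\<lambda>x. z m x - z n x))\<^sup>2 = (T (z m))\<^sup>2 - 2 * form (z m) (z n) + (T (z n))\<^sup>2"
      using T_lincomb_sq[OF zH zH, of 1 m "-1" n] by simp
    also have "\<dots> \<le> 2 * (T (z m))\<^sup>2 + 2 * (T (z n))\<^sup>2 - 4 * d m" using mid by simp
    also have "\<dots> \<le> 2 * (D - d m) + 4 * inverse (real (Suc m))"
      by (rule arith[OF z(2)[of m] z(2)[of n] D(2)[of n] inv])
    finally show ?thesis .
  qed
  have "(\<lambda>m. 2 * (D - d m) + 4 * inverse (real (Suc m))) \<longlonglongrightarrow> 2 * (D - D) + 4 * 0"
    by (intro tendsto_intros D LIMSEQ_inverse_real_of_nat)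
  then have lim0: "(\<lambda>m. 2 * (D - d m) + 4 * inverse (real (Suc m))) \<longlonglongrightarrow> 0" by simp
  have dz: "(\<lambda>x. z m x - z n x) \<in> H" for m n by (rule diff[OF zH zH])
  have sym: "T (\<lambda>x. z m x - z n x) = T (\<lambda>x. z n x - z m x)" for m n
    using T_scale[OF dz[of m n], of "-1"] by simp
  have Cau: "\<exists>M. \<forall>m\<ge>M. \<forall>n\<ge>M. N (\<lambda>x. z m x - z n x) < e" if e: "e > 0" for e
  proof -
    have "\<forall>\<^sub>F m in sequentially. 2 * (D - d m) + 4 * inverse (real (Suc m)) < (c * e)\<^sup>2"
      using order_tendstoD(2)[OF lim0] c(1) e by simp
    then obtain M where M: "\<And>m. m \<ge> M \<Longrightarrow> 2 * (D - d m) + 4 * inverse (real (Suc m)) < (c * e)\<^sup>2"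
      by (auto simp: eventually_sequentially)
    have le: "T (\<lambda>x. z m x - z n x) < c * e" if "m \<ge> M" "m \<le> n" for m n
      using par[OF that(2)] M[OF that(1)] c(1) e by (intro power2_less_imp_less[of "T (\<lambda>x. z m x - z n x)"]) auto
    have "T (\<lambda>x. z m x - z n x) < c * e" if "m \<ge> M" "n \<ge> M" for m n
      using le[of m n] le[of n m] that sym[of m n] by (cases "m \<le> n") auto
    then have "c * N (\<lambda>x. z m x - z n x) < c * e" if "m \<ge> M" "n \<ge> M" for m n
      using c(2)[OF dz[of m n]] that by (meson le_less_trans)
    then show ?thesis using c(1) by auto
  qed
  have zlim: "(\<lambda>n. Lpow r \<Omega> (\<lambda>x. z n x - w x)) \<longlonglongrightarrow> 0"
    by (rule tendsto_sandwich[OF _ _ tendsto_const LIMSEQ_inverse_real_of_nat]) (use zw in \<open>auto simp: Lpow_nonneg\<close>)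
  from closed[OF zC Cau w zlim] have wH: "w \<in> H" and Nw: "(\<lambda>n. N (\<lambda>x. z n x - w x)) \<longlonglongrightarrow> 0" by auto
  have "T w \<le> B + sqrt (inverse (real (Suc n))) + C * N (\<lambda>x. z n x - w x)" for n
  proof -
    have "T (\<lambda>x. z n x + (-1) * (z n x - w x)) \<le> T (z n) + T (\<lambda>x. (-1) * (z n x - w x))"
      by (rule T_triangle[OF zH scale[OF diff[OF zH wH]]])
    then have "T w \<le> T (z n) + T (\<lambda>x. z n x - w x)"
      using T_scale[OF diff[OF zH[of n] wH], of "-1"] by simp
    moreover have "T (\<lambda>x. z n x - w x) \<le> C * N (\<lambda>x. z n x - w x)" by (rule C(2)[OF diff[OF zH wH]])
    moreover have "T (z n) \<le> B + sqrt (inverse (real (Suc n)))"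
    proof -
      have "(T (z n))\<^sup>2 \<le> B\<^sup>2 + inverse (real (Suc n))" using z(2)[of n] dB[of n] by simp
      then have "T (z n) \<le> sqrt (B\<^sup>2 + inverse (real (Suc n)))" by (rule real_le_rsqrt)
      also have "\<dots> \<le> sqrt (B\<^sup>2) + sqrt (inverse (real (Suc n)))" by (rule sqrt_add_le_add_sqrt) auto
      finally show ?thesis using B by simp
    qed
    ultimately show ?thesis by simp
  qed
  moreover have "(\<lambda>n. B + sqrt (inverse (real (Suc n))) + C * N (\<lambda>x. z n x - w x)) \<longlonglongrightarrow> B + sqrt 0 + C * 0"
    by (intro tendsto_intros LIMSEQ_inverse_real_of_nat Nw)
  ultimately have "T w \<le> B + sqrt 0 + C * 0" by (intro LIMSEQ_le_const) auto
  then show ?thesis using wH by simp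
qed

end

section \<open>The fibering map\<close>

text \<open>The difference of the two sides is half of the sum of \<open>- b h k * (x h - x
  k)\<^sup>2\<close>, in which the terms on the diagonal vanish.\<close>

lemma sum_interaction_ge:
  fixes b :: "'i \<Rightarrow> 'i \<Rightarrow> real" and x :: "'i \<Rightarrow> real"
  assumes I: "finite I" and sym: "\<And>h k. h \<in> I \<Longrightarrow> k \<in> I \<Longrightarrow> b h k = b k h"
    and off: "\<And>h k. h \<in> I \<Longrightarrow> k \<in> I \<Longrightarrow> h \<noteq> k \<Longrightarrow> b h k \<le> 0"
  shows "(\<Sum>h\<in>I. (\<Sum>k\<in>I. b h k) * (x h)\<^sup>2) \<le> (\<Sum>h\<in>I. \<Sum>k\<in>I. b h k * x h * x k)"
proof -
  have swap: "(\<Sum>h\<in>I. \<Sum>k\<in>I. b h k * (x k)\<^sup>2) = (\<Sum>h\<in>I. \<Sum>k\<in>I. b h k * (x h)\<^sup>2)"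
    by (subst sum.swap) (intro sum.cong refl, simp add: sym)
  have "0 \<le> (\<Sum>h\<in>I. \<Sum>k\<in>I. - b h k * (x h - x k)\<^sup>2)"
  proof (intro sum_nonneg)
    fix h k assume hk: "h \<in> I" "k \<in> I"
    show "0 \<le> - b h k * (x h - x k)\<^sup>2"
      using off[OF hk] by (cases "h = k") (auto intro: mult_nonpos_nonneg)
  qed
  also have "\<dots> = (\<Sum>h\<in>I. \<Sum>k\<in>I. 2 * (b h k * x h * x k) - b h k * (x h)\<^sup>2 - b h k * (x k)\<^sup>2)"
    by (intro sum.cong refl) (simp add: power2_eq_square algebra_simps)
  also have "\<dots> = 2 * (\<Sum>h\<in>I. \<Sum>k\<in>I. b h k * x h * x k) - 2 * (\<Sum>h\<in>I. \<Sum>k\<in>I. b h k * (x h)\<^sup>2)"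
    by (simp add: sum_subtractf flip: sum_distrib_left) (simp add: swap)
  finally show ?thesis by (simp add: sum_distrib_right)
qed

text \<open>The energy as a function of the factors \<open>s\<close> by which the blocks are
  multiplied.\<close>

definition fibre :: "real \<Rightarrow> 'i set \<Rightarrow> ('i \<Rightarrow> real) \<Rightarrow> ('i \<Rightarrow> 'i \<Rightarrow> real) \<Rightarrow> ('i \<Rightarrow> real) \<Rightarrow> real" where
  "fibre p I a b s = 1 / 2 * (\<Sum>h\<in>I. a h * (s h)\<^sup>2)
     - 1 / (2 * p) * (\<Sum>h\<in>I. \<Sum>k\<in>I. b h k * (s h powr p * s k powr p))"

text \<open>The equations are \<open>s\<^sub>h\<close> times the partial derivatives of \<open>fibre\<close>:
  the Nehari constraints for the multiple with factors \<open>s\<close>.\<close>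

definition fibre_critical :: "real \<Rightarrow> 'i set \<Rightarrow> ('i \<Rightarrow> real) \<Rightarrow> ('i \<Rightarrow> 'i \<Rightarrow> real) \<Rightarrow> ('i \<Rightarrow> real) \<Rightarrow> bool" where
  "fibre_critical p I a b s \<longleftrightarrow> (\<forall>h\<in>I. 0 < s h \<and> a h * (s h)\<^sup>2 = (\<Sum>k\<in>I. b h k * (s h powr p * s k powr p)))"

lemma powr_tangent_at_1:
  fixes y p :: real
  assumes "1 < p" "0 < y"
  shows "1 + p * (y - 1) \<le> y powr p"
proof -
  have "y powr p - 1 powr p \<ge> p * 1 powr (p - 1) * (y - 1)"
    using assms by (intro convex_on_imp_above_tangent[where A = "{0<..}"])
      (auto intro!: powr_convex derivative_eq_intros simp: interior_open)
  then show ?thesis by simp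
qed

text \<open>The right-hand side is the value at \<open>s = 1\<close>. Diagonal dominance reduces the claim to
  a single variable, where it says that \<open>y\<^sup>p\<close> lies above its tangent at
  \<open>1\<close>.\<close>

lemma fibre_le:
  fixes a :: "'i \<Rightarrow> real"
  assumes I: "finite I" and p: "1 < p"
    and sym: "\<And>h k. h \<in> I \<Longrightarrow> k \<in> I \<Longrightarrow> b h k = b k h"
    and off: "\<And>h k. h \<in> I \<Longrightarrow> k \<in> I \<Longrightarrow> h \<noteq> k \<Longrightarrow> b h k \<le> 0"
    and a: "\<And>h. h \<in> I \<Longrightarrow> 0 < a h" "\<And>h. h \<in> I \<Longrightarrow> (\<Sum>k\<in>I. b h k) = a h"
    and s: "\<And>h. h \<in> I \<Longrightarrow> 0 < s h"
  shows "fibre p I a b s \<le> (1 / 2 - 1 / (2 * p)) * (\<Sum>h\<in>I. a h)"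
proof -
  have "(\<Sum>h\<in>I. a h * (s h powr p)\<^sup>2) \<le> (\<Sum>h\<in>I. \<Sum>k\<in>I. b h k * (s h powr p * s k powr p))"
    using sum_interaction_ge[where b = b and x = "\<lambda>h. s h powr p", OF I sym off] a(2) by (simp add: mult.assoc)
  then have "fibre p I a b s \<le> 1 / 2 * (\<Sum>h\<in>I. a h * (s h)\<^sup>2) - 1 / (2 * p) * (\<Sum>h\<in>I. a h * (s h powr p)\<^sup>2)"
    unfolding fibre_def using p by (intro diff_mono mult_left_mono) auto
  also have "\<dots> = (\<Sum>h\<in>I. a h * (1 / 2 * (s h)\<^sup>2 - 1 / (2 * p) * (s h powr p)\<^sup>2))"
    by (simp add: sum_distrib_left sum_subtractf algebra_simps)
  also have "\<dots> \<le> (\<Sum>h\<in>I. a h * (1 / 2 - 1 / (2 * p)))"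
  proof (intro sum_mono mult_left_mono)
    fix h assume h: "h \<in> I"
    have "(s h powr p)\<^sup>2 = ((s h)\<^sup>2) powr p"
      using s[OF h] by (simp add: power2_eq_square powr_mult)
    also have "\<dots> \<ge> 1 + p * ((s h)\<^sup>2 - 1)"
      using s[OF h] by (intro powr_tangent_at_1 p) auto
    finally have "1 / (2 * p) * (1 + p * ((s h)\<^sup>2 - 1)) \<le> 1 / (2 * p) * (s h powr p)\<^sup>2"
      using p by (intro mult_left_mono) auto
    moreover have "1 / (2 * p) * (1 + p * ((s h)\<^sup>2 - 1)) = 1 / (2 * p) + 1 / 2 * (s h)\<^sup>2 - 1 / 2"
      using p by (simp add: field_simps)
    ultimately show "1 / 2 * (s h)\<^sup>2 - 1 / (2 * p) * (s h powr p)\<^sup>2 \<le> 1 / 2 - 1 / (2 * p)" by argo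
  qed (use a less_imp_le in auto)
  finally show ?thesis by (subst mult.commute) (simp only: sum_distrib_right)
qed

lemma powr_sq_split:
  fixes t p :: real
  assumes "0 < t"
  shows "t powr p * t powr p = t\<^sup>2 * t powr (2 * p - 2)"
proof -
  have "t\<^sup>2 = t powr 2" using assms by simp
  then show ?thesis by (simp flip: powr_add)
qed

text \<open>At the largest coordinate \<open>s i\<close>, replacing every \<open>s j\<close> by \<open>s
  i\<close> lowers the right-hand side of the critical equation, because the other entries of the row are
  nonpositive; at the smallest one it raises it.\<close>

lemma fibre_critical_bounds:
  fixes a :: "'i \<Rightarrow> real"
  assumes I: "finite I" and p: "1 < p"
    and off: "\<And>h k. h \<in> I \<Longrightarrow> k \<in> I \<Longrightarrow> h \<noteq> k \<Longrightarrow> b h k \<le> 0"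
    and r: "\<And>h. h \<in> I \<Longrightarrow> 0 < (\<Sum>k\<in>I. b h k)"
    and lo: "\<And>h. h \<in> I \<Longrightarrow> m * (\<Sum>k\<in>I. b h k) \<le> a h"
    and up: "\<And>h. h \<in> I \<Longrightarrow> a h \<le> M * (\<Sum>k\<in>I. b h k)"
    and crit: "fibre_critical p I a b s" and h: "h \<in> I"
  shows "m \<le> s h powr (2 * p - 2)" "s h powr (2 * p - 2) \<le> M"
proof -
  have s: "\<And>k. k \<in> I \<Longrightarrow> 0 < s k" and
    c: "\<And>k. k \<in> I \<Longrightarrow> a k * (s k)\<^sup>2 = (\<Sum>j\<in>I. b k j * (s k powr p * s j powr p))"
    using crit by (auto simp: fibre_critical_def)
  have *: "(\<Sum>j\<in>I. b i j * (s i powr p * s i powr p)) = (\<Sum>j\<in>I. b i j) * ((s i)\<^sup>2 * s i powr (2 * p - 2))"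
    if "i \<in> I" for i
    unfolding powr_sq_split[OF s[OF that], symmetric] by (simp add: sum_distrib_right)
  show "s h powr (2 * p - 2) \<le> M"
  proof -
    have "Max (s ` I) \<in> s ` I" using I h by (intro Max_in) auto
    then obtain i where i: "i \<in> I" "Max (s ` I) = s i" by auto
    then have max: "s k \<le> s i" if "k \<in> I" for k
      using I that by (metis Max_ge finite_imageI imageI)
    have "(\<Sum>j\<in>I. b i j) * ((s i)\<^sup>2 * s i powr (2 * p - 2)) \<le> (\<Sum>j\<in>I. b i j * (s i powr p * s j powr p))"
      unfolding *[OF i(1), symmetric]
    proof (intro sum_mono)
      fix j assume j: "j \<in> I"
      show "b i j * (s i powr p * s i powr p) \<le> b i j * (s i powr p * s j powr p)"
      proof (cases "i = j")
        case False
        have "s j powr p \<le> s i powr p"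
          using max[OF j] s[OF j] p by (intro powr_mono2) auto
        then show ?thesis using off[OF i(1) j False]
          by (intro mult_left_mono_neg mult_left_mono) auto
      qed simp
    qed
    also have "\<dots> = a i * (s i)\<^sup>2" using c[OF i(1)] by simp
    also have "\<dots> \<le> M * (\<Sum>k\<in>I. b i k) * (s i)\<^sup>2" using up[OF i(1)] by (intro mult_right_mono) auto
    finally have "((\<Sum>j\<in>I. b i j) * (s i)\<^sup>2) * (s i powr (2 * p - 2)) \<le> ((\<Sum>j\<in>I. b i j) * (s i)\<^sup>2) * M"
      by (simp add: mult_ac)
    moreover have "(\<Sum>j\<in>I. b i j) * (s i)\<^sup>2 > 0" using r[OF i(1)] s[OF i(1)] by simp
    ultimately have "s i powr (2 * p - 2) \<le> M" by (rule mult_left_le_imp_le)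
    moreover have "s h powr (2 * p - 2) \<le> s i powr (2 * p - 2)"
      using max[OF h] s[OF h] p by (intro powr_mono2) auto
    ultimately show ?thesis by simp
  qed
  show "m \<le> s h powr (2 * p - 2)"
  proof -
    have "Min (s ` I) \<in> s ` I" using I h by (intro Min_in) auto
    then obtain i where i: "i \<in> I" "Min (s ` I) = s i" by auto
    then have min: "s i \<le> s k" if "k \<in> I" for k
      using I that by (metis Min_le finite_imageI imageI)
    have "m * (\<Sum>k\<in>I. b i k) * (s i)\<^sup>2 \<le> a i * (s i)\<^sup>2" using lo[OF i(1)] by (intro mult_right_mono) auto
    also have "\<dots> = (\<Sum>j\<in>I. b i j * (s i powr p * s j powr p))" using c[OF i(1)] by simp
    also have "\<dots> \<le> (\<Sum>j\<in>I. b i j * (s i powr p * s i powr p))"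
    proof (intro sum_mono)
      fix j assume j: "j \<in> I"
      show "b i j * (s i powr p * s j powr p) \<le> b i j * (s i powr p * s i powr p)"
      proof (cases "i = j")
        case False
        have "s i powr p \<le> s j powr p"
          using min[OF j] s[OF i(1)] p by (intro powr_mono2) auto
        then show ?thesis using off[OF i(1) j False]
          by (intro mult_left_mono_neg mult_left_mono) auto
      qed simp
    qed
    finally have "((\<Sum>j\<in>I. b i j) * (s i)\<^sup>2) * m \<le> ((\<Sum>j\<in>I. b i j) * (s i)\<^sup>2) * (s i powr (2 * p - 2))"
      unfolding *[OF i(1)] by (simp add: mult_ac)
    moreover have "(\<Sum>j\<in>I. b i j) * (s i)\<^sup>2 > 0" using r[OF i(1)] s[OF i(1)] by simp
    ultimately have "m \<le> s i powr (2 * p - 2)" by (rule mult_left_le_imp_le)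
    moreover have "s i powr (2 * p - 2) \<le> s h powr (2 * p - 2)"
      using min[OF h] s[OF i(1)] p by (intro powr_mono2) auto
    ultimately show ?thesis by simp
  qed
qed

lemma quadratic_form_split:
  fixes b :: "'i \<Rightarrow> 'i \<Rightarrow> real" and x :: "'i \<Rightarrow> real"
  assumes I: "finite I" and h: "h \<in> I" and sym: "\<And>k. k \<in> I \<Longrightarrow> b h k = b k h"
  shows "(\<Sum>i\<in>I. \<Sum>k\<in>I. b i k * (x i * x k)) = b h h * (x h * x h)
    + 2 * x h * (\<Sum>k\<in>I - {h}. b h k * x k) + (\<Sum>i\<in>I - {h}. \<Sum>k\<in>I - {h}. b i k * (x i * x k))"
proof -
  have inner: "(\<Sum>k\<in>I. b i k * (x i * x k)) = b i h * (x i * x h) + (\<Sum>k\<in>I - {h}. b i k * (x i * x k))" for i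
    by (rule sum.remove[OF I h])
  have "(\<Sum>i\<in>I. \<Sum>k\<in>I. b i k * (x i * x k)) = (\<Sum>k\<in>I. b h k * (x h * x k)) + (\<Sum>i\<in>I - {h}. \<Sum>k\<in>I. b i k * (x i * x k))"
    by (rule sum.remove[OF I h])
  also have "(\<Sum>i\<in>I - {h}. \<Sum>k\<in>I. b i k * (x i * x k)) =
     (\<Sum>i\<in>I - {h}. b i h * (x i * x h)) + (\<Sum>i\<in>I - {h}. \<Sum>k\<in>I - {h}. b i k * (x i * x k))"
    unfolding inner by (rule sum.distrib)
  also have "(\<Sum>i\<in>I - {h}. b i h * (x i * x h)) = x h * (\<Sum>k\<in>I - {h}. b h k * x k)"
    unfolding sum_distrib_left by (intro sum.cong) (auto simp: sym mult_ac)
  also have "(\<Sum>k\<in>I. b h k * (x h * x k)) = b h h * (x h * x h) + x h * (\<Sum>k\<in>I - {h}. b h k * x k)"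
    unfolding inner[of h] sum_distrib_left by (simp add: mult_ac)
  finally show ?thesis by simp
qed

text \<open>The constant \<open>C\<close> collects the terms without the coordinate \<open>h\<close>.\<close>

lemma fibre_update:
  fixes a :: "'i \<Rightarrow> real"
  assumes I: "finite I" and h: "h \<in> I" and p: "1 < p"
    and sym: "\<And>h k. h \<in> I \<Longrightarrow> k \<in> I \<Longrightarrow> b h k = b k h"
  obtains C where "\<And>t. fibre p I a b (s(h := t)) = C + (1 / 2 * (a h * t\<^sup>2)
     - 1 / (2 * p) * (b h h * (t powr p * t powr p) + 2 * t powr p * (\<Sum>k\<in>I - {h}. b h k * s k powr p)))"
proof -
  let ?C = "1 / 2 * (\<Sum>i\<in>I - {h}. a i * (s i)\<^sup>2)
     - 1 / (2 * p) * (\<Sum>i\<in>I - {h}. \<Sum>k\<in>I - {h}. b i k * (s i powr p * s k powr p))"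
  have "fibre p I a b (s(h := t)) = ?C + (1 / 2 * (a h * t\<^sup>2)
     - 1 / (2 * p) * (b h h * (t powr p * t powr p) + 2 * t powr p * (\<Sum>k\<in>I - {h}. b h k * s k powr p)))" for t
  proof -
    let ?s = "s(h := t)"
    have 1: "(\<Sum>i\<in>I. a i * (?s i)\<^sup>2) = a h * t\<^sup>2 + (\<Sum>i\<in>I - {h}. a i * (s i)\<^sup>2)"
      unfolding sum.remove[OF I h] by (auto intro!: sum.cong)
    have 2: "(\<Sum>i\<in>I. \<Sum>k\<in>I. b i k * (?s i powr p * ?s k powr p)) = b h h * (t powr p * t powr p)
       + 2 * t powr p * (\<Sum>k\<in>I - {h}. b h k * s k powr p)
       + (\<Sum>i\<in>I - {h}. \<Sum>k\<in>I - {h}. b i k * (s i powr p * s k powr p))"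
    proof -
      have u: "?s i = s i" if "i \<in> I - {h}" for i using that by auto
      have "(\<Sum>i\<in>I. \<Sum>k\<in>I. b i k * (?s i powr p * ?s k powr p)) = b h h * (?s h powr p * ?s h powr p)
         + 2 * ?s h powr p * (\<Sum>k\<in>I - {h}. b h k * ?s k powr p)
         + (\<Sum>i\<in>I - {h}. \<Sum>k\<in>I - {h}. b i k * (?s i powr p * ?s k powr p))"
        by (rule quadratic_form_split[where x = "\<lambda>i. ?s i powr p", OF I h]) (rule sym[OF h])
      also have "(\<Sum>k\<in>I - {h}. b h k * ?s k powr p) = (\<Sum>k\<in>I - {h}. b h k * s k powr p)"
        by (intro sum.cong refl) (simp only: u)
      also have "(\<Sum>i\<in>I - {h}. \<Sum>k\<in>I - {h}. b i k * (?s i powr p * ?s k powr p))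
         = (\<Sum>i\<in>I - {h}. \<Sum>k\<in>I - {h}. b i k * (s i powr p * s k powr p))"
        by (intro sum.cong refl) (simp only: u)
      finally show ?thesis by simp
    qed
    show ?thesis unfolding fibre_def 1 2 by (simp add: algebra_simps)
  qed
  then show ?thesis by (rule that)
qed

text \<open>Maximise \<open>fibre\<close> over a large cube. At a face where a coordinate is \<open>0\<close>,
  the quadratic term wins over the terms of order \<open>2p\<close>, so moving inwards increases the value; at
  an outer face the row sums being positive gives a negative outward derivative. So the maximum is an interior
  critical point.\<close>

lemma fibre_critical_exists:
  fixes a :: "'i \<Rightarrow> real"
  assumes I: "finite I" and p: "1 < p"
    and sym: "\<And>h k. h \<in> I \<Longrightarrow> k \<in> I \<Longrightarrow> b h k = b k h"
    and off: "\<And>h k. h \<in> I \<Longrightarrow> k \<in> I \<Longrightarrow> h \<noteq> k \<Longrightarrow> b h k \<le> 0"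
    and a: "\<And>h. h \<in> I \<Longrightarrow> 0 < a h"
    and r: "\<And>h. h \<in> I \<Longrightarrow> 0 < (\<Sum>k\<in>I. b h k)"
  obtains s where "fibre_critical p I a b s"
proof -
  define q where "q = 2 * p - 2"
  have q: "q > 0" using p by (simp add: q_def)
  \<comment> \<open>large enough that \<open>a h < R\<^bsup>2p-2\<^esup>\<close> times the row sum, for every \<open>h\<close>\<close>
  define R where "R = (1 + (\<Sum>h\<in>I. a h / (\<Sum>k\<in>I. b h k))) powr (1 / q)"
  have ratio: "0 \<le> a h / (\<Sum>k\<in>I. b h k)" if "h \<in> I" for h
    using a[OF that] r[OF that] by simp
  have S: "0 \<le> (\<Sum>h\<in>I. a h / (\<Sum>k\<in>I. b h k))" using ratio by (rule sum_nonneg)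
  then have R: "R > 0" "R powr q = 1 + (\<Sum>h\<in>I. a h / (\<Sum>k\<in>I. b h k))"
    using q by (auto simp: R_def powr_powr)
  have aR: "a h < (\<Sum>k\<in>I. b h k) * R powr q" if h: "h \<in> I" for h
  proof -
    have "a h / (\<Sum>k\<in>I. b h k) \<le> (\<Sum>h\<in>I. a h / (\<Sum>k\<in>I. b h k))"
      using ratio by (intro member_le_sum[OF h _ I]) auto
    then have "a h / (\<Sum>k\<in>I. b h k) < R powr q" using R(2) by simp
    then show ?thesis using r[OF h] by (simp add: field_simps)
  qed
  define K where "K = PiE UNIV (\<lambda>h. if h \<in> I then {0..R} else {0})"
  have "compactin (product_topology (\<lambda>i. euclidean) UNIV) K"
    unfolding K_def compactin_PiE by (auto simp: compactin_euclidean_iff)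
  then have K: "compact K" by (simp add: euclidean_product_topology)
  have cont: "continuous_on K (fibre p I a b)"
    unfolding fibre_def using p
    by (intro continuous_intros continuous_on_powr' continuous_on_subset[OF continuous_on_product_coordinates])
      (auto simp: K_def PiE_def Pi_def)
  have "(\<lambda>h. 0) \<in> K" using R(1) by (auto simp: K_def)
  then obtain s where s: "s \<in> K" "\<And>y. y \<in> K \<Longrightarrow> fibre p I a b y \<le> fibre p I a b s"
    using continuous_attains_sup[OF K _ cont] by blast
  have sI: "0 \<le> s h" "s h \<le> R" if "h \<in> I" for h
    using s(1) that by (auto simp: K_def PiE_def Pi_def split: if_splits)
  have bhh: "0 < b h h" if h: "h \<in> I" for h
  proof -
    have "(\<Sum>k\<in>I. b h k) = b h h + (\<Sum>k\<in>I - {h}. b h k)" by (rule sum.remove[OF I h])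
    moreover have "(\<Sum>k\<in>I - {h}. b h k) \<le> 0" using off[OF h] by (intro sum_nonpos) auto
    ultimately show ?thesis using r[OF h] by simp
  qed
  have "0 < s h \<and> a h * (s h)\<^sup>2 = (\<Sum>k\<in>I. b h k * (s h powr p * s k powr p))" if h: "h \<in> I" for h
  proof -
    define c where "c = (\<Sum>k\<in>I - {h}. b h k * s k powr p)"
    have c0: "c \<le> 0" unfolding c_def using off[OF h] by (intro sum_nonpos mult_nonpos_nonneg) auto
    define \<psi> where "\<psi> t = 1 / 2 * (a h * t\<^sup>2) - 1 / (2 * p) * (b h h * (t powr p * t powr p) + 2 * t powr p * c)" for t
    obtain C where C: "\<And>t. fibre p I a b (s(h := t)) = C + \<psi> t"
      using fibre_update[where b = b and a = a and s = s, OF I h p sym] unfolding \<psi>_def c_def by blast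
    have max: "\<psi> t \<le> \<psi> (s h)" if t: "0 \<le> t" "t \<le> R" for t
    proof -
      have "s x \<in> (if x \<in> I then {0..R} else {0})" for x using s(1) by (simp add: K_def PiE_iff)
      then have "(s(h := t)) x \<in> (if x \<in> I then {0..R} else {0})" for x
        using t h by (cases "x = h") auto
      then have "s(h := t) \<in> K" by (simp add: K_def PiE_iff del: fun_upd_apply)
      from s(2)[OF this] C[of t] C[of "s h"] show ?thesis by simp
    qed
    have pos: "0 < s h"
    proof (rule ccontr)
      assume "\<not> 0 < s h"
      then have s0: "s h = 0" using sI(1)[OF h] by simp
      \<comment> \<open>small enough that \<open>b h h * t\<^bsup>2p\<^esup> \<le> a h * t\<^sup>2\<close>\<close>
      define t where "t = min R ((a h / b h h) powr (1 / q))"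
      have ab: "0 < a h / b h h" using a[OF h] bhh[OF h] by simp
      have t: "0 < t" "t \<le> R" using R(1) ab by (auto simp: t_def)
      have "t powr q \<le> ((a h / b h h) powr (1 / q)) powr q"
        using t q by (intro powr_mono2) (auto simp: t_def)
      also have "\<dots> = a h / b h h" using a[OF h] bhh[OF h] q by (simp add: powr_powr)
      finally have "b h h * t powr q \<le> a h" using bhh[OF h] by (simp add: field_simps)
      then have "t\<^sup>2 * (b h h * t powr q) \<le> t\<^sup>2 * a h" by (intro mult_left_mono) auto
      then have le: "b h h * (t powr p * t powr p) \<le> a h * t\<^sup>2"
        unfolding powr_sq_split[OF t(1)] q_def by (simp add: mult_ac)
      have "b h h * (t powr p * t powr p) + 2 * t powr p * c \<le> a h * t\<^sup>2"
        using le c0 by (simp add: mult_nonneg_nonpos add_decreasing2)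
      then have "1 / (2 * p) * (b h h * (t powr p * t powr p) + 2 * t powr p * c) \<le> 1 / (2 * p) * (a h * t\<^sup>2)"
        using p by (intro mult_left_mono) auto
      also have "\<dots> < 1 / 2 * (a h * t\<^sup>2)"
        using p a[OF h] t(1) by (intro mult_strict_right_mono) (auto simp: field_simps)
      finally have "0 < \<psi> t" by (simp add: \<psi>_def)
      moreover have "\<psi> (s h) = 0" using p by (simp add: \<psi>_def s0)
      ultimately show False using max[of t] t by simp
    qed
    have der: "(\<psi> has_real_derivative (a h * t - t powr (p - 1) * (b h h * t powr p + c))) (at t)" if t: "t > 0" for t
    proof -
      have "(\<psi> has_real_derivative (1 / 2 * (a h * (2 * t)) - 1 / (2 * p) * (b h h * (p * t powr (p - 1) * t powr p
            + t powr p * (p * t powr (p - 1))) + 2 * (p * t powr (p - 1)) * c))) (at t)"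
        unfolding \<psi>_def using t p by (auto intro!: derivative_eq_intros simp: field_simps)
      moreover have "1 / 2 * (a h * (2 * t)) - 1 / (2 * p) * (b h h * (p * t powr (p - 1) * t powr p
            + t powr p * (p * t powr (p - 1))) + 2 * (p * t powr (p - 1)) * c)
          = a h * t - t powr (p - 1) * (b h h * t powr p + c)"
        using p by (simp add: field_simps)
      ultimately show ?thesis by simp
    qed
    have row: "(\<Sum>k\<in>I. b h k * s k powr p) = b h h * s h powr p + c"
      unfolding c_def by (rule sum.remove[OF I h])
    have mult: "t * t powr (p - 1) = t powr p" if "t > 0" for t :: real
      using that by (simp add: powr_diff)
    have lt: "s h < R"
    proof (rule ccontr)
      assume "\<not> s h < R"
      then have sR: "s h = R" using sI(2)[OF h] by simp
      have "(\<Sum>k\<in>I. b h k * R powr p) \<le> (\<Sum>k\<in>I. b h k * s k powr p)"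
      proof (intro sum_mono)
        fix k assume k: "k \<in> I"
        show "b h k * R powr p \<le> b h k * s k powr p"
        proof (cases "h = k")
          case False
          have "s k powr p \<le> R powr p" using sI[OF k] p by (intro powr_mono2) auto
          then show ?thesis using off[OF h k False] by (intro mult_left_mono_neg)
        qed (use sR in auto)
      qed
      then have "R * R powr (p - 1) * ((\<Sum>k\<in>I. b h k) * R powr p) \<le> R * R powr (p - 1) * (b h h * R powr p + c)"
        using R(1) by (intro mult_left_mono) (auto simp: row sR sum_distrib_right)
      moreover have "R * (a h * R) < R * R powr (p - 1) * ((\<Sum>k\<in>I. b h k) * R powr p)"
      proof -
        have "R\<^sup>2 * a h < R\<^sup>2 * ((\<Sum>k\<in>I. b h k) * R powr q)" using aR[OF h] R(1) by simp
        also have "\<dots> = (\<Sum>k\<in>I. b h k) * (R powr p * R powr p)"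
          unfolding powr_sq_split[OF R(1)] q_def by (simp add: mult_ac)
        finally show ?thesis unfolding mult[OF R(1)] by (simp add: power2_eq_square mult_ac)
      qed
      ultimately have "R * (a h * R - R powr (p - 1) * (b h h * R powr p + c)) < 0"
        by (simp add: algebra_simps)
      then have neg: "a h * R - R powr (p - 1) * (b h h * R powr p + c) < 0"
        using R(1) by (simp add: mult_less_0_iff)
      obtain d where d: "d > 0" "\<And>e. 0 < e \<Longrightarrow> e < d \<Longrightarrow> \<psi> R < \<psi> (R - e)"
        using DERIV_neg_dec_left[OF der[OF R(1)] neg] by blast
      define e where "e = min (d / 2) (R / 2)"
      have e: "0 < e" "e < d" "e \<le> R" using d(1) R(1) by (auto simp: e_def)
      show False using d(2)[OF e(1,2)] max[of "R - e"] e sR by simp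
    qed
    have "a h * s h - s h powr (p - 1) * (b h h * s h powr p + c) = 0"
    proof (rule DERIV_local_max[OF der[OF pos]])
      show "0 < min (s h) (R - s h)" using pos lt by simp
      show "\<forall>y. \<bar>s h - y\<bar> < min (s h) (R - s h) \<longrightarrow> \<psi> y \<le> \<psi> (s h)"
        using max by (auto simp: abs_less_iff)
    qed
    then have "s h * (a h * s h) = s h * (s h powr (p - 1) * (\<Sum>k\<in>I. b h k * s k powr p))"
      by (simp add: row)
    also have "\<dots> = s h powr p * (\<Sum>k\<in>I. b h k * s k powr p)"
      using mult[OF pos] by (simp flip: mult.assoc)
    finally have "a h * (s h)\<^sup>2 = (\<Sum>k\<in>I. b h k * (s h powr p * s k powr p))"
      by (simp add: power2_eq_square sum_distrib_left mult_ac)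
    then show ?thesis using pos by blast
  qed
  then show ?thesis by (intro that[of s]) (auto simp: fibre_critical_def)
qed


lemma tendsto_1_of_eventually_close:
  fixes f :: "'a \<Rightarrow> real"
  assumes "\<And>\<eta>. 0 < \<eta> \<Longrightarrow> \<eta> < 1 \<Longrightarrow> \<forall>\<^sub>F e in F. 1 - \<eta> \<le> f e \<and> f e \<le> 1 + \<eta>"
  shows "(f \<longlongrightarrow> 1) F"
proof (rule tendstoI)
  fix \<epsilon> :: real assume "\<epsilon> > 0"
  then have "\<forall>\<^sub>F e in F. 1 - min (\<epsilon> / 2) (1 / 2) \<le> f e \<and> f e \<le> 1 + min (\<epsilon> / 2) (1 / 2)"
    by (intro assms) auto
  then show "\<forall>\<^sub>F e in F. dist (f e) 1 < \<epsilon>"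
  proof eventually_elim
    case (elim e)
    then have "\<bar>f e - 1\<bar> \<le> min (\<epsilon> / 2) (1 / 2)" by (intro abs_leI) argo+
    then have "\<bar>f e - 1\<bar> \<le> \<epsilon> / 2" by simp
    then show ?case using \<open>\<epsilon> > 0\<close> by (simp add: dist_real_def)
  qed
qed

text \<open>Envelope argument: for small \<open>e\<close> choose a critical point \<open>s e\<close> of the
  perturbed fibre. The bounds on critical points force \<open>s e \<longlonglongrightarrow> 1\<close>, since
  the quotients of \<open>\<alpha>\<close> by the row sums tend to \<open>1\<close>. The increment of the
  fibre at \<open>s e\<close> from parameter \<open>0\<close> to \<open>e\<close> is nonnegative, as its final
  value is at least the maximal initial value. Dividing by \<open>e\<close> of either sign gives both
  inequalities.\<close>

lemma fibre_envelope:
  fixes \<alpha> :: "'i \<Rightarrow> real \<Rightarrow> real" and b :: "'i \<Rightarrow> 'i \<Rightarrow> real \<Rightarrow> real"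
  assumes I: "finite I" and p: "1 < p"
    and sym: "\<And>h k e. h \<in> I \<Longrightarrow> k \<in> I \<Longrightarrow> b h k e = b k h e"
    and off: "\<And>h k e. h \<in> I \<Longrightarrow> k \<in> I \<Longrightarrow> h \<noteq> k \<Longrightarrow> b h k e \<le> 0"
    and pos: "\<And>h. h \<in> I \<Longrightarrow> 0 < \<alpha> h 0" and nehari: "\<And>h. h \<in> I \<Longrightarrow> (\<Sum>k\<in>I. b h k 0) = \<alpha> h 0"
    and d\<alpha>: "\<And>h. h \<in> I \<Longrightarrow> (\<alpha> h has_real_derivative \<alpha>' h) (at 0)"
    and db: "\<And>h k. h \<in> I \<Longrightarrow> k \<in> I \<Longrightarrow> (b h k has_real_derivative b' h k) (at 0)"
    and min: "\<And>e s. (\<And>h. h \<in> I \<Longrightarrow> 0 < \<alpha> h e) \<Longrightarrow> fibre_critical p I (\<lambda>h. \<alpha> h e) (\<lambda>h k. b h k e) s \<Longrightarrow>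
      (1 / 2 - 1 / (2 * p)) * (\<Sum>h\<in>I. \<alpha> h 0) \<le> fibre p I (\<lambda>h. \<alpha> h e) (\<lambda>h k. b h k e) s"
  shows "1 / 2 * (\<Sum>h\<in>I. \<alpha>' h) - 1 / (2 * p) * (\<Sum>h\<in>I. \<Sum>k\<in>I. b' h k) = 0"
proof -
  let ?r = "\<lambda>h e. \<Sum>k\<in>I. b h k e"
  let ?crit = "\<lambda>e s. fibre_critical p I (\<lambda>h. \<alpha> h e) (\<lambda>h k. b h k e) s"
  \<comment> \<open>arbitrary for those \<open>e\<close>, all of them away from \<open>0\<close>, that have no critical point\<close>
  define s where "s e = (SOME s. ?crit e s)" for e
  have \<alpha>0: "(\<alpha> h \<longlongrightarrow> \<alpha> h 0) (at 0)" if "h \<in> I" for h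
    using DERIV_isCont[OF d\<alpha>[OF that]] by (simp add: isCont_def)
  have b0: "(b h k \<longlongrightarrow> b h k 0) (at 0)" if "h \<in> I" "k \<in> I" for h k
    using DERIV_isCont[OF db[OF that]] by (simp add: isCont_def)
  have r0: "((\<lambda>e. ?r h e) \<longlongrightarrow> \<alpha> h 0) (at 0)" if h: "h \<in> I" for h
    unfolding nehari[OF h, symmetric] by (intro tendsto_sum b0 h)
  have ev_pos: "\<forall>\<^sub>F e in at 0. \<forall>h\<in>I. 0 < \<alpha> h e \<and> 0 < ?r h e"
    using I
  proof (rule eventually_ball_finite, intro ballI eventually_conj)
    fix h assume h: "h \<in> I"
    show "\<forall>\<^sub>F e in at 0. 0 < \<alpha> h e" by (rule order_tendstoD(1)[OF \<alpha>0[OF h] pos[OF h]])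
    show "\<forall>\<^sub>F e in at 0. 0 < ?r h e" by (rule order_tendstoD(1)[OF r0[OF h] pos[OF h]])
  qed
  have crit: "\<forall>\<^sub>F e in at 0. ?crit e (s e)"
    using ev_pos
  proof eventually_elim
    case (elim e)
    have "\<exists>s. ?crit e s"
    proof (rule fibre_critical_exists[of I p "\<lambda>h k. b h k e" "\<lambda>h. \<alpha> h e"])
      show "b h k e = b k h e" if "h \<in> I" "k \<in> I" for h k by (rule sym[OF that])
      show "b h k e \<le> 0" if "h \<in> I" "k \<in> I" "h \<noteq> k" for h k by (rule off[OF that])
    qed (use I p elim in auto)
    then show ?case unfolding s_def by (rule someI_ex)
  qed
  have s1: "((\<lambda>e. s e h) \<longlongrightarrow> 1) (at 0)" if h: "h \<in> I" for h
  proof -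
    have "((\<lambda>e. s e h powr (2 * p - 2)) \<longlongrightarrow> 1) (at 0)"
    proof (rule tendsto_1_of_eventually_close)
      fix \<eta> :: real assume \<eta>: "0 < \<eta>" "\<eta> < 1"
      have lo: "\<forall>\<^sub>F e in at 0. (1 - \<eta>) * ?r k e < \<alpha> k e" if k: "k \<in> I" for k
      proof -
        have "((\<lambda>e. \<alpha> k e - (1 - \<eta>) * ?r k e) \<longlongrightarrow> \<alpha> k 0 - (1 - \<eta>) * \<alpha> k 0) (at 0)"
          by (intro tendsto_intros \<alpha>0 r0 k)
        moreover have "0 < \<alpha> k 0 - (1 - \<eta>) * \<alpha> k 0" using pos[OF k] \<eta> by (simp add: algebra_simps)
        ultimately have "\<forall>\<^sub>F e in at 0. 0 < \<alpha> k e - (1 - \<eta>) * ?r k e" by (rule order_tendstoD)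
        then show ?thesis by eventually_elim simp
      qed
      have up: "\<forall>\<^sub>F e in at 0. \<alpha> k e < (1 + \<eta>) * ?r k e" if k: "k \<in> I" for k
      proof -
        have "((\<lambda>e. (1 + \<eta>) * ?r k e - \<alpha> k e) \<longlongrightarrow> (1 + \<eta>) * \<alpha> k 0 - \<alpha> k 0) (at 0)"
          by (intro tendsto_intros \<alpha>0 r0 k)
        moreover have "0 < (1 + \<eta>) * \<alpha> k 0 - \<alpha> k 0" using pos[OF k] \<eta> by (simp add: algebra_simps)
        ultimately have "\<forall>\<^sub>F e in at 0. 0 < (1 + \<eta>) * ?r k e - \<alpha> k e" by (rule order_tendstoD)
        then show ?thesis by eventually_elim simp
      qed
      have "\<forall>\<^sub>F e in at 0. \<forall>k\<in>I. (1 - \<eta>) * ?r k e < \<alpha> k e \<and> \<alpha> k e < (1 + \<eta>) * ?r k e"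
        using I lo up by (simp add: eventually_ball_finite_distrib eventually_conj)
      then show "\<forall>\<^sub>F e in at 0. 1 - \<eta> \<le> s e h powr (2 * p - 2) \<and> s e h powr (2 * p - 2) \<le> 1 + \<eta>"
        using crit ev_pos
      proof eventually_elim
        case (elim e)
        show ?case
          using elim off h I p
            fibre_critical_bounds[of I p "\<lambda>h k. b h k e" "1 - \<eta>" "\<lambda>h. \<alpha> h e" "1 + \<eta>" "s e" h]
          by (auto intro: less_imp_le)
      qed
    qed
    then have "((\<lambda>e. (s e h powr (2 * p - 2)) powr (1 / (2 * p - 2))) \<longlongrightarrow> 1 powr (1 / (2 * p - 2))) (at 0)"
      by (intro tendsto_powr tendsto_const) auto
    moreover have "\<forall>\<^sub>F e in at 0. (s e h powr (2 * p - 2)) powr (1 / (2 * p - 2)) = s e h"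
      using crit
    proof eventually_elim
      case (elim e)
      then have "0 < s e h" using h by (simp add: fibre_critical_def)
      then show ?case using p by (simp add: powr_powr)
    qed
    ultimately show ?thesis by (simp add: filterlim_cong[OF refl refl])
  qed
  define F where "F e = fibre p I (\<lambda>h. \<alpha> h e) (\<lambda>h k. b h k e) (s e)
      - fibre p I (\<lambda>h. \<alpha> h 0) (\<lambda>h k. b h k 0) (s e)" for e
  have F0: "\<forall>\<^sub>F e in at 0. 0 \<le> F e"
    using crit ev_pos
  proof eventually_elim
    case (elim e)
    have "fibre p I (\<lambda>h. \<alpha> h 0) (\<lambda>h k. b h k 0) (s e) \<le> (1 / 2 - 1 / (2 * p)) * (\<Sum>h\<in>I. \<alpha> h 0)"
    proof (rule fibre_le[OF I p])
      show "b h k 0 = b k h 0" if "h \<in> I" "k \<in> I" for h k by (rule sym[OF that])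
      show "b h k 0 \<le> 0" if "h \<in> I" "k \<in> I" "h \<noteq> k" for h k by (rule off[OF that])
    qed (use pos nehari elim in \<open>auto simp: fibre_critical_def\<close>)
    with min[OF _ elim(1)] elim(2) show ?case by (simp add: F_def)
  qed
  let ?D = "1 / 2 * (\<Sum>h\<in>I. \<alpha>' h) - 1 / (2 * p) * (\<Sum>h\<in>I. \<Sum>k\<in>I. b' h k)"
  have F_eq: "F e / e = 1 / 2 * (\<Sum>h\<in>I. (\<alpha> h e - \<alpha> h 0) / e * (s e h)\<^sup>2)
     - 1 / (2 * p) * (\<Sum>h\<in>I. \<Sum>k\<in>I. (b h k e - b h k 0) / e * (s e h powr p * s e k powr p))" for e
    unfolding F_def fibre_def
    by (simp add: left_diff_distrib diff_divide_distrib sum_subtractf sum_divide_distrib[symmetric] right_diff_distrib)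
  have "((\<lambda>e. F e / e) \<longlongrightarrow> 1 / 2 * (\<Sum>h\<in>I. \<alpha>' h * 1\<^sup>2)
     - 1 / (2 * p) * (\<Sum>h\<in>I. \<Sum>k\<in>I. b' h k * (1 powr p * 1 powr p))) (at 0)"
    unfolding F_eq
    using d\<alpha> db by (intro tendsto_intros s1) (auto simp: DERIV_def)
  then have lim: "((\<lambda>e. F e / e) \<longlongrightarrow> ?D) (at 0)" by simp
  have "0 \<le> ?D"
  proof (rule tendsto_lowerbound)
    show "((\<lambda>e. F e / e) \<longlongrightarrow> ?D) (at_right 0)" using lim by (simp add: filterlim_at_split)
    have "\<forall>\<^sub>F e in at_right 0. 0 \<le> F e" using F0 by (simp add: eventually_at_split)
    moreover have "\<forall>\<^sub>F e in at_right (0::real). 0 < e" by (simp add: eventually_at_right_less)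
    ultimately show "\<forall>\<^sub>F e in at_right 0. 0 \<le> F e / e" by eventually_elim simp
  qed simp
  moreover have "?D \<le> 0"
  proof (rule tendsto_upperbound)
    show "((\<lambda>e. F e / e) \<longlongrightarrow> ?D) (at_left 0)" using lim by (simp add: filterlim_at_split)
    have "\<forall>\<^sub>F e in at_left 0. 0 \<le> F e" using F0 by (simp add: eventually_at_split)
    moreover have "\<forall>\<^sub>F e in at_left (0::real). e < 0" by (simp add: eventually_at_left_field) (metis lt_ex)
    ultimately show "\<forall>\<^sub>F e in at_left 0. F e / e \<le> 0" by eventually_elim (simp add: divide_nonneg_neg)
  qed simp
  ultimately show ?thesis by argo
qed

section \<open>The interaction integrals\<close>

lemma abs_powr_has_derivative:
  fixes t p :: real
  assumes p: "1 < p"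
  shows "((\<lambda>t. \<bar>t\<bar> powr p) has_real_derivative (p * (\<bar>t\<bar> powr (p - 2) * t))) (at t)"
proof -
  consider "t > 0" | "t < 0" | "t = 0" by linarith
  then show ?thesis
  proof cases
    case 1
    have "((\<lambda>t. t powr p) has_real_derivative p * t powr (p - 1)) (at t)"
      using 1 by (rule has_real_derivative_powr)
    then have "((\<lambda>t. \<bar>t\<bar> powr p) has_real_derivative p * t powr (p - 1)) (at t)"
      by (rule has_field_derivative_transform_within_open[of _ _ _ "{0<..}"]) (use 1 in auto)
    moreover have "t powr (p - 1) = \<bar>t\<bar> powr (p - 2) * t"
      using 1 powr_mult_base[of t "p - 2"] by (simp add: mult.commute)
    ultimately show ?thesis by simp
  next
    case 2
    have "((\<lambda>t. (- t) powr p) has_real_derivative p * (- t) powr (p - 1) * (- 1)) (at t)"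
      using 2 by (auto intro!: derivative_eq_intros)
    then have "((\<lambda>t. \<bar>t\<bar> powr p) has_real_derivative p * (- t) powr (p - 1) * (- 1)) (at t)"
      by (rule has_field_derivative_transform_within_open[of _ _ _ "{..<0}"]) (use 2 in auto)
    moreover have "(- t) powr (p - 1) * (- 1) = \<bar>t\<bar> powr (p - 2) * t"
      using 2 powr_mult_base[of "- t" "p - 2"] by (simp add: mult.commute)
    ultimately show ?thesis by (simp only: mult.assoc)
  next
    case 3
    have "((\<lambda>h::real. \<bar>h\<bar> powr (p - 1)) \<longlongrightarrow> \<bar>0\<bar> powr (p - 1)) (at 0)"
      using p by (intro tendsto_powr' tendsto_intros) auto
    then have lim: "((\<lambda>h::real. \<bar>h\<bar> powr (p - 1)) \<longlongrightarrow> 0) (at 0)" by simp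
    have "norm (\<bar>h\<bar> powr p / h) \<le> \<bar>h\<bar> powr (p - 1)" for h :: real
      by (cases "h = 0") (simp_all add: powr_diff)
    then have "((\<lambda>h. \<bar>h\<bar> powr p / h) \<longlongrightarrow> 0) (at 0)"
      by (intro Lim_null_comparison[OF always_eventually lim] allI)
    then show ?thesis using 3 by (simp add: DERIV_def)
  qed
qed

lemma abs_powr_derivative_le:
  fixes t p S :: real
  assumes "1 < p" "\<bar>t\<bar> \<le> S"
  shows "\<bar>\<bar>t\<bar> powr (p - 2) * t\<bar> \<le> S powr (p - 1)"
proof (cases "t = 0")
  case False
  then have "\<bar>\<bar>t\<bar> powr (p - 2) * t\<bar> = \<bar>t\<bar> powr (p - 1)"
    using powr_mult_base[of "\<bar>t\<bar>" "p - 2"] by (simp add: abs_mult mult.commute)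
  also have "\<dots> \<le> S powr (p - 1)" using assms by (intro powr_mono2) auto
  finally show ?thesis .
qed simp

lemma powr_triple_eq:
  fixes S p :: real
  assumes "0 \<le> S"
  shows "S powr p * S powr (p - 1) * S = S powr (2 * p)"
proof (cases "S = 0")
  case False
  then have "S powr (p - 1) * S = S powr p"
    using assms powr_mult_base[of S "p - 1"] by (simp add: mult.commute)
  then have "S powr p * S powr (p - 1) * S = S powr p * S powr p" by (simp only: mult.assoc)
  then show ?thesis by (simp flip: powr_add)
qed simp

lemma interaction_integrand_le:
  fixes s t p :: real
  assumes "0 < p"
  shows "\<bar>s\<bar> powr p * \<bar>t\<bar> powr p \<le> \<bar>s\<bar> powr (2 * p) + \<bar>t\<bar> powr (2 * p)"
proof -
  have sq: "\<bar>x\<bar> powr (2 * p) = (\<bar>x\<bar> powr p)\<^sup>2" for x :: real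
    by (simp add: power2_eq_square flip: powr_add)
  have "0 \<le> (\<bar>s\<bar> powr p - \<bar>t\<bar> powr p)\<^sup>2 + (\<bar>s\<bar> powr p)\<^sup>2 + (\<bar>t\<bar> powr p)\<^sup>2" by simp
  then show ?thesis unfolding sq by (simp add: power2_eq_square algebra_simps)
qed

lemma interaction_integrable:
  fixes u v :: "'a::euclidean_space \<Rightarrow> real"
  assumes p: "0 < p" and u: "u \<in> Lp (2 * p) \<Omega>" and v: "v \<in> Lp (2 * p) \<Omega>"
  shows "integrable (lebesgue_on \<Omega>) (\<lambda>x. \<bar>u x\<bar> powr p * \<bar>v x\<bar> powr p)"
    and "interaction \<Omega> p u v \<le> Lpow (2 * p) \<Omega> u + Lpow (2 * p) \<Omega> v"
proof -
  note [measurable] = LpD(1)[OF u] LpD(1)[OF v]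
  have R: "integrable (lebesgue_on \<Omega>) (\<lambda>x. \<bar>u x\<bar> powr (2 * p) + \<bar>v x\<bar> powr (2 * p))"
    using LpD(2)[OF u] LpD(2)[OF v] by simp
  show i: "integrable (lebesgue_on \<Omega>) (\<lambda>x. \<bar>u x\<bar> powr p * \<bar>v x\<bar> powr p)"
  proof (rule Bochner_Integration.integrable_bound[OF R])
    show "AE x in lebesgue_on \<Omega>. norm (\<bar>u x\<bar> powr p * \<bar>v x\<bar> powr p) \<le> norm (\<bar>u x\<bar> powr (2 * p) + \<bar>v x\<bar> powr (2 * p))"
      using interaction_integrand_le[OF p] by (simp add: abs_mult)
  qed measurable
  have "interaction \<Omega> p u v \<le> (\<integral>x. \<bar>u x\<bar> powr (2 * p) + \<bar>v x\<bar> powr (2 * p) \<partial>lebesgue_on \<Omega>)"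
    unfolding interaction_def using interaction_integrand_le[OF p] by (intro integral_mono i R)
  then show "interaction \<Omega> p u v \<le> Lpow (2 * p) \<Omega> u + Lpow (2 * p) \<Omega> v"
    using LpD(2)[OF u] LpD(2)[OF v] by (simp add: Lpow_def)
qed

lemma interaction_nonneg: "0 \<le> interaction \<Omega> p u v"
  unfolding interaction_def by (intro Bochner_Integration.integral_nonneg) simp

lemma interaction_commute: "interaction \<Omega> p u v = interaction \<Omega> p v u"
  by (simp add: interaction_def mult.commute)

lemma interaction_scale:
  "interaction \<Omega> p (\<lambda>x. a * u x) (\<lambda>x. b * v x) = \<bar>a\<bar> powr p * \<bar>b\<bar> powr p * interaction \<Omega> p u v"
proof -
  have "(\<lambda>x. \<bar>a * u x\<bar> powr p * \<bar>b * v x\<bar> powr p) = (\<lambda>x. (\<bar>a\<bar> powr p * \<bar>b\<bar> powr p) * (\<bar>u x\<bar> powr p * \<bar>v x\<bar> powr p))"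
    by (simp add: abs_mult powr_mult mult_ac)
  then show ?thesis by (simp add: interaction_def)
qed

lemma interaction_self: "interaction \<Omega> p u u = Lpow (2 * p) \<Omega> u"
  by (simp add: interaction_def Lpow_def flip: powr_add)

lemma interaction_tendsto:
  fixes u v :: "nat \<Rightarrow> 'a::euclidean_space \<Rightarrow> real"
  assumes p: "0 < p"
    and u: "\<And>n. u n \<in> borel_measurable (lebesgue_on \<Omega>)" "u' \<in> borel_measurable (lebesgue_on \<Omega>)"
    and v: "\<And>n. v n \<in> borel_measurable (lebesgue_on \<Omega>)" "v' \<in> borel_measurable (lebesgue_on \<Omega>)"
    and G: "integrable (lebesgue_on \<Omega>) G" "AE x in lebesgue_on \<Omega>. \<forall>n. norm (u n x) powr (2 * p) \<le> G x"
      "AE x in lebesgue_on \<Omega>. (\<lambda>n. u n x) \<longlonglongrightarrow> u' x"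
    and F: "integrable (lebesgue_on \<Omega>) F" "AE x in lebesgue_on \<Omega>. \<forall>n. norm (v n x) powr (2 * p) \<le> F x"
      "AE x in lebesgue_on \<Omega>. (\<lambda>n. v n x) \<longlonglongrightarrow> v' x"
  shows "(\<lambda>n. interaction \<Omega> p (u n) (v n)) \<longlonglongrightarrow> interaction \<Omega> p u' v'"
  unfolding interaction_def
proof (rule integral_dominated_convergence)
  note [measurable] = u v
  show "(\<lambda>x. \<bar>u' x\<bar> powr p * \<bar>v' x\<bar> powr p) \<in> borel_measurable (lebesgue_on \<Omega>)" by measurable
  show "(\<lambda>x. \<bar>u n x\<bar> powr p * \<bar>v n x\<bar> powr p) \<in> borel_measurable (lebesgue_on \<Omega>)" for n by measurable
  show "integrable (lebesgue_on \<Omega>) (\<lambda>x. G x + F x)" using G F by simp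
  show "AE x in lebesgue_on \<Omega>. (\<lambda>n. \<bar>u n x\<bar> powr p * \<bar>v n x\<bar> powr p) \<longlonglongrightarrow> \<bar>u' x\<bar> powr p * \<bar>v' x\<bar> powr p"
    using G(3) F(3)
  proof eventually_elim
    case (elim x)
    show ?case using p by (intro tendsto_mult tendsto_powr' tendsto_rabs elim tendsto_const) auto
  qed
  show "AE x in lebesgue_on \<Omega>. norm (\<bar>u n x\<bar> powr p * \<bar>v n x\<bar> powr p) \<le> G x + F x" for n
    using G(2) F(2)
  proof eventually_elim
    case (elim x)
    have "\<bar>u n x\<bar> powr p * \<bar>v n x\<bar> powr p \<le> \<bar>u n x\<bar> powr (2 * p) + \<bar>v n x\<bar> powr (2 * p)"
      by (rule interaction_integrand_le[OF p])
    also have "\<dots> \<le> G x + F x" using elim by (intro add_mono) auto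
    finally show ?case by simp
  qed
qed

text \<open>Up to the factor \<open>p\<close>, the derivative of \<open>interaction \<Omega> p u w\<close>
  when \<open>u\<close> moves in the direction \<open>v\<close>.\<close>

definition interaction_deriv ::
  "'a::euclidean_space set \<Rightarrow> real \<Rightarrow> ('a \<Rightarrow> real) \<Rightarrow> ('a \<Rightarrow> real) \<Rightarrow> ('a \<Rightarrow> real) \<Rightarrow> real" where
  "interaction_deriv \<Omega> p u v w = (\<integral>x. \<bar>w x\<bar> powr p * (\<bar>u x\<bar> powr (p - 2) * u x) * v x \<partial>lebesgue_on \<Omega>)"

text \<open>Differentiation under the integral: for \<open>|e| \<le> 1\<close> the difference quotients are at
  most \<open>2p S\<^sup>2\<^sup>p\<close>, where \<open>S\<close> is the sum of the four absolute
  values.\<close>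

lemma interaction_has_derivative:
  fixes u v w z :: "'a::euclidean_space \<Rightarrow> real"
  assumes p: "1 < p" and L: "u \<in> Lp (2 * p) \<Omega>" "v \<in> Lp (2 * p) \<Omega>" "w \<in> Lp (2 * p) \<Omega>" "z \<in> Lp (2 * p) \<Omega>"
  shows "((\<lambda>e. interaction \<Omega> p (\<lambda>x. u x + e * v x) (\<lambda>x. w x + e * z x)) has_real_derivative
     p * (interaction_deriv \<Omega> p u v w + interaction_deriv \<Omega> p w z u)) (at 0)"
proof -
  note [measurable] = LpD(1)[OF L(1)] LpD(1)[OF L(2)] LpD(1)[OF L(3)] LpD(1)[OF L(4)]
  have p0: "0 < 2 * p" using p by simp
  define S where "S x = \<bar>u x\<bar> + \<bar>v x\<bar> + \<bar>w x\<bar> + \<bar>z x\<bar>" for x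
  have S0: "0 \<le> S x" for x by (simp add: S_def)
  have abs: "(\<lambda>x. \<bar>f x\<bar>) \<in> Lp (2 * p) \<Omega>" if "f \<in> Lp (2 * p) \<Omega>" for f :: "'a \<Rightarrow> real"
    using that by (auto simp: Lp_def)
  have add: "(\<lambda>x. f x + g x) \<in> Lp (2 * p) \<Omega>" if "f \<in> Lp (2 * p) \<Omega>" "g \<in> Lp (2 * p) \<Omega>" for f g :: "'a \<Rightarrow> real"
    using Lp_lincomb(1)[OF p0 that, of 1 1] by simp
  have SL: "S \<in> Lp (2 * p) \<Omega>" unfolding S_def[abs_def] by (intro add abs L)
  have iS: "integrable (lebesgue_on \<Omega>) (\<lambda>x. 2 * p * S x powr (2 * p))"
    using LpD(2)[OF SL] S0 by simp
  note [measurable] = LpD(1)[OF SL]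
  let ?g = "\<lambda>x e. \<bar>u x + e * v x\<bar> powr p * \<bar>w x + e * z x\<bar> powr p"
  let ?g1 = "\<lambda>x e. \<bar>w x + e * z x\<bar> powr p * (\<bar>u x + e * v x\<bar> powr (p - 2) * (u x + e * v x)) * v x"
  let ?g2 = "\<lambda>x e. \<bar>u x + e * v x\<bar> powr p * (\<bar>w x + e * z x\<bar> powr (p - 2) * (w x + e * z x)) * z x"
  have der: "(?g x has_real_derivative p * (?g1 x e + ?g2 x e)) (at e)" for x e
  proof -
    have 1: "((\<lambda>e. \<bar>u x + e * v x\<bar> powr p) has_real_derivative p * (\<bar>u x + e * v x\<bar> powr (p - 2) * (u x + e * v x)) * v x) (at e)"
      by (rule DERIV_chain2[OF abs_powr_has_derivative[OF p]]) (auto intro!: derivative_eq_intros)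
    have 2: "((\<lambda>e. \<bar>w x + e * z x\<bar> powr p) has_real_derivative p * (\<bar>w x + e * z x\<bar> powr (p - 2) * (w x + e * z x)) * z x) (at e)"
      by (rule DERIV_chain2[OF abs_powr_has_derivative[OF p]]) (auto intro!: derivative_eq_intros)
    show ?thesis
      by (rule DERIV_cong[OF DERIV_mult[OF 1 2]]) (simp add: algebra_simps)
  qed
  have arg: "\<bar>u x + e * v x\<bar> \<le> S x" "\<bar>w x + e * z x\<bar> \<le> S x" if "\<bar>e\<bar> \<le> 1" for x e
  proof -
    have "\<bar>e * v x\<bar> \<le> \<bar>v x\<bar>" "\<bar>e * z x\<bar> \<le> \<bar>z x\<bar>" using that by (auto simp: abs_mult mult_left_le_one_le)
    then show "\<bar>u x + e * v x\<bar> \<le> S x" "\<bar>w x + e * z x\<bar> \<le> S x" unfolding S_def by auto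
  qed
  have bd: "\<bar>?g1 x e\<bar> \<le> S x powr (2 * p)" "\<bar>?g2 x e\<bar> \<le> S x powr (2 * p)" if e: "\<bar>e\<bar> \<le> 1" for x e
  proof -
    have V: "\<bar>v x\<bar> \<le> S x" "\<bar>z x\<bar> \<le> S x" by (auto simp: S_def)
    have pw: "\<bar>u x + e * v x\<bar> powr p \<le> S x powr p" "\<bar>w x + e * z x\<bar> powr p \<le> S x powr p"
      using arg[OF e, of x] p by (auto intro!: powr_mono2)
    have 1: "\<bar>?g1 x e\<bar> \<le> S x powr p * S x powr (p - 1) * S x"
      unfolding abs_mult[of _ "v x"] abs_mult[of "\<bar>w x + e * z x\<bar> powr p"]
      using pw(2) abs_powr_derivative_le[OF p arg(1)[OF e, of x]] V(1) S0[of x]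
      by (intro mult_mono) auto
    have 2: "\<bar>?g2 x e\<bar> \<le> S x powr p * S x powr (p - 1) * S x"
      unfolding abs_mult[of _ "z x"] abs_mult[of "\<bar>u x + e * v x\<bar> powr p"]
      using pw(1) abs_powr_derivative_le[OF p arg(2)[OF e, of x]] V(2) S0[of x]
      by (intro mult_mono) auto
    show "\<bar>?g1 x e\<bar> \<le> S x powr (2 * p)" "\<bar>?g2 x e\<bar> \<le> S x powr (2 * p)"
      using 1 2 unfolding powr_triple_eq[OF S0] by blast+
  qed
  have lip: "\<bar>(?g x e - ?g x 0) / e\<bar> \<le> 2 * p * S x powr (2 * p)" if e: "\<bar>e\<bar> \<le> 1" "e \<noteq> 0" for x e
  proof -
    have "\<bar>?g x e - ?g x 0\<bar> \<le> (2 * p * S x powr (2 * p)) * \<bar>e - 0\<bar>"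
    proof (rule field_differentiable_bound[of "{-1..1}" "?g x", unfolded real_norm_def])
      show "(?g x has_field_derivative p * (?g1 x t + ?g2 x t)) (at t within {-1..1})" for t
        by (rule has_field_derivative_at_within[OF der])
      show "\<bar>p * (?g1 x t + ?g2 x t)\<bar> \<le> 2 * p * S x powr (2 * p)" if "t \<in> {-1..1}" for t
      proof -
        have t: "\<bar>t\<bar> \<le> 1" using that by auto
        have "\<bar>?g1 x t + ?g2 x t\<bar> \<le> S x powr (2 * p) + S x powr (2 * p)"
          using bd[OF t, of x] by (intro order_trans[OF abs_triangle_ineq] add_mono)
        then have "p * \<bar>?g1 x t + ?g2 x t\<bar> \<le> p * (S x powr (2 * p) + S x powr (2 * p))"
          using p by (intro mult_left_mono) auto
        then show ?thesis using p by (simp add: abs_mult)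
      qed
    qed (use e in auto)
    then show ?thesis using e(2) by (simp add: pos_divide_le_eq)
  qed
  have D1: "integrable (lebesgue_on \<Omega>) (\<lambda>x. ?g1 x 0)" "integrable (lebesgue_on \<Omega>) (\<lambda>x. ?g2 x 0)"
  proof -
    have iS': "integrable (lebesgue_on \<Omega>) (\<lambda>x. S x powr (2 * p))"
      using LpD(2)[OF SL] S0 by simp
    show "integrable (lebesgue_on \<Omega>) (\<lambda>x. ?g1 x 0)"
      by (rule Bochner_Integration.integrable_bound[OF iS']) (use bd(1)[of 0] in auto)
    show "integrable (lebesgue_on \<Omega>) (\<lambda>x. ?g2 x 0)"
      by (rule Bochner_Integration.integrable_bound[OF iS']) (use bd(2)[of 0] in auto)
  qed
  let ?D = "p * (interaction_deriv \<Omega> p u v w + interaction_deriv \<Omega> p w z u)"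
  have D: "(\<integral>x. p * (?g1 x 0 + ?g2 x 0) \<partial>lebesgue_on \<Omega>) = ?D"
    using D1 by (simp add: interaction_deriv_def)
  have lin: "(\<lambda>x. f x + e * g x) \<in> Lp (2 * p) \<Omega>" if "f \<in> Lp (2 * p) \<Omega>" "g \<in> Lp (2 * p) \<Omega>" for f g :: "'a \<Rightarrow> real" and e
    using Lp_lincomb(1)[OF p0 that, of 1 e] by simp
  have int: "integrable (lebesgue_on \<Omega>) (\<lambda>x. ?g x e)" for e
    using p by (intro interaction_integrable(1) lin L) auto
  have "((\<lambda>e. (interaction \<Omega> p (\<lambda>x. u x + e * v x) (\<lambda>x. w x + e * z x)
        - interaction \<Omega> p (\<lambda>x. u x + 0 * v x) (\<lambda>x. w x + 0 * z x)) / e) \<longlongrightarrow> ?D) (at 0)"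
    unfolding tendsto_at_iff_sequentially
  proof (intro allI impI)
    fix X :: "nat \<Rightarrow> real" assume X: "\<forall>i. X i \<in> UNIV - {0}" "X \<longlonglongrightarrow> 0"
    have "\<forall>\<^sub>F n in sequentially. \<bar>X n\<bar> < 1"
      using X(2) order_tendstoD(2)[OF tendsto_rabs[OF X(2)], of 1] by simp
    then obtain M where M: "\<And>n. n \<ge> M \<Longrightarrow> \<bar>X n\<bar> < 1" by (auto simp: eventually_sequentially)
    \<comment> \<open>the dominating bound needs all terms in \<open>[-1, 1]\<close>\<close>
    define Y where "Y n = X (n + M)" for n
    have Y: "Y n \<noteq> 0" "\<bar>Y n\<bar> \<le> 1" for n using X(1) M[of "n + M"] by (auto simp: Y_def)
    have Y0: "Y \<longlonglongrightarrow> 0" unfolding Y_def using X(2) by (rule LIMSEQ_ignore_initial_segment)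
    have lim: "(\<lambda>n. \<integral>x. (?g x (Y n) - ?g x 0) / Y n \<partial>lebesgue_on \<Omega>) \<longlonglongrightarrow> (\<integral>x. p * (?g1 x 0 + ?g2 x 0) \<partial>lebesgue_on \<Omega>)"
    proof (rule integral_dominated_convergence[OF _ _ iS])
      show "AE x in lebesgue_on \<Omega>. (\<lambda>n. (?g x (Y n) - ?g x 0) / Y n) \<longlonglongrightarrow> p * (?g1 x 0 + ?g2 x 0)"
      proof (rule AE_I2)
        fix x
        have "((\<lambda>h. (?g x (0 + h) - ?g x 0) / h) \<longlongrightarrow> p * (?g1 x 0 + ?g2 x 0)) (at 0)"
          using der[of x 0] unfolding DERIV_def .
        moreover have "filterlim Y (at 0) sequentially"
          unfolding filterlim_at using Y0 Y(1) by auto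
        ultimately show "(\<lambda>n. (?g x (Y n) - ?g x 0) / Y n) \<longlonglongrightarrow> p * (?g1 x 0 + ?g2 x 0)"
          using filterlim_compose[of "\<lambda>h. (?g x (0 + h) - ?g x 0) / h" _ "at 0" Y] by simp
      qed
      show "AE x in lebesgue_on \<Omega>. norm ((?g x (Y n) - ?g x 0) / Y n) \<le> 2 * p * S x powr (2 * p)" for n
        using lip[OF Y(2,1)] by simp
    qed measurable
    have eq: "(\<integral>x. (?g x (Y n) - ?g x 0) / Y n \<partial>lebesgue_on \<Omega>) =
      (interaction \<Omega> p (\<lambda>x. u x + Y n * v x) (\<lambda>x. w x + Y n * z x)
        - interaction \<Omega> p (\<lambda>x. u x + 0 * v x) (\<lambda>x. w x + 0 * z x)) / Y n" for n
      unfolding interaction_def using int[of "Y n"] int[of 0] by simp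
    have "(\<lambda>n. (interaction \<Omega> p (\<lambda>x. u x + X (n + M) * v x) (\<lambda>x. w x + X (n + M) * z x)
        - interaction \<Omega> p (\<lambda>x. u x + 0 * v x) (\<lambda>x. w x + 0 * z x)) / X (n + M)) \<longlonglongrightarrow> ?D"
      using lim unfolding D eq unfolding Y_def .
    then show "((\<lambda>e. (interaction \<Omega> p (\<lambda>x. u x + e * v x) (\<lambda>x. w x + e * z x)
        - interaction \<Omega> p (\<lambda>x. u x + 0 * v x) (\<lambda>x. w x + 0 * z x)) / e) \<circ> X) \<longlonglongrightarrow> ?D"
      unfolding o_def by (rule LIMSEQ_offset)
  qed
  then show ?thesis by (simp add: DERIV_def)
qed

section \<open>Disjoint bumps\<close>

text \<open>Bumps on \<open>q\<close> consecutive boxes along the diagonal of a box inside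
  \<open>\<Omega>\<close>.\<close>

lemma disjoint_test_functions:
  fixes \<Omega> :: "'a::euclidean_space set"
  assumes \<Omega>: "open \<Omega>" "\<Omega> \<noteq> {}" and q: "1 \<le> q"
  obtains \<phi> :: "nat \<Rightarrow> 'a \<Rightarrow> real" where
    "\<And>h. h \<in> {1..q} \<Longrightarrow> \<phi> h \<in> Cc_infinity \<Omega>"
    "\<And>h. h \<in> {1..q} \<Longrightarrow> \<not> (AE x in lebesgue_on \<Omega>. \<phi> h x = 0)"
    "\<And>h k x. h \<in> {1..q} \<Longrightarrow> k \<in> {1..q} \<Longrightarrow> h \<noteq> k \<Longrightarrow> \<phi> h x * \<phi> k x = 0"
proof -
  obtain y where y: "y \<in> \<Omega>" using \<Omega>(2) by auto
  obtain a b where ab: "cbox a b \<subseteq> \<Omega>" "y \<in> box a b"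
    using open_contains_cbox[OF \<Omega>(1) y] by metis
  have lt: "a \<bullet> i < b \<bullet> i" if "i \<in> Basis" for i
    using ab(2) that unfolding mem_box by (meson less_trans)
  define c where "c h = a + (real h / real q) *\<^sub>R (b - a)" for h :: nat
  have c_inner: "c h \<bullet> i = a \<bullet> i + (real h / real q) * (b \<bullet> i - a \<bullet> i)" for h i
    by (simp add: c_def inner_simps)
  have mono: "c h \<bullet> i \<le> c k \<bullet> i" if "i \<in> Basis" "h \<le> k" for h k i
    using lt[OF that(1)] that(2) q by (auto simp: c_inner intro!: mult_right_mono divide_right_mono)
  have strict: "c h \<bullet> i < c k \<bullet> i" if "i \<in> Basis" "h < k" for h k i
    using lt[OF that(1)] that(2) q by (auto simp: c_inner intro!: mult_strict_right_mono divide_strict_right_mono)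
  have c0: "c 0 = a" and cq: "c q = b" using q by (auto simp: c_def)
  have sub: "cbox (c (h - 1)) (c h) \<subseteq> cbox a b" if "h \<in> {1..q}" for h
  proof
    fix x assume x: "x \<in> cbox (c (h - 1)) (c h)"
    have "a \<bullet> i \<le> x \<bullet> i \<and> x \<bullet> i \<le> b \<bullet> i" if i: "i \<in> Basis" for i
      using mono[OF i, of 0 "h - 1"] mono[OF i, of h q] x i \<open>h \<in> {1..q}\<close> unfolding c0 cq mem_box
      by (meson atLeastAtMost_iff order_trans zero_le)
    then show "x \<in> cbox a b" by (simp add: mem_box)
  qed
  define \<phi> where "\<phi> h = bump (c (h - 1)) (c h) 0" for h
  show ?thesis
  proof (rule that)
    fix h assume h: "h \<in> {1..q}"
    show "\<phi> h \<in> Cc_infinity \<Omega>"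
      unfolding \<phi>_def using sub[OF h] ab(1) by (intro bump_in_Cc) auto
    show "\<not> (AE x in lebesgue_on \<Omega>. \<phi> h x = 0)"
    proof
      assume "AE x in lebesgue_on \<Omega>. \<phi> h x = 0"
      moreover have "\<Omega> \<inter> space lebesgue \<in> sets lebesgue" using \<Omega>(1) by auto
      ultimately have AE: "AE x in lebesgue. x \<in> \<Omega> \<longrightarrow> \<phi> h x = 0"
        by (subst (asm) AE_restrict_space_iff)
      let ?B = "box (c (h - 1)) (c h)"
      have B: "?B \<subseteq> \<Omega>" using sub[OF h] ab(1) box_subset_cbox by blast
      have "AE x in lebesgue. x \<notin> ?B"
        using AE by eventually_elim (use B bump_nonzero_iff[of "c (h - 1)" "c h" 0] in \<open>auto simp: \<phi>_def\<close>)
      then have "?B \<in> null_sets lebesgue"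
        by (subst (asm) AE_iff_null_sets[symmetric]) auto
      then have "negligible ?B" by (simp add: negligible_iff_null_sets)
      then have "?B = {}" using open_not_negligible[OF open_box] by blast
      moreover have "?B \<noteq> {}" using strict[of _ "h - 1" h] h by (auto simp: box_ne_empty)
      ultimately show False by simp
    qed
  next
    fix h k x assume hk: "h \<in> {1..q}" "k \<in> {1..q}" "h \<noteq> k"
    show "\<phi> h x * \<phi> k x = 0"
    proof (rule ccontr)
      assume "\<phi> h x * \<phi> k x \<noteq> 0"
      then have x: "x \<in> box (c (h - 1)) (c h)" "x \<in> box (c (k - 1)) (c k)"
        using bump_nonzero_iff by (auto simp: \<phi>_def)
      obtain i :: 'a where i: "i \<in> Basis" using nonempty_Basis by blast
      have "c (h - 1) \<bullet> i < c k \<bullet> i" "c (k - 1) \<bullet> i < c h \<bullet> i"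
        using x i unfolding mem_box by (meson less_trans)+
      then have "\<not> k \<le> h - 1" "\<not> h \<le> k - 1"
        using mono[OF i, of k "h - 1"] mono[OF i, of h "k - 1"] by auto
      then show False using hk by auto
    qed
  qed
qed

section \<open>Subsequences of bounded sequences\<close>

lemma finite_common_subsequence:
  fixes P :: "'i \<Rightarrow> (nat \<Rightarrow> nat) \<Rightarrow> bool"
  assumes I: "finite I"
    and ex: "\<And>i s. i \<in> I \<Longrightarrow> strict_mono s \<Longrightarrow> \<exists>t :: nat \<Rightarrow> nat. strict_mono t \<and> P i (s \<circ> t)"
    and sub: "\<And>i s (t :: nat \<Rightarrow> nat). i \<in> I \<Longrightarrow> P i s \<Longrightarrow> strict_mono t \<Longrightarrow> P i (s \<circ> t)"
  obtains s where "strict_mono s" "\<And>i. i \<in> I \<Longrightarrow> P i s"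
proof -
  have "\<exists>s. strict_mono s \<and> (\<forall>i\<in>J. P i s)" if "finite J" "J \<subseteq> I" for J
    using that
  proof (induction J rule: finite_induct)
    case empty
    show ?case using strict_mono_id by auto
  next
    case (insert j J)
    then obtain s where s: "strict_mono s" "\<forall>i\<in>J. P i s" by auto
    obtain t where t: "strict_mono t" "P j (s \<circ> t)" using ex[OF _ s(1)] insert.prems by blast
    have "strict_mono (s \<circ> t)" using s(1) t(1) by (rule strict_mono_o)
    moreover have "\<forall>i\<in>insert j J. P i (s \<circ> t)" using t s(2) sub insert.prems by blast
    ultimately show ?case by blast
  qed
  from this[OF I order_refl] obtain s where "strict_mono s" "\<forall>i\<in>I. P i s" by blast
  then show ?thesis by (intro that[of s]) auto
qed

context coercive_space
begin

text \<open>Packages what replaces weak convergence: a bounded sequence has a subsequence that converges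
  almost everywhere, dominated in \<open>L\<^sup>r\<close>, with convergent norms whose limit bounds the norm
  of the limit function.\<close>

lemma weak_subsequence:
  fixes v :: "nat \<Rightarrow> 'a \<Rightarrow> real"
  assumes v: "\<And>n. v n \<in> H" and B: "\<And>n. T (v n) \<le> B"
  obtains t w m G where "strict_mono (t :: nat \<Rightarrow> nat)" "w \<in> H" "T w \<le> m" "(\<lambda>k. T (v (t k))) \<longlonglongrightarrow> m"
    "integrable (lebesgue_on \<Omega>) G"
    "AE x in lebesgue_on \<Omega>. \<forall>k. norm (v (t k) x) powr r \<le> G x"
    "AE x in lebesgue_on \<Omega>. (\<lambda>k. v (t k) x) \<longlonglongrightarrow> w x"
proof -
  obtain t1 w where t1: "strict_mono t1" "w \<in> Lp r \<Omega>" "(\<lambda>n. Lpow r \<Omega> (\<lambda>x. v (t1 n) x - w x)) \<longlonglongrightarrow> 0"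
    using bounded_subsequence[of v B] v B by blast
  have "bounded (range (\<lambda>n. T (v (t1 n))))"
    using T_nonneg[OF v] B by (intro boundedI[of _ B]) auto
  then obtain m t2 where t2: "strict_mono t2" "((\<lambda>n. T (v (t1 n))) \<circ> t2) \<longlonglongrightarrow> m"
    using bounded_imp_convergent_subsequence by blast
  have l2: "(\<lambda>n. Lpow r \<Omega> (\<lambda>x. v (t1 (t2 n)) x - w x)) \<longlonglongrightarrow> 0"
    using LIMSEQ_subseq_LIMSEQ[OF t1(3) t2(1)] by (simp add: o_def)
  have T2: "(\<lambda>n. T (v (t1 (t2 n)))) \<longlonglongrightarrow> m" using t2(2) by (simp add: o_def)
  obtain t3 G where t3: "strict_mono t3" "integrable (lebesgue_on \<Omega>) G"
    "AE x in lebesgue_on \<Omega>. \<forall>n. norm (v (t1 (t2 (t3 n))) x) powr r \<le> G x"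
    "AE x in lebesgue_on \<Omega>. (\<lambda>n. v (t1 (t2 (t3 n))) x) \<longlonglongrightarrow> w x"
    by (rule Lpow_subsequence_dominated[OF r0 H_Lp[OF v] t1(2) l2])
  have low: "w \<in> H \<and> T w \<le> m + e" if e: "e > 0" for e
  proof (rule lower_semicontinuous[OF t1(2)])
    fix \<delta> :: real assume "\<delta> > 0"
    then have "\<forall>\<^sub>F n in sequentially. Lpow r \<Omega> (\<lambda>x. v (t1 (t2 n)) x - w x) < \<delta>"
      by (rule order_tendstoD(2)[OF l2])
    moreover have "\<forall>\<^sub>F n in sequentially. T (v (t1 (t2 n))) < m + e"
      using order_tendstoD(2)[OF T2] e by simp
    ultimately have "\<forall>\<^sub>F n in sequentially. Lpow r \<Omega> (\<lambda>x. v (t1 (t2 n)) x - w x) < \<delta> \<and> T (v (t1 (t2 n))) < m + e"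
      by (rule eventually_conj)
    then obtain n where "Lpow r \<Omega> (\<lambda>x. v (t1 (t2 n)) x - w x) < \<delta>" "T (v (t1 (t2 n))) < m + e"
      using eventually_happens'[OF sequentially_bot] by fast
    then show "\<exists>u\<in>H. Lpow r \<Omega> (\<lambda>x. u x - w x) \<le> \<delta> \<and> T u \<le> m + e"
      using v by (meson less_imp_le)
  qed
  have wH: "w \<in> H" using low[of 1] by simp
  have Tw: "T w \<le> m" by (rule field_le_epsilon) (use low in blast)
  show ?thesis
  proof (rule that[of "t1 \<circ> (t2 \<circ> t3)" w m G])
    show "strict_mono (t1 \<circ> (t2 \<circ> t3))" using t1(1) t2(1) t3(1) by (intro strict_mono_o)
    show "(\<lambda>k. T (v ((t1 \<circ> (t2 \<circ> t3)) k))) \<longlonglongrightarrow> m"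
      using LIMSEQ_subseq_LIMSEQ[OF T2 t3(1)] by (simp add: o_def)
  qed (use wH Tw t3 in auto)
qed

lemma zero_H: "(\<lambda>x. 0) \<in> H"
proof -
  have "(\<lambda>x::'a. 0::real) \<in> Cc_infinity \<Omega>"
    by (simp add: Cc_infinity_def Ck_const)
  then show ?thesis by (rule Cc_H)
qed

lemma T_zero: "T (\<lambda>x. 0) = 0"
  using T_eq_0_iff[OF zero_H] by simp

lemma form_zero: "u \<in> H \<Longrightarrow> form u (\<lambda>x. 0) = 0"
  using T_lincomb_sq[of u "\<lambda>x. 0" 1 1] zero_H T_zero by simp

lemma T_sq_has_derivative:
  assumes "u \<in> H" "v \<in> H"
  shows "((\<lambda>e. (T (\<lambda>x. u x + e * v x))\<^sup>2) has_real_derivative 2 * form u v) (at 0)"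
proof -
  have "(T (\<lambda>x. u x + e * v x))\<^sup>2 = (T u)\<^sup>2 + 2 * e * form u v + e\<^sup>2 * (T v)\<^sup>2" for e
    using T_lincomb_sq[OF assms, of 1 e] by simp
  then show ?thesis by (auto intro!: derivative_eq_intros)
qed

end

section \<open>The Nehari set\<close>

locale elliptic_system =
  fixes \<Omega> :: "'a::euclidean_space set" and H :: "('a \<Rightarrow> real) set" and \<kappa> p :: real
    and l q :: nat and lam :: "nat \<Rightarrow> real" and \<beta> :: "nat \<Rightarrow> nat \<Rightarrow> real" and L :: "nat \<Rightarrow> nat"
  assumes \<Omega>: "open \<Omega>" "\<Omega> \<noteq> {}" and p: "1 < p" and l: "1 \<le> l" and q: "1 \<le> q"
    and blocks: "block_decomposition l q L \<beta>"
    and coercive: "\<And>i. i \<in> {1..l} \<Longrightarrow> coercive_space \<Omega> H \<kappa> (2 * p) (lam i)"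
begin

abbreviation "T i \<equiv> shifted_norm \<Omega> (lam i)"

text \<open>The ends \<open>L h\<close> of the blocks increase, so the first end not below \<open>i\<close>
  belongs to the block that contains \<open>i\<close>.\<close>

definition blk :: "nat \<Rightarrow> nat" where "blk i = (LEAST h. i \<le> L h)"

lemma block_ends: "L 0 = 0" "L q = l" and L_less: "h < q \<Longrightarrow> L h < L (Suc h)"
  and \<beta>_sym: "i \<in> {1..l} \<Longrightarrow> j \<in> {1..l} \<Longrightarrow> \<beta> i j = \<beta> j i"
  and \<beta>_diag: "i \<in> {1..l} \<Longrightarrow> 0 < \<beta> i i"
  and \<beta>_off: "h \<in> {1..q} \<Longrightarrow> k \<in> {1..q} \<Longrightarrow> h \<noteq> k \<Longrightarrow> i \<in> block L h \<Longrightarrow> j \<in> block L k \<Longrightarrow> \<beta> i j \<le> 0"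
  using blocks by (auto simp: block_decomposition_def)

lemma L_mono:
  assumes "h \<le> k" "k \<le> q"
  shows "L h \<le> L k"
  using assms
proof (induction k rule: dec_induct)
  case (step n)
  then show ?case using L_less[of n] by auto
qed simp

lemma block_iff:
  assumes h: "h \<in> {1..q}"
  shows "i \<in> block L h \<longleftrightarrow> i \<in> {1..l} \<and> blk i = h"
proof
  assume i: "i \<in> block L h"
  then have i': "L (h - 1) < i" "i \<le> L h" by (auto simp: block_def)
  have "L h \<le> l" using L_mono[of h q] h block_ends by simp
  moreover have "blk i = h"
    unfolding blk_def
  proof (rule Least_equality)
    fix y assume y: "i \<le> L y"
    show "h \<le> y"
    proof (rule ccontr)
      assume "\<not> h \<le> y"
      then have "L y \<le> L (h - 1)" using h by (intro L_mono) auto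
      then show False using y i' by simp
    qed
  qed (rule i'(2))
  ultimately show "i \<in> {1..l} \<and> blk i = h" using i' by auto
next
  assume i: "i \<in> {1..l} \<and> blk i = h"
  have "i \<le> L q" using i block_ends by simp
  then have "i \<le> L (blk i)" unfolding blk_def by (rule LeastI)
  moreover have "\<not> i \<le> L (blk i - 1)"
    using not_less_Least[of "blk i - 1" "\<lambda>h. i \<le> L h"] i h by (auto simp: blk_def)
  ultimately show "i \<in> block L h" using i by (auto simp: block_def)
qed

lemma blk_range:
  assumes "i \<in> {1..l}"
  shows "blk i \<in> {1..q}"
proof -
  have i: "i \<le> L q" using assms block_ends by simp
  then have "i \<le> L (blk i)" unfolding blk_def by (rule LeastI)
  then have "blk i \<noteq> 0" using assms block_ends(1) by (metis atLeastAtMost_iff not_one_le_zero le_zero_eq)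
  moreover have "blk i \<le> q" unfolding blk_def using i by (rule Least_le)
  ultimately show ?thesis by simp
qed

lemma block_eq: "h \<in> {1..q} \<Longrightarrow> block L h = {i \<in> {1..l}. blk i = h}"
  using block_iff by blast

lemma block_subset: "h \<in> {1..q} \<Longrightarrow> block L h \<subseteq> {1..l}"
  using block_eq by auto

lemma finite_block: "finite (block L h)"
  by (rule finite_subset[of _ "{..L h}"]) (auto simp: block_def)

lemma block_nonempty:
  assumes "h \<in> {1..q}"
  shows "L h \<in> block L h"
  using L_less[of "h - 1"] assms by (auto simp: block_def)

lemma sum_blocks: "(\<Sum>h=1..q. \<Sum>i\<in>block L h. f i) = (\<Sum>i=1..l. f i)" for f :: "nat \<Rightarrow> real"
proof -
  have "(\<Sum>h=1..q. \<Sum>i\<in>block L h. f i) = (\<Sum>h=1..q. \<Sum>i\<in>{i \<in> {1..l}. blk i = h}. f i)"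
    by (intro sum.cong refl arg_cong[where f = "sum f"] block_eq)
  also have "\<dots> = (\<Sum>i=1..l. f i)" using blk_range by (intro sum.group) auto
  finally show ?thesis .
qed

text \<open>The squared norm of the block \<open>h\<close> and, below, the total interaction of two blocks:
  the coefficients of the fibre through \<open>u\<close>.\<close>

definition sqnorm :: "(nat \<Rightarrow> 'a \<Rightarrow> real) \<Rightarrow> nat \<Rightarrow> real" where
  "sqnorm u h = (\<Sum>i\<in>block L h. (T i (u i))\<^sup>2)"

definition coupling :: "(nat \<Rightarrow> 'a \<Rightarrow> real) \<Rightarrow> nat \<Rightarrow> nat \<Rightarrow> real" where
  "coupling u h k = (\<Sum>i\<in>block L h. \<Sum>j\<in>block L k. \<beta> i j * interaction \<Omega> p (u i) (u j))"

definition admissible :: "(nat \<Rightarrow> 'a \<Rightarrow> real) \<Rightarrow> bool" where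
  "admissible u \<longleftrightarrow> (\<forall>i\<in>{1..l}. u i \<in> H)"

abbreviation "nehari_set \<equiv> nehari \<Omega> H p l q lam \<beta> L"

lemma sqnorm_nonneg: "0 \<le> sqnorm u h"
  unfolding sqnorm_def by (intro sum_nonneg) simp

lemma block_norm_sq: "(block_norm \<Omega> lam L h u)\<^sup>2 = sqnorm u h"
  using sqnorm_nonneg[of u h] by (simp add: block_norm_def sqnorm_def)

lemma block_norm_nonzero: "block_norm \<Omega> lam L h u \<noteq> 0 \<longleftrightarrow> 0 < sqnorm u h"
  using sqnorm_nonneg[of u h] by (simp add: block_norm_def sqnorm_def less_le)

lemma coupling_sym:
  assumes "h \<in> {1..q}" "k \<in> {1..q}"
  shows "coupling u h k = coupling u k h"
proof -
  have "coupling u h k = (\<Sum>j\<in>block L k. \<Sum>i\<in>block L h. \<beta> i j * interaction \<Omega> p (u i) (u j))"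
    unfolding coupling_def by (rule sum.swap)
  also have "\<dots> = coupling u k h"
    unfolding coupling_def
  proof (intro sum.cong refl)
    fix j i assume "j \<in> block L k" "i \<in> block L h"
    then have "\<beta> i j = \<beta> j i" using \<beta>_sym block_subset assms by blast
    then show "\<beta> i j * interaction \<Omega> p (u i) (u j) = \<beta> j i * interaction \<Omega> p (u j) (u i)"
      by (simp only: interaction_commute[of \<Omega> p "u i"])
  qed
  finally show ?thesis .
qed

lemma coupling_off: "h \<in> {1..q} \<Longrightarrow> k \<in> {1..q} \<Longrightarrow> h \<noteq> k \<Longrightarrow> coupling u h k \<le> 0"
  unfolding coupling_def using \<beta>_off interaction_nonneg by (intro sum_nonpos mult_nonpos_nonneg) auto

lemma coupling_row: "(\<Sum>k=1..q. coupling u h k) = (\<Sum>i\<in>block L h. \<Sum>j=1..l. \<beta> i j * interaction \<Omega> p (u i) (u j))"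
proof -
  have "(\<Sum>k=1..q. coupling u h k) = (\<Sum>i\<in>block L h. \<Sum>k=1..q. \<Sum>j\<in>block L k. \<beta> i j * interaction \<Omega> p (u i) (u j))"
    unfolding coupling_def by (rule sum.swap)
  then show ?thesis by (simp only: sum_blocks)
qed

lemma nehari_iff:
  "u \<in> nehari_set \<longleftrightarrow> admissible u \<and> (\<forall>h\<in>{1..q}. 0 < sqnorm u h \<and> (\<Sum>k=1..q. coupling u h k) = sqnorm u h)"
  unfolding nehari_def mem_Collect_eq admissible_def block_derivative_def block_norm_sq block_norm_nonzero coupling_row[symmetric]
  by auto

lemma energy_eq: "energy \<Omega> p l lam \<beta> u = 1 / 2 * (\<Sum>h=1..q. sqnorm u h) - 1 / (2 * p) * (\<Sum>h=1..q. \<Sum>k=1..q. coupling u h k)"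
  unfolding energy_def sqnorm_def sum_blocks coupling_row by (simp only: sum_blocks)

lemma energy_nehari:
  assumes "u \<in> nehari_set"
  shows "energy \<Omega> p l lam \<beta> u = (1 / 2 - 1 / (2 * p)) * (\<Sum>h=1..q. sqnorm u h)"
proof -
  have "(\<Sum>h=1..q. \<Sum>k=1..q. coupling u h k) = (\<Sum>h=1..q. sqnorm u h)"
    using assms by (intro sum.cong) (auto simp: nehari_iff)
  then show ?thesis by (simp add: energy_eq left_diff_distrib)
qed

definition scaled :: "(nat \<Rightarrow> real) \<Rightarrow> (nat \<Rightarrow> 'a \<Rightarrow> real) \<Rightarrow> nat \<Rightarrow> 'a \<Rightarrow> real" where
  "scaled s u i x = s (blk i) * u i x"

lemma sqnorm_scaled:
  assumes "admissible u" "h \<in> {1..q}"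
  shows "sqnorm (scaled s u) h = sqnorm u h * (s h)\<^sup>2"
  unfolding sqnorm_def sum_distrib_right
proof (intro sum.cong refl)
  fix i assume i: "i \<in> block L h"
  then have i': "i \<in> {1..l}" "blk i = h" using block_iff[OF assms(2)] by auto
  have "T i (\<lambda>x. s h * u i x) = \<bar>s h\<bar> * T i (u i)"
    using assms(1) i' by (intro coercive_space.T_scale[OF coercive]) (auto simp: admissible_def)
  then show "(T i (scaled s u i))\<^sup>2 = (T i (u i))\<^sup>2 * (s h)\<^sup>2"
    using i' by (simp add: scaled_def[abs_def] power_mult_distrib mult.commute)
qed

lemma coupling_scaled:
  assumes hk: "h \<in> {1..q}" "k \<in> {1..q}" and s: "0 < s h" "0 < s k"
  shows "coupling (scaled s u) h k = coupling u h k * (s h powr p * s k powr p)"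
  unfolding coupling_def sum_distrib_right
proof (intro sum.cong refl)
  fix i j assume "i \<in> block L h" "j \<in> block L k"
  then have ij: "blk i = h" "blk j = k" using block_iff[OF hk(1)] block_iff[OF hk(2)] by auto
  show "\<beta> i j * interaction \<Omega> p (scaled s u i) (scaled s u j) = \<beta> i j * interaction \<Omega> p (u i) (u j) * (s h powr p * s k powr p)"
    using interaction_scale[of \<Omega> p "s h" "u i" "s k" "u j"] s ij by (simp add: scaled_def[abs_def])
qed

lemma energy_scaled:
  assumes u: "admissible u" and s: "\<And>h. h \<in> {1..q} \<Longrightarrow> 0 < s h"
  shows "energy \<Omega> p l lam \<beta> (scaled s u) = fibre p {1..q} (sqnorm u) (coupling u) s"
proof -
  have "(\<Sum>h=1..q. sqnorm (scaled s u) h) = (\<Sum>h=1..q. sqnorm u h * (s h)\<^sup>2)"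
    by (intro sum.cong refl sqnorm_scaled u)
  moreover have "(\<Sum>h=1..q. \<Sum>k=1..q. coupling (scaled s u) h k) = (\<Sum>h=1..q. \<Sum>k=1..q. coupling u h k * (s h powr p * s k powr p))"
    by (intro sum.cong refl coupling_scaled s)
  ultimately show ?thesis by (simp add: energy_eq fibre_def)
qed

lemma admissible_scaled: "admissible u \<Longrightarrow> admissible (scaled s u)"
  unfolding admissible_def scaled_def[abs_def]
  using coercive_space.scale[OF coercive] by blast

lemma scaled_in_nehari:
  assumes u: "admissible u" and pos: "\<And>h. h \<in> {1..q} \<Longrightarrow> 0 < sqnorm u h"
    and crit: "fibre_critical p {1..q} (sqnorm u) (coupling u) s"
  shows "scaled s u \<in> nehari_set"
proof -
  have s: "0 < s h" "sqnorm u h * (s h)\<^sup>2 = (\<Sum>k=1..q. coupling u h k * (s h powr p * s k powr p))" if "h \<in> {1..q}" for h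
    using crit that by (auto simp: fibre_critical_def)
  have "(\<Sum>k=1..q. coupling (scaled s u) h k) = sqnorm (scaled s u) h" if h: "h \<in> {1..q}" for h
  proof -
    have "(\<Sum>k=1..q. coupling (scaled s u) h k) = (\<Sum>k=1..q. coupling u h k * (s h powr p * s k powr p))"
      by (intro sum.cong refl coupling_scaled h s(1))
    then show ?thesis using s(2)[OF h] sqnorm_scaled[OF u h] by simp
  qed
  moreover have "0 < sqnorm (scaled s u) h" if h: "h \<in> {1..q}" for h
    using sqnorm_scaled[OF u h, of s] pos[OF h] s(1)[OF h] by simp
  ultimately show ?thesis using admissible_scaled[OF u] by (auto simp: nehari_iff)
qed

lemma fibre_critical_point:
  assumes pos: "\<And>h. h \<in> {1..q} \<Longrightarrow> 0 < sqnorm u h" and row: "\<And>h. h \<in> {1..q} \<Longrightarrow> 0 < (\<Sum>k=1..q. coupling u h k)"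
  obtains s where "fibre_critical p {1..q} (sqnorm u) (coupling u) s"
  by (rule fibre_critical_exists[where I = "{1..q}" and p = p and a = "sqnorm u" and b = "coupling u"])
    (use p coupling_sym coupling_off pos row in auto)

text \<open>Put test functions with disjoint supports into one component of each block. Then
  \<open>coupling\<close> is diagonal with positive entries, so the fibre has a critical point.\<close>

lemma nehari_nonempty: "nehari_set \<noteq> {}"
proof -
  obtain \<phi> :: "nat \<Rightarrow> 'a \<Rightarrow> real" where \<phi>: "\<And>h. h \<in> {1..q} \<Longrightarrow> \<phi> h \<in> Cc_infinity \<Omega>"
    "\<And>h. h \<in> {1..q} \<Longrightarrow> \<not> (AE x in lebesgue_on \<Omega>. \<phi> h x = 0)"
    "\<And>h k x. h \<in> {1..q} \<Longrightarrow> k \<in> {1..q} \<Longrightarrow> h \<noteq> k \<Longrightarrow> \<phi> h x * \<phi> k x = 0"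
    by (rule disjoint_test_functions[OF \<Omega> q]) blast
  \<comment> \<open>only the last component of each block is nonzero\<close>
  define u where "u i = (if i = L (blk i) then \<phi> (blk i) else (\<lambda>x. 0))" for i
  have \<phi>H: "\<phi> h \<in> H" if h: "h \<in> {1..q}" for h
    using coercive_space.Cc_H[OF coercive[of 1] \<phi>(1)[OF h]] l by simp
  have adm: "admissible u"
    unfolding admissible_def u_def
    using \<phi>H blk_range coercive_space.zero_H[OF coercive[of 1]] l by auto
  have Lh: "L h \<in> {1..l}" "blk (L h) = h" if "h \<in> {1..q}" for h
    using block_nonempty[OF that] block_iff[OF that] by auto
  have uL: "u (L h) = \<phi> h" if "h \<in> {1..q}" for h
    using Lh[OF that] by (simp add: u_def)
  have u0: "u i = (\<lambda>x. 0)" if "h \<in> {1..q}" "i \<in> block L h" "i \<noteq> L h" for h i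
    using that block_iff[OF that(1)] by (auto simp: u_def)
  have int0: "interaction \<Omega> p (\<lambda>x. 0) w = 0" "interaction \<Omega> p w (\<lambda>x. 0) = 0" for w
    by (simp_all add: interaction_def)
  have coupling_eq: "coupling u h k = \<beta> (L h) (L k) * interaction \<Omega> p (\<phi> h) (\<phi> k)" if hk: "h \<in> {1..q}" "k \<in> {1..q}" for h k
  proof -
    have "coupling u h k = (\<Sum>i\<in>block L h. if i = L h then \<beta> (L h) (L k) * interaction \<Omega> p (\<phi> h) (\<phi> k) else 0)"
      unfolding coupling_def
    proof (intro sum.cong refl)
      fix i assume i: "i \<in> block L h"
      have "(\<Sum>j\<in>block L k. \<beta> i j * interaction \<Omega> p (u i) (u j)) = (\<Sum>j\<in>block L k. if j = L k then \<beta> i (L k) * interaction \<Omega> p (u i) (\<phi> k) else 0)"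
        using u0[OF hk(2)] uL[OF hk(2)] by (intro sum.cong) (auto simp: int0)
      also have "\<dots> = \<beta> i (L k) * interaction \<Omega> p (u i) (\<phi> k)"
        using block_nonempty[OF hk(2)] finite_block by simp
      finally show "(\<Sum>j\<in>block L k. \<beta> i j * interaction \<Omega> p (u i) (u j))
          = (if i = L h then \<beta> (L h) (L k) * interaction \<Omega> p (\<phi> h) (\<phi> k) else 0)"
        using u0[OF hk(1) i] uL[OF hk(1)] by (auto simp: int0)
    qed
    then show ?thesis using block_nonempty[OF hk(1)] finite_block by simp
  qed
  have sqnorm_pos: "0 < sqnorm u h" if h: "h \<in> {1..q}" for h
  proof -
    interpret c: coercive_space \<Omega> H \<kappa> "2 * p" "lam (L h)" by (rule coercive[OF Lh(1)[OF h]])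
    have "T (L h) (\<phi> h) \<noteq> 0" using c.T_eq_0_iff[OF \<phi>H[OF h]] \<phi>(2)[OF h] by blast
    then have "0 < (T (L h) (u (L h)))\<^sup>2" using uL[OF h] by simp
    also have "\<dots> \<le> sqnorm u h"
      unfolding sqnorm_def by (intro member_le_sum[OF block_nonempty[OF h] _ finite_block]) simp
    finally show ?thesis .
  qed
  have row: "0 < (\<Sum>k=1..q. coupling u h k)" if h: "h \<in> {1..q}" for h
  proof -
    interpret c: coercive_space \<Omega> H \<kappa> "2 * p" "lam (L h)" by (rule coercive[OF Lh(1)[OF h]])
    have "coupling u h k = (if k = h then \<beta> (L h) (L h) * interaction \<Omega> p (\<phi> h) (\<phi> h) else 0)" if k: "k \<in> {1..q}" for k
    proof (cases "k = h")
      case False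
      have "\<bar>\<phi> h x\<bar> powr p * \<bar>\<phi> k x\<bar> powr p = 0" for x
        using \<phi>(3)[OF h k, of x] False p by (auto simp flip: powr_mult abs_mult)
      then have "interaction \<Omega> p (\<phi> h) (\<phi> k) = 0" unfolding interaction_def by (simp only: Bochner_Integration.integral_zero)
      then show ?thesis using False coupling_eq[OF h k] by simp
    qed (use coupling_eq[OF h h] in simp)
    then have "(\<Sum>k=1..q. coupling u h k) = (\<Sum>k=1..q. if k = h then \<beta> (L h) (L h) * interaction \<Omega> p (\<phi> h) (\<phi> h) else 0)"
      by (intro sum.cong) auto
    also have "\<dots> = \<beta> (L h) (L h) * interaction \<Omega> p (\<phi> h) (\<phi> h)" using h by simp
    also have "\<dots> > 0"
    proof (rule mult_pos_pos[OF \<beta>_diag[OF Lh(1)[OF h]]])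
      have "Lpow (2 * p) \<Omega> (\<phi> h) \<noteq> 0"
      proof
        assume "Lpow (2 * p) \<Omega> (\<phi> h) = 0"
        then have "AE x in lebesgue_on \<Omega>. norm (\<phi> h x) powr (2 * p) = 0"
          unfolding Lpow_def using integral_nonneg_eq_0_iff_AE[OF LpD(2)[OF c.H_Lp[OF \<phi>H[OF h]]]] by simp
        then have "AE x in lebesgue_on \<Omega>. \<phi> h x = 0" by eventually_elim simp
        then show False using \<phi>(2)[OF h] by blast
      qed
      then show "0 < interaction \<Omega> p (\<phi> h) (\<phi> h)"
        unfolding interaction_self using Lpow_nonneg[of "2 * p" \<Omega> "\<phi> h"] by simp
    qed
    finally show ?thesis .
  qed
  obtain s where "fibre_critical p {1..q} (sqnorm u) (coupling u) s" using fibre_critical_point[OF sqnorm_pos row] .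
  then show ?thesis using scaled_in_nehari[OF adm sqnorm_pos] by blast
qed

text \<open>The bounded embedding controls the interactions within a block.\<close>

lemma coupling_diag_le:
  obtains K where "0 < K" "\<And>u h. admissible u \<Longrightarrow> h \<in> {1..q} \<Longrightarrow> coupling u h h \<le> K * sqnorm u h powr p"
proof -
  have "\<exists>C\<ge>0. \<forall>v\<in>H. Lpow (2 * p) \<Omega> v \<le> C * T i v powr (2 * p)" if "i \<in> {1..l}" for i
    using coercive_space.embedding[OF coercive[OF that]] by metis
  then obtain C where C: "\<And>i. i \<in> {1..l} \<Longrightarrow> 0 \<le> C i"
    "\<And>i v. i \<in> {1..l} \<Longrightarrow> v \<in> H \<Longrightarrow> Lpow (2 * p) \<Omega> v \<le> C i * T i v powr (2 * p)" by metis
  define K where "K = 1 + (\<Sum>i=1..l. \<Sum>j=1..l. \<bar>\<beta> i j\<bar> * (C i + C j))"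
  have nn: "0 \<le> \<bar>\<beta> i j\<bar> * (C i + C j)" if "i \<in> {1..l}" "j \<in> {1..l}" for i j
    using C(1) that by simp
  have K: "0 < K" unfolding K_def using nn by (intro add_pos_nonneg sum_nonneg) auto
  have "coupling u h h \<le> K * sqnorm u h powr p" if u: "admissible u" and h: "h \<in> {1..q}" for u h
  proof -
    have Lp: "Lpow (2 * p) \<Omega> (u i) \<le> C i * sqnorm u h powr p" if i: "i \<in> block L h" for i
    proof -
      have i': "i \<in> {1..l}" using block_subset[OF h] i by auto
      have uH: "u i \<in> H" using u i' by (auto simp: admissible_def)
      have T0: "0 \<le> T i (u i)" by (rule coercive_space.T_nonneg[OF coercive[OF i'] uH])
      have "T i (u i) powr (2 * p) = ((T i (u i))\<^sup>2) powr p"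
        using T0 by (simp add: power2_eq_square powr_mult flip: powr_add)
      also have "\<dots> \<le> sqnorm u h powr p"
        unfolding sqnorm_def using p i finite_block by (intro powr_mono2 member_le_sum) auto
      finally have "C i * T i (u i) powr (2 * p) \<le> C i * sqnorm u h powr p"
        using C(1)[OF i'] by (rule mult_left_mono)
      then show ?thesis using C(2)[OF i' uH] by simp
    qed
    have "coupling u h h \<le> (\<Sum>i\<in>block L h. \<Sum>j\<in>block L h. (\<bar>\<beta> i j\<bar> * (C i + C j)) * sqnorm u h powr p)"
      unfolding coupling_def
    proof (intro sum_mono)
      fix i j assume ij: "i \<in> block L h" "j \<in> block L h"
      then have ij': "i \<in> {1..l}" "j \<in> {1..l}" using block_subset[OF h] by auto
      have uL: "u i \<in> Lp (2 * p) \<Omega>" "u j \<in> Lp (2 * p) \<Omega>"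
        using u ij' coercive_space.H_Lp[OF coercive[OF ij'(1)]] by (auto simp: admissible_def)
      have "interaction \<Omega> p (u i) (u j) \<le> (C i + C j) * sqnorm u h powr p"
        using interaction_integrable(2)[OF _ uL] p Lp[OF ij(1)] Lp[OF ij(2)] by (simp add: distrib_right)
      then have "\<bar>\<beta> i j\<bar> * interaction \<Omega> p (u i) (u j) \<le> \<bar>\<beta> i j\<bar> * ((C i + C j) * sqnorm u h powr p)"
        by (rule mult_left_mono) simp
      moreover have "\<beta> i j * interaction \<Omega> p (u i) (u j) \<le> \<bar>\<beta> i j\<bar> * interaction \<Omega> p (u i) (u j)"
        using interaction_nonneg by (intro mult_right_mono) auto
      ultimately show "\<beta> i j * interaction \<Omega> p (u i) (u j) \<le> (\<bar>\<beta> i j\<bar> * (C i + C j)) * sqnorm u h powr p"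
        by (simp add: mult.assoc)
    qed
    also have "\<dots> = (\<Sum>i\<in>block L h. \<Sum>j\<in>block L h. \<bar>\<beta> i j\<bar> * (C i + C j)) * sqnorm u h powr p"
      by (simp add: sum_distrib_right)
    also have "\<dots> \<le> K * sqnorm u h powr p"
    proof (rule mult_right_mono)
      have "(\<Sum>i\<in>block L h. \<Sum>j\<in>block L h. \<bar>\<beta> i j\<bar> * (C i + C j)) \<le> (\<Sum>i=1..l. \<Sum>j=1..l. \<bar>\<beta> i j\<bar> * (C i + C j))"
        using block_subset[OF h] nn
        by (intro order_trans[OF sum_mono[OF sum_mono2] sum_mono2] sum_nonneg) auto
      then show "(\<Sum>i\<in>block L h. \<Sum>j\<in>block L h. \<bar>\<beta> i j\<bar> * (C i + C j)) \<le> K" by (simp add: K_def)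
    qed simp
    finally show ?thesis .
  qed
  with K show ?thesis by (rule that)
qed

lemma coupling_diag_ge_row: 
  assumes "h \<in> {1..q}"
  shows "(\<Sum>k=1..q. coupling u h k) \<le> coupling u h h"
proof -
  have "(\<Sum>k=1..q. coupling u h k) = coupling u h h + (\<Sum>k\<in>{1..q} - {h}. coupling u h k)"
    using assms by (intro sum.remove) auto
  moreover have "(\<Sum>k\<in>{1..q} - {h}. coupling u h k) \<le> 0"
    using coupling_off assms by (intro sum_nonpos) auto
  ultimately show ?thesis by simp
qed

text \<open>The interactions with other blocks are nonpositive, so \<open>a \<le> K a\<^sup>p\<close> for the
  squared norm \<open>a\<close> of a block.\<close>

lemma nehari_lower_bound:
  obtains d where "0 < d" "\<And>u h. u \<in> nehari_set \<Longrightarrow> h \<in> {1..q} \<Longrightarrow> d \<le> sqnorm u h"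
proof -
  obtain K where K: "0 < K" "\<And>u h. admissible u \<Longrightarrow> h \<in> {1..q} \<Longrightarrow> coupling u h h \<le> K * sqnorm u h powr p"
    using coupling_diag_le by blast
  define d where "d = (1 / K) powr (1 / (p - 1))"
  have "d \<le> sqnorm u h" if u: "u \<in> nehari_set" and h: "h \<in> {1..q}" for u h
  proof -
    have A: "0 < sqnorm u h" "sqnorm u h = (\<Sum>k=1..q. coupling u h k)" "admissible u" using u h by (auto simp: nehari_iff)
    have "sqnorm u h \<le> K * sqnorm u h powr p" using A(2) coupling_diag_ge_row[OF h, of u] K(2)[OF A(3) h] by simp
    also have "sqnorm u h powr p = sqnorm u h * sqnorm u h powr (p - 1)" using A(1) powr_mult_base[of "sqnorm u h" "p - 1"] by simp
    finally have "1 / K \<le> sqnorm u h powr (p - 1)" using A(1) K(1) by (simp add: field_simps)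
    then have "d \<le> (sqnorm u h powr (p - 1)) powr (1 / (p - 1))"
      unfolding d_def using p K(1) by (intro powr_mono2) auto
    also have "\<dots> = sqnorm u h" using p A(1) by (simp add: powr_powr)
    finally show ?thesis .
  qed
  moreover have "0 < d" using K(1) by (simp add: d_def)
  ultimately show ?thesis by (intro that[of d])
qed

end

section \<open>Minimisers on the Nehari set\<close>

context elliptic_system
begin

text \<open>The limit \<open>w\<close> of a minimising sequence satisfies the Nehari constraints up to an
  inequality that makes the factors \<open>t\<close> of its projection at most \<open>1\<close>, so projecting
  does not raise the energy.\<close>

lemma minimizer_exists:
  obtains u where "u \<in> nehari_set" "\<And>w. w \<in> nehari_set \<Longrightarrow> (\<Sum>h=1..q. sqnorm u h) \<le> (\<Sum>h=1..q. sqnorm w h)"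
proof -
  define A where "A u = (\<Sum>h=1..q. sqnorm u h)" for u
  have A0: "0 \<le> A u" for u unfolding A_def by (intro sum_nonneg sqnorm_nonneg)
  define c where "c = Inf (A ` nehari_set)"
  have bdd: "bdd_below (A ` nehari_set)" using A0 by (intro bdd_belowI[of _ 0]) auto
  have c_le: "c \<le> A w" if "w \<in> nehari_set" for w
    unfolding c_def using that bdd by (intro cInf_lower) auto
  have "\<exists>u\<in>nehari_set. A u < c + inverse (real (Suc n))" for n
  proof -
    have "\<exists>y\<in>A ` nehari_set. y < c + inverse (real (Suc n))"
      unfolding c_def using nehari_nonempty by (intro cInf_lessD) auto
    then show ?thesis by blast
  qed
  then obtain U where U: "\<And>n. U n \<in> nehari_set" "\<And>n. A (U n) < c + inverse (real (Suc n))" by metis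
  have Ulim: "(\<lambda>n. A (U n)) \<longlonglongrightarrow> c"
  proof (rule tendsto_sandwich)
    show "\<forall>\<^sub>F n in sequentially. c \<le> A (U n)" using c_le[OF U(1)] by simp
    show "\<forall>\<^sub>F n in sequentially. A (U n) \<le> c + inverse (real (Suc n))"
      using U(2) by (intro always_eventually allI less_imp_le)
    show "(\<lambda>n. c + inverse (real (Suc n))) \<longlonglongrightarrow> c"
      using tendsto_add[OF tendsto_const LIMSEQ_inverse_real_of_nat, of c] by simp
  qed simp
  have UH: "U n i \<in> H" if "i \<in> {1..l}" for n i
    using U(1)[of n] that by (auto simp: nehari_iff admissible_def)
  have A_eq: "A u = (\<Sum>i=1..l. (T i (u i))\<^sup>2)" for u
    unfolding A_def sqnorm_def by (rule sum_blocks)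
  have UB: "T i (U n i) \<le> sqrt (c + 1)" if i: "i \<in> {1..l}" for i n
  proof (rule real_le_rsqrt)
    have "(T i (U n i))\<^sup>2 \<le> A (U n)"
      unfolding A_eq using i by (intro member_le_sum) auto
    also have "\<dots> \<le> c + inverse (real (Suc n))" using U(2)[of n] by simp
    also have "\<dots> \<le> c + 1" by (simp add: inverse_le_1_iff)
    finally show "(T i (U n i))\<^sup>2 \<le> c + 1" .
  qed
  \<comment> \<open>the property of component \<open>i\<close> that has to hold along a common subsequence; it passes to subsequences\<close>
  define P where "P i s \<longleftrightarrow> (\<exists>w m G. w \<in> H \<and> T i w \<le> m \<and> (\<lambda>k. T i (U (s k) i)) \<longlonglongrightarrow> m \<and>
    integrable (lebesgue_on \<Omega>) G \<and> (AE x in lebesgue_on \<Omega>. \<forall>k. norm (U (s k) i x) powr (2 * p) \<le> G x) \<and>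
    (AE x in lebesgue_on \<Omega>. (\<lambda>k. U (s k) i x) \<longlonglongrightarrow> w x))" for i and s :: "nat \<Rightarrow> nat"
  obtain s where s: "strict_mono s" "\<And>i. i \<in> {1..l} \<Longrightarrow> P i s"
  proof (rule finite_common_subsequence[of "{1..l}" P])
    show "\<exists>t. strict_mono t \<and> P i (s \<circ> t)" if i: "i \<in> {1..l}" for i and s :: "nat \<Rightarrow> nat"
    proof -
      obtain t w m G where "strict_mono (t :: nat \<Rightarrow> nat)" "w \<in> H" "T i w \<le> m" "(\<lambda>k. T i (U (s (t k)) i)) \<longlonglongrightarrow> m"
        "integrable (lebesgue_on \<Omega>) G"
        "AE x in lebesgue_on \<Omega>. \<forall>k. norm (U (s (t k)) i x) powr (2 * p) \<le> G x"
        "AE x in lebesgue_on \<Omega>. (\<lambda>k. U (s (t k)) i x) \<longlonglongrightarrow> w x"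
        using coercive_space.weak_subsequence[OF coercive[OF i], of "\<lambda>n. U (s n) i" "sqrt (c + 1)"] UH[OF i] UB[OF i] by blast
      then show ?thesis unfolding P_def o_def by blast
    qed
    show "P i (s \<circ> t)" if Ps: "P i s" and t: "strict_mono t" for i s and t :: "nat \<Rightarrow> nat"
    proof -
      obtain w m G where w: "w \<in> H" "T i w \<le> m" "(\<lambda>k. T i (U (s k) i)) \<longlonglongrightarrow> m"
        "integrable (lebesgue_on \<Omega>) G" "AE x in lebesgue_on \<Omega>. \<forall>k. norm (U (s k) i x) powr (2 * p) \<le> G x"
        "AE x in lebesgue_on \<Omega>. (\<lambda>k. U (s k) i x) \<longlonglongrightarrow> w x"
        using Ps unfolding P_def by blast
      have 1: "(\<lambda>k. T i (U (s (t k)) i)) \<longlonglongrightarrow> m"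
        using LIMSEQ_subseq_LIMSEQ[OF w(3) t] by (simp add: o_def)
      have 2: "AE x in lebesgue_on \<Omega>. \<forall>k. norm (U (s (t k)) i x) powr (2 * p) \<le> G x"
        using w(5) by eventually_elim blast
      have 3: "AE x in lebesgue_on \<Omega>. (\<lambda>k. U (s (t k)) i x) \<longlonglongrightarrow> w x"
        using w(6)
      proof eventually_elim
        case (elim x)
        show ?case using LIMSEQ_subseq_LIMSEQ[OF elim t] by (simp add: o_def)
      qed
      show ?thesis unfolding P_def o_def using w(1,2,4) 1 2 3 by blast
    qed
  qed auto
  have "\<forall>i\<in>{1..l}. \<exists>w m G. w \<in> H \<and> T i w \<le> m \<and> (\<lambda>k. T i (U (s k) i)) \<longlonglongrightarrow> m \<and>
    integrable (lebesgue_on \<Omega>) G \<and> (AE x in lebesgue_on \<Omega>. \<forall>k. norm (U (s k) i x) powr (2 * p) \<le> G x) \<and>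
    (AE x in lebesgue_on \<Omega>. (\<lambda>k. U (s k) i x) \<longlonglongrightarrow> w x)"
    using s(2) unfolding P_def by blast
  then obtain w m G where w: "\<And>i. i \<in> {1..l} \<Longrightarrow> w i \<in> H" "\<And>i. i \<in> {1..l} \<Longrightarrow> T i (w i) \<le> m i"
    "\<And>i. i \<in> {1..l} \<Longrightarrow> (\<lambda>k. T i (U (s k) i)) \<longlonglongrightarrow> m i"
    "\<And>i. i \<in> {1..l} \<Longrightarrow> integrable (lebesgue_on \<Omega>) (G i)"
    "\<And>i. i \<in> {1..l} \<Longrightarrow> AE x in lebesgue_on \<Omega>. \<forall>k. norm (U (s k) i x) powr (2 * p) \<le> G i x"
    "\<And>i. i \<in> {1..l} \<Longrightarrow> AE x in lebesgue_on \<Omega>. (\<lambda>k. U (s k) i x) \<longlonglongrightarrow> w i x"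
    unfolding bchoice_iff by (elim exE) blast
  have adm: "admissible w" using w(1) by (simp add: admissible_def)
  define B where "B h = (\<Sum>i\<in>block L h. (m i)\<^sup>2)" for h
  have sqnorm_lim: "(\<lambda>k. sqnorm (U (s k)) h) \<longlonglongrightarrow> B h" if h: "h \<in> {1..q}" for h
    unfolding sqnorm_def B_def using block_subset[OF h] by (intro tendsto_sum tendsto_power w(3)) auto
  have meas: "v \<in> borel_measurable (lebesgue_on \<Omega>)" if "v \<in> H" for v
    using coercive_space.H_Lp[OF coercive[of 1] that] l LpD(1) by force
  have coupling_lim: "(\<lambda>k. coupling (U (s k)) h h') \<longlonglongrightarrow> coupling w h h'" if h: "h \<in> {1..q}" "h' \<in> {1..q}" for h h'
    unfolding coupling_def
  proof (intro tendsto_sum tendsto_mult tendsto_const)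
    fix i j assume "i \<in> block L h" "j \<in> block L h'"
    then have ij: "i \<in> {1..l}" "j \<in> {1..l}" using block_subset h by blast+
    show "(\<lambda>k. interaction \<Omega> p (U (s k) i) (U (s k) j)) \<longlonglongrightarrow> interaction \<Omega> p (w i) (w j)"
      using p by (intro interaction_tendsto[OF _ _ _ _ _ w(4)[OF ij(1)] w(5)[OF ij(1)] w(6)[OF ij(1)] w(4)[OF ij(2)] w(5)[OF ij(2)] w(6)[OF ij(2)]]
         meas UH w(1) ij) auto
  qed
  \<comment> \<open>the Nehari constraints of the sequence survive with the limits \<open>B h\<close> in place of the squared norms of \<open>w\<close>\<close>
  have row: "(\<Sum>k=1..q. coupling w h k) = B h" if h: "h \<in> {1..q}" for h
  proof (rule LIMSEQ_unique)
    show "(\<lambda>n. \<Sum>k=1..q. coupling (U (s n)) h k) \<longlonglongrightarrow> (\<Sum>k=1..q. coupling w h k)"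
      by (intro tendsto_sum coupling_lim h)
    have "(\<Sum>k=1..q. coupling (U (s n)) h k) = sqnorm (U (s n)) h" for n
      using U(1)[of "s n"] h by (auto simp: nehari_iff)
    then show "(\<lambda>n. \<Sum>k=1..q. coupling (U (s n)) h k) \<longlonglongrightarrow> B h" using sqnorm_lim[OF h] by simp
  qed
  obtain d where d: "0 < d" "\<And>u h. u \<in> nehari_set \<Longrightarrow> h \<in> {1..q} \<Longrightarrow> d \<le> sqnorm u h"
    using nehari_lower_bound by blast
  have B_pos: "0 < B h" if h: "h \<in> {1..q}" for h
  proof -
    have "d \<le> B h" using d(2)[OF U(1) h] by (intro LIMSEQ_le_const[OF sqnorm_lim[OF h]]) auto
    then show ?thesis using d(1) by simp
  qed
  have sqnorm_le: "sqnorm w h \<le> B h" if h: "h \<in> {1..q}" for h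
    unfolding sqnorm_def B_def
  proof (intro sum_mono power_mono)
    fix i assume "i \<in> block L h"
    then have i: "i \<in> {1..l}" using block_subset[OF h] by auto
    show "T i (w i) \<le> m i" by (rule w(2)[OF i])
    show "0 \<le> T i (w i)" by (rule coercive_space.T_nonneg[OF coercive[OF i] w(1)[OF i]])
  qed
  obtain K where K: "0 < K" "\<And>u h. admissible u \<Longrightarrow> h \<in> {1..q} \<Longrightarrow> coupling u h h \<le> K * sqnorm u h powr p"
    using coupling_diag_le by blast
  have sqnorm_pos: "0 < sqnorm w h" if h: "h \<in> {1..q}" for h
  proof (rule ccontr)
    assume "\<not> 0 < sqnorm w h"
    then have "sqnorm w h = 0" using sqnorm_nonneg[of w h] by simp
    then have "coupling w h h \<le> 0" using K(2)[OF adm h] by simp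
    then show False using coupling_diag_ge_row[OF h, of w] row[OF h] B_pos[OF h] by simp
  qed
  have row_pos: "0 < (\<Sum>k=1..q. coupling w h k)" if h: "h \<in> {1..q}" for h using row[OF h] B_pos[OF h] by simp
  obtain t where t: "fibre_critical p {1..q} (sqnorm w) (coupling w) t"
    using fibre_critical_point[OF sqnorm_pos row_pos] by blast
  have t_pos: "0 < t h" if "h \<in> {1..q}" for h using t that by (auto simp: fibre_critical_def)
  \<comment> \<open>all quotients of squared norms by row sums are at most \<open>1\<close> here\<close>
  have t_le: "t h \<le> 1" if h: "h \<in> {1..q}" for h
  proof -
    have "t h powr (2 * p - 2) \<le> 1"
    proof (rule fibre_critical_bounds(2)[where I = "{1..q}" and a = "sqnorm w" and b = "coupling w" and m = 0])
      show "sqnorm w h \<le> 1 * (\<Sum>k=1..q. coupling w h k)" if "h \<in> {1..q}" for h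
        using sqnorm_le[OF that] row[OF that] by simp
    qed (use p coupling_off row_pos sqnorm_nonneg t h in auto)
    moreover have "1 < t h powr (2 * p - 2)" if "1 < t h"
      using powr_less_mono2[of "2 * p - 2" 1 "t h"] p that by simp
    ultimately show ?thesis by force
  qed
  have "A (scaled t w) \<le> (\<Sum>h=1..q. B h)"
    unfolding A_def
  proof (rule sum_mono)
    fix h assume h: "h \<in> {1..q}"
    have "sqnorm (scaled t w) h = sqnorm w h * (t h)\<^sup>2" by (rule sqnorm_scaled[OF adm h])
    also have "\<dots> \<le> sqnorm w h * 1"
      using t_pos[OF h] t_le[OF h] sqnorm_nonneg by (intro mult_left_mono power_le_one) auto
    also have "\<dots> \<le> B h" using sqnorm_le[OF h] by simp
    finally show "sqnorm (scaled t w) h \<le> B h" .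
  qed
  also have "(\<Sum>h=1..q. B h) = c"
  proof (rule LIMSEQ_unique)
    show "(\<lambda>n. A (U (s n))) \<longlonglongrightarrow> (\<Sum>h=1..q. B h)"
      unfolding A_def by (intro tendsto_sum sqnorm_lim)
    show "(\<lambda>n. A (U (s n))) \<longlonglongrightarrow> c"
      using LIMSEQ_subseq_LIMSEQ[OF Ulim s(1)] by (simp add: o_def)
  qed
  finally have le: "A (scaled t w) \<le> c" .
  show ?thesis
  proof (rule that)
    show "scaled t w \<in> nehari_set" by (rule scaled_in_nehari[OF adm sqnorm_pos t])
    show "(\<Sum>h=1..q. sqnorm (scaled t w) h) \<le> (\<Sum>h=1..q. sqnorm v h)" if "v \<in> nehari_set" for v
      using le c_le[OF that] unfolding A_def by simp
  qed
qed

lemma interaction_deriv_zero: "interaction_deriv \<Omega> p u (\<lambda>x. 0) w = 0"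
  by (simp add: interaction_deriv_def)

text \<open>All components are perturbed by multiples of \<open>d i\<close>, which is \<open>v\<close> for the
  component \<open>n\<close> and \<open>0\<close> otherwise. By symmetry of \<open>\<beta>\<close>, row
  \<open>n\<close> and column \<open>n\<close> contribute equally to the derivative of the
  interactions.\<close>

lemma minimizer_is_solution:
  assumes u: "u \<in> nehari_set"
    and min: "\<And>w. w \<in> nehari_set \<Longrightarrow> (\<Sum>h=1..q. sqnorm u h) \<le> (\<Sum>h=1..q. sqnorm w h)"
  shows "weak_solution \<Omega> H p l lam \<beta> u"
  unfolding weak_solution_def
proof (intro conjI ballI)
  have uH: "u i \<in> H" if "i \<in> {1..l}" for i using u that by (auto simp: nehari_iff admissible_def)
  then show "u i \<in> H" if "i \<in> {1..l}" for i using that .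
  fix n v assume n: "n \<in> {1..l}" and v: "v \<in> H"
  define d where "d i = (if i = n then v else (\<lambda>x. 0))" for i
  have zH: "(\<lambda>x. 0) \<in> H" by (rule coercive_space.zero_H[OF coercive[OF n]])
  have dH: "d i \<in> H" for i using v zH by (simp add: d_def)
  define w where "w e i x = u i x + e * d i x" for e :: real and i x
  have w_eq: "w e i = (\<lambda>x. u i x + e * d i x)" for e i by (simp add: w_def[abs_def])
  have w0: "w 0 = u" by (intro ext) (simp add: w_def)
  have adm: "admissible (w e)" for e
    unfolding admissible_def
  proof
    fix i assume i: "i \<in> {1..l}"
    show "w e i \<in> H"
      unfolding w_eq using coercive_space.lincomb[OF coercive[OF i] uH[OF i] dH, of 1 e i] by simp
  qed
  let ?F = "\<lambda>i. coercive_space.form \<Omega> (lam i)"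
  let ?R = "\<lambda>i j. interaction_deriv \<Omega> p (u i) (d i) (u j)"
  have form_zero: "?F i (u i) (\<lambda>x. 0) = 0" if "i \<in> {1..l}" for i
    by (rule coercive_space.form_zero[OF coercive[OF that] uH[OF that]])
  have HLp: "z \<in> Lp (2 * p) \<Omega>" if "z \<in> H" for z
    by (rule coercive_space.H_Lp[OF coercive[OF n] that])
  define \<alpha>' where "\<alpha>' h = (\<Sum>i\<in>block L h. 2 * ?F i (u i) (d i))" for h
  define b' where "b' h k = (\<Sum>i\<in>block L h. \<Sum>j\<in>block L k. \<beta> i j * (p * (?R i j + ?R j i)))" for h k
  have d\<alpha>: "((\<lambda>e. sqnorm (w e) h) has_real_derivative \<alpha>' h) (at 0)" if h: "h \<in> {1..q}" for h
    unfolding sqnorm_def \<alpha>'_def w_eq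
  proof (rule DERIV_sum)
    fix i assume "i \<in> block L h"
    then have i: "i \<in> {1..l}" using block_subset[OF h] by auto
    show "((\<lambda>e. (T i (\<lambda>x. u i x + e * d i x))\<^sup>2) has_real_derivative 2 * ?F i (u i) (d i)) (at 0)"
      by (rule coercive_space.T_sq_has_derivative[OF coercive[OF i] uH[OF i] dH])
  qed
  have db: "((\<lambda>e. coupling (w e) h k) has_real_derivative b' h k) (at 0)" if hk: "h \<in> {1..q}" "k \<in> {1..q}" for h k
    unfolding coupling_def b'_def w_eq
  proof (intro DERIV_sum DERIV_cmult)
    fix i j assume "i \<in> block L h" "j \<in> block L k"
    then have ij: "i \<in> {1..l}" "j \<in> {1..l}" using block_subset hk by blast+
    show "((\<lambda>e. interaction \<Omega> p (\<lambda>x. u i x + e * d i x) (\<lambda>x. u j x + e * d j x)) has_real_derivative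
        p * (?R i j + ?R j i)) (at 0)"
      by (rule interaction_has_derivative[OF p HLp[OF uH[OF ij(1)]] HLp[OF dH] HLp[OF uH[OF ij(2)]] HLp[OF dH]])
  qed
  have "1 / 2 * (\<Sum>h=1..q. \<alpha>' h) - 1 / (2 * p) * (\<Sum>h=1..q. \<Sum>k=1..q. b' h k) = 0"
  proof (rule fibre_envelope[where \<alpha> = "\<lambda>h e. sqnorm (w e) h" and b = "\<lambda>h k e. coupling (w e) h k" and I = "{1..q}" and p = p])
    show "coupling (w e) h k = coupling (w e) k h" if "h \<in> {1..q}" "k \<in> {1..q}" for h k e by (rule coupling_sym[OF that])
    show "coupling (w e) h k \<le> 0" if "h \<in> {1..q}" "k \<in> {1..q}" "h \<noteq> k" for h k e by (rule coupling_off[OF that])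
    show "0 < sqnorm (w 0) h" "(\<Sum>k=1..q. coupling (w 0) h k) = sqnorm (w 0) h" if "h \<in> {1..q}" for h
      using u that unfolding w0 by (auto simp: nehari_iff)
    fix e s assume pos: "\<And>h. h \<in> {1..q} \<Longrightarrow> 0 < sqnorm (w e) h"
      and crit: "fibre_critical p {1..q} (\<lambda>h. sqnorm (w e) h) (\<lambda>h k. coupling (w e) h k) s"
    have N: "scaled s (w e) \<in> nehari_set"
      using scaled_in_nehari[OF adm pos] crit by simp
    have "(1 / 2 - 1 / (2 * p)) * (\<Sum>h=1..q. sqnorm u h) \<le> (1 / 2 - 1 / (2 * p)) * (\<Sum>h=1..q. sqnorm (scaled s (w e)) h)"
      using min[OF N] p by (intro mult_left_mono) (auto simp: field_simps)
    also have "\<dots> = fibre p {1..q} (sqnorm (w e)) (coupling (w e)) s"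
      unfolding energy_nehari[OF N, symmetric]
      using crit by (intro energy_scaled adm) (auto simp: fibre_critical_def)
    finally show "(1 / 2 - 1 / (2 * p)) * (\<Sum>h=1..q. sqnorm (w 0) h) \<le> fibre p {1..q} (\<lambda>h. sqnorm (w e) h) (\<lambda>h k. coupling (w e) h k) s"
      unfolding w0 .
  qed (use p d\<alpha> db in auto)
  moreover have "(\<Sum>h=1..q. \<alpha>' h) = 2 * ?F n (u n) v"
  proof -
    have "(\<Sum>h=1..q. \<alpha>' h) = (\<Sum>i=1..l. 2 * ?F i (u i) (d i))" unfolding \<alpha>'_def by (rule sum_blocks)
    also have "\<dots> = (\<Sum>i=1..l. if i = n then 2 * ?F n (u n) v else 0)"
      by (intro sum.cong) (auto simp: d_def form_zero)
    finally show ?thesis using n by simp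
  qed
  moreover have "(\<Sum>h=1..q. \<Sum>k=1..q. b' h k) = 2 * p * (\<Sum>j=1..l. \<beta> n j * interaction_deriv \<Omega> p (u n) v (u j))"
  proof -
    have "(\<Sum>h=1..q. \<Sum>k=1..q. b' h k) = (\<Sum>h=1..q. \<Sum>i\<in>block L h. \<Sum>k=1..q. \<Sum>j\<in>block L k. \<beta> i j * (p * (?R i j + ?R j i)))"
      unfolding b'_def by (intro sum.cong refl sum.swap)
    also have "\<dots> = (\<Sum>i=1..l. \<Sum>j=1..l. \<beta> i j * (p * (?R i j + ?R j i)))"
      by (simp only: sum_blocks)
    also have "\<dots> = (\<Sum>i=1..l. \<Sum>j=1..l. p * (\<beta> i j * ?R i j)) + (\<Sum>i=1..l. \<Sum>j=1..l. p * (\<beta> i j * ?R j i))"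
      by (simp add: algebra_simps flip: sum.distrib)
    also have "(\<Sum>i=1..l. \<Sum>j=1..l. p * (\<beta> i j * ?R j i)) = (\<Sum>i=1..l. \<Sum>j=1..l. p * (\<beta> i j * ?R i j))"
      by (subst sum.swap) (intro sum.cong refl, simp add: \<beta>_sym)
    also have "(\<Sum>i=1..l. \<Sum>j=1..l. p * (\<beta> i j * ?R i j)) =
        (\<Sum>i=1..l. if i = n then (\<Sum>j=1..l. p * (\<beta> n j * interaction_deriv \<Omega> p (u n) v (u j))) else 0)"
      by (intro sum.cong) (auto simp: d_def interaction_deriv_zero)
    also have "\<dots> = p * (\<Sum>j=1..l. \<beta> n j * interaction_deriv \<Omega> p (u n) v (u j))"
      using n by (simp add: sum_distrib_left)
    finally show ?thesis by simp
  qed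
  ultimately have "?F n (u n) v = (\<Sum>j=1..l. \<beta> n j * interaction_deriv \<Omega> p (u n) v (u j))"
    using p by simp
  then show "(\<integral>x. wgrad \<Omega> (u n) x \<bullet> wgrad \<Omega> v x + lam n * u n x * v x \<partial>lebesgue_on \<Omega>)
      = (\<Sum>j=1..l. \<beta> n j * (\<integral>x. \<bar>u j x\<bar> powr p * (\<bar>u n x\<bar> powr (p - 2) * u n x) * v x \<partial>lebesgue_on \<Omega>))"
    unfolding coercive_space.form_def[OF coercive[OF n]] interaction_deriv_def .
qed

lemma nehari_blockwise_nontrivial:
  assumes "u \<in> nehari_set"
  shows "blockwise_nontrivial \<Omega> q L u"
  unfolding blockwise_nontrivial_def
proof (rule ballI, rule ccontr)
  fix h assume h: "h \<in> {1..q}" and "\<not> (\<exists>i\<in>block L h. \<not> (AE x in lebesgue_on \<Omega>. u i x = 0))"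
  then have AE: "AE x in lebesgue_on \<Omega>. u i x = 0" if "i \<in> block L h" for i using that by blast
  have "T i (u i) = 0" if i: "i \<in> block L h" for i
  proof -
    have i': "i \<in> {1..l}" using block_subset[OF h] i by auto
    have "u i \<in> H" using assms i' by (auto simp: nehari_iff admissible_def)
    then show ?thesis using coercive_space.T_eq_0_iff[OF coercive[OF i']] AE[OF i] by blast
  qed
  then have "sqnorm u h = 0" by (simp add: sqnorm_def)
  then show False using assms h by (force simp: nehari_iff)
qed

lemma least_energy_solution_exists: "\<exists>u. least_energy_solution \<Omega> H p l q lam \<beta> L u"
proof -
  obtain u where u: "u \<in> nehari_set" "\<And>w. w \<in> nehari_set \<Longrightarrow> (\<Sum>h=1..q. sqnorm u h) \<le> (\<Sum>h=1..q. sqnorm w h)"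
    using minimizer_exists by blast
  have "ereal (energy \<Omega> p l lam \<beta> u) = (INF w\<in>nehari_set. ereal (energy \<Omega> p l lam \<beta> w))"
  proof (rule antisym)
    show "ereal (energy \<Omega> p l lam \<beta> u) \<le> (INF w\<in>nehari_set. ereal (energy \<Omega> p l lam \<beta> w))"
    proof (rule INF_greatest)
      fix w assume w: "w \<in> nehari_set"
      have "energy \<Omega> p l lam \<beta> u \<le> energy \<Omega> p l lam \<beta> w"
        unfolding energy_nehari[OF u(1)] energy_nehari[OF w]
        using u(2)[OF w] p by (intro mult_left_mono) (auto simp: field_simps)
      then show "ereal (energy \<Omega> p l lam \<beta> u) \<le> ereal (energy \<Omega> p l lam \<beta> w)" by simp
    qed
    show "(INF w\<in>nehari_set. ereal (energy \<Omega> p l lam \<beta> w)) \<le> ereal (energy \<Omega> p l lam \<beta> u)"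
      by (rule INF_lower[OF u(1)])
  qed
  then show ?thesis
    unfolding least_energy_solution_def
    using minimizer_is_solution[OF u] nehari_blockwise_nontrivial[OF u(1)] by blast
qed

end

theorem theorem1p1:
  fixes \<Omega> :: "'a::euclidean_space set"
    and H :: "('a \<Rightarrow> real) set" and nrm :: "('a \<Rightarrow> real) \<Rightarrow> real"
    and l q :: nat and p :: real
    and lam :: "nat \<Rightarrow> real" and \<beta> :: "nat \<Rightarrow> nat \<Rightarrow> real" and L :: "nat \<Rightarrow> nat"
  assumes "DIM('a) \<ge> 3" and "l \<ge> 2" and "p > 1"
    and "open \<Omega>" and "\<Omega> \<noteq> {}"
    and "(H = H10 \<Omega> \<and> nrm = H1_norm \<Omega>) \<or> (H = D012 \<Omega> \<and> nrm = D12_norm \<Omega>)"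
    and "\<forall>i\<in>{1..l}. well_defined_coercive \<Omega> H nrm (lam i)"
    and "1 \<le> q" and "q \<le> l" and "block_decomposition l q L \<beta>"
    and "compactly_embedded_Lp \<Omega> H nrm (2 * p)"
  shows "\<exists>u. least_energy_solution \<Omega> H p l q lam \<beta> L u"
proof -
  obtain \<kappa> where \<kappa>: "H = H10 \<Omega> \<and> \<kappa> = 1 \<or> H = D012 \<Omega> \<and> \<kappa> = 0" "nrm = shifted_norm \<Omega> \<kappa>"
    using assms(6) by (auto simp: H1_norm_eq D12_norm_eq)
  interpret elliptic_system \<Omega> H \<kappa> p l q lam \<beta> L
  proof (rule elliptic_system.intro)
    show "coercive_space \<Omega> H \<kappa> (2 * p) (lam i)" if "i \<in> {1..l}" for i
      using assms(3,4,7,11) that \<kappa> by (intro coercive_space.intro) auto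
  qed (use assms in auto)
  show ?thesis by (rule least_energy_solution_exists)
qed

end
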